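(* Assume that the Weakened Minimal Resolution Conjecture (stated in the context) holds. Let $X\subseteq\mathbb{P}^1\times\mathbb{P}^2$ be a finite set of points, $|X|\ge 2$, in sufficiently general position. Then $S/I_X$ has a virtual resolution of length $3$ obtained from the virtual of a pair construction at $\mathbf{d}=(|X|-1,0)$; that is, the subcomplex of the minimal free resolution of $S/I_X$ consisting of all summands generated in degrees at most $\mathbf{d}+(1,2)=(|X|,2)$ is a virtual resolution of $S/I_X$ of length $3$.
   Context: $\Bbbk$ is an algebraically closed field and $S=\Bbbk[x_0,x_1,y_0,y_1,y_2]$ is the Cox ring of $\mathbb{P}^1\times\mathbb{P}^2$ over $\Bbbk$, with $\mathbb{Z}^2$-grading $\deg(x_i)=(1,0)$, $\deg(y_j)=(0,1)$; $B=\langle x_0,x_1\rangle\cap\langle y_0,y_1,y_2\rangle$. $I_X\subseteq S$ is the bihomogeneous vanishing ideal of $X$. The partial order on $\mathbb{Z}^2$ is $(i,j)\ge(i',j')$ iff $i\ge i'$ and $j\ge j'$. Virtual resolutions: $\Gamma_B(M)=\{u\in M\mid B^tu=0\text{ for some }t\in\mathbb{N}\}$. A $\mathbb{Z}^2$-graded complex of free $S$-modules $F_\bullet\colon F_0\leftarrow F_1\leftarrow\cdots$ is a virtual resolution of a finitely generated $\mathbb{Z}^2$-graded $S$-module $M$ if (1) for each $i>0$ there is some $t$ with $B^tH_i(F_\bullet)=0$, and (2) $H_0(F_\bullet)/\Gamma_B(H_0(F_\bullet))\cong M/\Gamma_B(M)$. The length of a complex is the largest $k$ with $F_k\ne0$.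 Hilbert matrices: $H_X(i,j)=\dim_{\Bbbk}(S/I_X)_{(i,j)}$ for $(i,j)\in\mathbb{Z}^2$. $X$ has a generic Hilbert matrix if $H_X(i,j)=\min\{|X|,\,(i+1)\binom{j+2}{2}\}$ for all $i,j\ge0$. For a matrix $H$ indexed by $\mathbb{Z}^2$, $(\Delta^CH)_{i,j}=H_{i,j}-H_{i-1,j}$, $(\Delta^RH)_{i,j}=H_{i,j}-H_{i,j-1}$, and $DH=(\Delta^C)^2(\Delta^R)^3H$. $\beta_{k,(i,j)}$ denotes the bigraded Betti numbers of $S/I_X$, i.e. the $k$-th module of its minimal free resolution is $\bigoplus_{(i,j)}S(-i,-j)^{\beta_{k,(i,j)}}$. Sufficiently general position: $X$ is in sufficiently general position if (1) $X$ has a generic Hilbert matrix, and (2) for every $(i,j)\ge(0,0)$ with $(i,j)\ne(0,0)$, one has $\beta_{1,(i,j)}>0$ if and only if [$DH_X(i,j)<0$ and $DH_X(i',j')\le0$ for all $(i',j')\le(i,j)$ with $(i',j')\ne(0,0)$]; and whenever this bracketed condition holds, $\beta_{1,(i,j)}=-DH_X(i,j)$. Weakened Minimal Resolution Conjecture: for every integer $N\ge2$ there exists a dense open subset $U\subseteq(\mathbb{P}^1\times\mathbb{P}^2)^N$ such that for every $(P_1,\dots,P_N)\in U$ the set $X=\{P_1,\dots,P_N\}$ satisfies (1) and (2) above. *)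

theory Defs
  imports
    "HOL-Analysis.Finite_Cartesian_Product"
    "HOL-Analysis.Abstract_Topology"
    "HOL-Computational_Algebra.Polynomial"
    "HOL-Library.Poly_Mapping"
    "HOL-Library.Product_Order"
    "HOL-Library.Product_Plus"
    "HOL-Algebra.AbelCoset"
    "HOL-Algebra.Module"
begin

section \<open>The Cox ring of the product of a projective line and a projective plane\<close>

type_synonym ('v, 'k) mpoly = "('v \<Rightarrow>\<^sub>0 nat) \<Rightarrow>\<^sub>0 'k"

text \<open>The variables are \<open>x\<^sub>i = Xv i\<close> (\<open>i = 0, 1\<close>) and \<open>y\<^sub>j = Yv j\<close> (\<open>j = 0, 1, 2\<close>); the
  index types are the numeral types, whose elements are the residues \<open>0, 1\<close> and \<open>0, 1, 2\<close>.\<close>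

datatype cox_var = Xv 2 | Yv 3

type_synonym 'k cox = "(cox_var, 'k) mpoly"

definition eval_mpoly :: "('v \<Rightarrow> 'k) \<Rightarrow> ('v, 'k::comm_ring_1) mpoly \<Rightarrow> 'k" where
  "eval_mpoly a f = (\<Sum>m\<in>Poly_Mapping.keys f. Poly_Mapping.lookup f m *
     (\<Prod>v\<in>Poly_Mapping.keys m. a v ^ Poly_Mapping.lookup m v))"

definition cox_deg :: "(cox_var \<Rightarrow> nat) \<Rightarrow> int \<times> int" where
  "cox_deg e = (\<Sum>i\<in>UNIV. int (e (Xv i)), \<Sum>j\<in>UNIV. int (e (Yv j)))"

definition cox_part :: "int \<times> int \<Rightarrow> 'k::zero cox set" where
  "cox_part d = {f. \<forall>m\<in>Poly_Mapping.keys f. cox_deg (Poly_Mapping.lookup m) = d}"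

definition cox_const :: "'k::zero \<Rightarrow> 'k cox" where
  "cox_const c = Poly_Mapping.single 0 c"

definition cox_gen :: "cox_var \<Rightarrow> 'k::zero_neq_one cox" where
  "cox_gen v = Poly_Mapping.single (Poly_Mapping.single v 1) 1"

abbreviation ideal_gen :: "'a::comm_ring_1 set \<Rightarrow> 'a set" where
  "ideal_gen A \<equiv> Modules.module.span (*) A"

primrec ideal_pow :: "'a::comm_ring_1 set \<Rightarrow> nat \<Rightarrow> 'a set" where
  "ideal_pow I 0 = UNIV"
| "ideal_pow I (Suc t) = ideal_gen {a * b | a b. a \<in> I \<and> b \<in> ideal_pow I t}"

definition irrelevant_ideal :: "'k::field cox set" where
  "irrelevant_ideal = ideal_gen (range (\<lambda>i. cox_gen (Xv i))) \<inter> ideal_gen (range (\<lambda>j. cox_gen (Yv j)))"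

definition maximal_graded_ideal :: "'k::field cox set" where
  "maximal_graded_ideal = ideal_gen (range cox_gen)"


section \<open>Points and their bihomogeneous vanishing ideals\<close>

definition proj_space :: "('k::field ^ 'n) set set" where
  "proj_space = (UNIV - {0}) // {(u, v). u \<noteq> 0 \<and> v \<noteq> 0 \<and> (\<exists>c. c \<noteq> 0 \<and> v = c *s u)}"

type_synonym 'k point = "('k ^ 2) set \<times> ('k ^ 3) set"

definition P1xP2 :: "'k::field point set" where
  "P1xP2 = proj_space \<times> proj_space"

definition homog_coords :: "(cox_var \<Rightarrow> 'k) \<Rightarrow> 'k point \<Rightarrow> bool" where
  "homog_coords a P \<longleftrightarrow> (\<chi> i. a (Xv i)) \<in> fst P \<and> (\<chi> j. a (Yv j)) \<in> snd P"

definition vanishing_ideal :: "'k::field point set \<Rightarrow> 'k cox set" where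
  "vanishing_ideal X = ideal_gen {f. (\<exists>d. f \<in> cox_part d) \<and>
     (\<forall>P\<in>X. \<forall>a. homog_coords a P \<longrightarrow> eval_mpoly a f = 0)}"


section \<open>Graded modules over the Cox ring\<close>

text \<open>The library record for modules inherits \<open>mult\<close> and \<open>one\<close> from rings; they have no meaning
  for a module and are left undefined throughout.\<close>

record ('a, 'b) graded_module = "('a, 'b) module" +
  part :: "int \<times> int \<Rightarrow> 'b set"

definition cox_module :: "('k::field cox, 'k cox) graded_module" where
  "cox_module = \<lparr>carrier = UNIV, mult = undefined, one = undefined, zero = 0, add = (+),
     smult = (*), part = cox_part\<rparr>"

definition submod :: "('a, 'b) graded_module \<Rightarrow> 'b set \<Rightarrow> ('a, 'b) graded_module" where
  "submod M U = M\<lparr>carrier := U, part := (\<lambda>d. part M d \<inter> U)\<rparr>"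

definition quot_mod :: "('a, 'b) graded_module \<Rightarrow> 'b set \<Rightarrow> ('a, 'b set) graded_module" where
  "quot_mod M N = \<lparr>carrier = a_rcosets\<^bsub>M\<^esub> N, mult = undefined, one = undefined,
     zero = N, add = set_add M,
     smult = (\<lambda>f C. \<Union>u\<in>C. N +>\<^bsub>M\<^esub> (f \<odot>\<^bsub>M\<^esub> u)),
     part = (\<lambda>d. (\<lambda>u. N +>\<^bsub>M\<^esub> u) ` part M d)\<rparr>"

definition graded_iso :: "('a, 'b) graded_module \<Rightarrow> ('a, 'c) graded_module \<Rightarrow> bool" where
  "graded_iso M N \<longleftrightarrow> (\<exists>h. bij_betw h (carrier M) (carrier N) \<and>
     (\<forall>u\<in>carrier M. \<forall>v\<in>carrier M. h (u \<oplus>\<^bsub>M\<^esub> v) = h u \<oplus>\<^bsub>N\<^esub> h v) \<and>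
     (\<forall>f. \<forall>u\<in>carrier M. h (f \<odot>\<^bsub>M\<^esub> u) = f \<odot>\<^bsub>N\<^esub> h u) \<and>
     (\<forall>d. h ` part M d = part N d))"

definition Gamma_B :: "('k::field cox, 'b) graded_module \<Rightarrow> 'b set" where
  "Gamma_B M = {u \<in> carrier M. \<exists>t. \<forall>b\<in>ideal_pow irrelevant_ideal t. b \<odot>\<^bsub>M\<^esub> u = \<zero>\<^bsub>M\<^esub>}"

definition part_basis :: "('k::field cox, 'b) graded_module \<Rightarrow> int \<times> int \<Rightarrow> 'b set \<Rightarrow> bool" where
  "part_basis M d E \<longleftrightarrow> finite E \<and> E \<subseteq> part M d \<and>
     (\<forall>u\<in>part M d. \<exists>!c. c \<in> E \<rightarrow>\<^sub>E (UNIV :: 'k set) \<and>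
        u = finsum M (\<lambda>e. cox_const (c e) \<odot>\<^bsub>M\<^esub> e) E)"

definition part_dim :: "('k::field cox, 'b) graded_module \<Rightarrow> int \<times> int \<Rightarrow> nat" where
  "part_dim M d = (THE n. \<exists>E. part_basis M d E \<and> card E = n)"

definition coord_ring :: "'k::field point set \<Rightarrow> ('k cox, 'k cox set) graded_module" where
  "coord_ring X = quot_mod cox_module (vanishing_ideal X)"


section \<open>Complexes of graded free modules\<close>

text \<open>\<open>F\<^sub>k\<close> is free on the finite set \<open>gens F k\<close>, the basis element \<open>g\<close> having degree \<open>gdeg F k g\<close>,
  so that \<open>F\<^sub>k\<close> is the direct sum of the \<open>S(- gdeg F k g)\<close>. The column \<open>c\<close> of the matrix
  \<open>diff F (Suc k)\<close> is the image of the basis element \<open>c\<close> under \<open>F\<^sub>k\<^sub>+\<^sub>1 \<rightarrow> F\<^sub>k\<close>; entries outside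
  \<open>gens F k \<times> gens F (Suc k)\<close>, as well as \<open>diff F 0\<close>, are never used.\<close>

record (overloaded) ('k::zero) free_complex =
  gens :: "nat \<Rightarrow> nat set"
  gdeg :: "nat \<Rightarrow> nat \<Rightarrow> int \<times> int"
  diff :: "nat \<Rightarrow> nat \<Rightarrow> nat \<Rightarrow> 'k cox"

definition free_mod :: "'k::field free_complex \<Rightarrow> nat \<Rightarrow> ('k cox, nat \<Rightarrow> 'k cox) graded_module" where
  "free_mod F k = (let V = {v. \<forall>g. g \<notin> gens F k \<longrightarrow> v g = 0} in
     \<lparr>carrier = V, mult = undefined, one = undefined,
      zero = (\<lambda>g. 0), add = (\<lambda>u v g. u g + v g), smult = (\<lambda>f v g. f * v g),
      part = (\<lambda>d. {v \<in> V. \<forall>g\<in>gens F k. v g \<in> cox_part (d - gdeg F k g)})\<rparr>)"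

text \<open>\<open>boundary F k\<close> is the map out of \<open>F\<^sub>k\<close>; on \<open>F\<^sub>0\<close> it is zero, so the cycles there are everything.\<close>

primrec boundary :: "'k::field free_complex \<Rightarrow> nat \<Rightarrow> (nat \<Rightarrow> 'k cox) \<Rightarrow> nat \<Rightarrow> 'k cox" where
  "boundary F 0 v = (\<lambda>r. 0)"
| "boundary F (Suc k) v =
     (\<lambda>r. if r \<in> gens F k then \<Sum>c\<in>gens F (Suc k). diff F (Suc k) r c * v c else 0)"

definition graded_free_complex :: "'k::field free_complex \<Rightarrow> bool" where
  "graded_free_complex F \<longleftrightarrow> (\<forall>k. finite (gens F k)) \<and>
     (\<forall>k. \<forall>r\<in>gens F k. \<forall>c\<in>gens F (Suc k).
        diff F (Suc k) r c \<in> cox_part (gdeg F (Suc k) c - gdeg F k r)) \<and>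
     (\<forall>k. \<forall>v\<in>carrier (free_mod F (Suc k)). boundary F k (boundary F (Suc k) v) = (\<lambda>r. 0))"

definition homology :: "'k::field free_complex \<Rightarrow> nat \<Rightarrow> ('k cox, (nat \<Rightarrow> 'k cox) set) graded_module" where
  "homology F k = quot_mod
     (submod (free_mod F k) {v \<in> carrier (free_mod F k). boundary F k v = (\<lambda>r. 0)})
     (boundary F (Suc k) ` carrier (free_mod F (Suc k)))"

definition complex_length :: "'k::zero free_complex \<Rightarrow> nat \<Rightarrow> bool" where
  "complex_length F n \<longleftrightarrow> gens F n \<noteq> {} \<and> (\<forall>k>n. gens F k = {})"

definition virtual_resolution ::
    "'k::field free_complex \<Rightarrow> ('k cox, 'b) graded_module \<Rightarrow> bool" where
  "virtual_resolution F M \<longleftrightarrow> graded_free_complex F \<and>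
     (\<forall>i>0. \<exists>t. \<forall>b\<in>ideal_pow irrelevant_ideal t. \<forall>u\<in>carrier (homology F i).
        b \<odot>\<^bsub>homology F i\<^esub> u = \<zero>\<^bsub>homology F i\<^esub>) \<and>
     graded_iso (quot_mod (homology F 0) (Gamma_B (homology F 0))) (quot_mod M (Gamma_B M))"

definition minimal_free_resolution ::
    "'k::field free_complex \<Rightarrow> ('k cox, 'b) graded_module \<Rightarrow> bool" where
  "minimal_free_resolution F M \<longleftrightarrow> graded_free_complex F \<and>
     (\<forall>i>0. carrier (homology F i) = {\<zero>\<^bsub>homology F i\<^esub>}) \<and>
     graded_iso (homology F 0) M \<and>
     (\<forall>k. \<forall>r\<in>gens F k. \<forall>c\<in>gens F (Suc k). diff F (Suc k) r c \<in> maximal_graded_ideal)"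

definition betti :: "('k::field cox, 'b) graded_module \<Rightarrow> nat \<Rightarrow> int \<times> int \<Rightarrow> nat" where
  "betti M k d = (THE n. \<exists>F. minimal_free_resolution F M \<and> n = card {g \<in> gens F k. gdeg F k g = d})"

text \<open>The order on \<open>int \<times> int\<close> is componentwise. A nonzero matrix entry forces the degree of the
  row to be at most that of the column, so the selected summands do form a subcomplex.\<close>

definition virtual_of_pair :: "'k::zero free_complex \<Rightarrow> int \<times> int \<Rightarrow> 'k free_complex" where
  "virtual_of_pair F d = F\<lparr>gens := (\<lambda>k. {g \<in> gens F k. gdeg F k g \<le> d + (1, 2)})\<rparr>"


section \<open>Sufficiently general position\<close>

definition hilbert_matrix :: "'k::field point set \<Rightarrow> int \<Rightarrow> int \<Rightarrow> int" where
  "hilbert_matrix X i j = int (part_dim (coord_ring X) (i, j))"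

definition generic_hilbert_matrix :: "'k::field point set \<Rightarrow> bool" where
  "generic_hilbert_matrix X \<longleftrightarrow> (\<forall>i j :: nat.
     hilbert_matrix X (int i) (int j) = int (min (card X) ((i + 1) * ((j + 2) choose 2))))"

definition delta_C :: "(int \<Rightarrow> int \<Rightarrow> int) \<Rightarrow> int \<Rightarrow> int \<Rightarrow> int" where
  "delta_C H i j = H i j - H (i - 1) j"

definition delta_R :: "(int \<Rightarrow> int \<Rightarrow> int) \<Rightarrow> int \<Rightarrow> int \<Rightarrow> int" where
  "delta_R H i j = H i j - H i (j - 1)"

definition diff_matrix :: "(int \<Rightarrow> int \<Rightarrow> int) \<Rightarrow> int \<Rightarrow> int \<Rightarrow> int" where
  "diff_matrix H = (delta_C ^^ 2) ((delta_R ^^ 3) H)"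

definition generator_degree :: "'k::field point set \<Rightarrow> int \<Rightarrow> int \<Rightarrow> bool" where
  "generator_degree X i j \<longleftrightarrow> diff_matrix (hilbert_matrix X) i j < 0 \<and>
     (\<forall>i' j'. (i', j') \<le> (i, j) \<and> (i', j') \<noteq> (0, 0) \<longrightarrow>
        diff_matrix (hilbert_matrix X) i' j' \<le> 0)"

definition sufficiently_general :: "'k::field point set \<Rightarrow> bool" where
  "sufficiently_general X \<longleftrightarrow> generic_hilbert_matrix X \<and>
     (\<forall>i j. (i, j) \<ge> (0, 0) \<and> (i, j) \<noteq> (0, 0) \<longrightarrow>
        (betti (coord_ring X) 1 (i, j) > 0 \<longleftrightarrow> generator_degree X i j) \<and>
        (generator_degree X i j \<longrightarrow>
           int (betti (coord_ring X) 1 (i, j)) = - diff_matrix (hilbert_matrix X) i j))"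


section \<open>The weakened Minimal Resolution Conjecture\<close>

text \<open>\<open>N\<close>-tuples of points are lists. The Zariski topology on them has as basic open sets the
  nonvanishing loci of the polynomials in the coordinates \<open>(i, v)\<close>, \<open>i < N\<close>, that are
  bihomogeneous in each of the \<open>N\<close> groups of variables.\<close>

definition point_tuples :: "nat \<Rightarrow> 'k::field point list set" where
  "point_tuples N = {Ps. length Ps = N \<and> set Ps \<subseteq> P1xP2}"

definition multihomogeneous :: "nat \<Rightarrow> (nat \<times> cox_var, 'k::field) mpoly \<Rightarrow> bool" where
  "multihomogeneous N f \<longleftrightarrow>
     (\<forall>m\<in>Poly_Mapping.keys f. Poly_Mapping.keys m \<subseteq> {..<N} \<times> UNIV) \<and>
     (\<exists>D. \<forall>m\<in>Poly_Mapping.keys f. \<forall>i<N. cox_deg (\<lambda>v. Poly_Mapping.lookup m (i, v)) = D i)"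

definition nonvanishing_locus ::
    "nat \<Rightarrow> (nat \<times> cox_var, 'k::field) mpoly \<Rightarrow> 'k point list set" where
  "nonvanishing_locus N f = {Ps \<in> point_tuples N.
     \<exists>a. (\<forall>i<N. homog_coords (\<lambda>v. a (i, v)) (Ps ! i)) \<and> eval_mpoly a f \<noteq> 0}"

definition zariski :: "nat \<Rightarrow> 'k::field point list topology" where
  "zariski N = topology_generated_by {nonvanishing_locus N f | f. multihomogeneous N f}"

definition weakened_mrc :: "'k::alg_closed_field itself \<Rightarrow> bool" where
  "weakened_mrc (_ :: 'k itself) \<longleftrightarrow> (\<forall>N\<ge>2. \<exists>U :: 'k point list set.
     openin (zariski N) U \<and> zariski N closure_of U = topspace (zariski N) \<and>
     (\<forall>Ps\<in>U. sufficiently_general (set Ps)))"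

end

theory Submission
  imports Defs "HOL-Library.Function_Algebras"
begin

text \<open>Let \<open>N = |X|\<close>. Every Betti number of \<open>S / I\<^sub>X\<close> is detected by Koszul homology: a minimal resolution has a
  generator of degree \<open>d\<close> in \<open>F\<^sub>k\<close> iff the \<open>k\<close>-th Koszul homology of \<open>S / I\<^sub>X\<close> in degree \<open>d\<close> is nonzero
  (shift dimensions along the resolution).

  Evaluation at the points embeds \<open>(S / I\<^sub>X)\<^sub>d\<close> into the functions on \<open>X\<close>. As the Hilbert matrix is generic, this
  is onto for \<open>d \<ge> (N - 1, 0)\<close>, for \<open>d \<ge> (0, N - 1)\<close> and for \<open>d = (N - 2, 1)\<close>, but not for \<open>d = (N - 2, 0)\<close>. On
  functions, Koszul complexes are contracted pointwise by a variable that does not vanish at the point.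
  Hence Koszul homology vanishes outside finitely many degrees, which makes minimal resolutions exist; it
  vanishes in \<open>x\<close>-degrees above \<open>N\<close>, and for \<open>k \<ge> 4\<close> in \<open>y\<close>-degrees at most 2; and it does not vanish for \<open>k = 3\<close>
  in degree \<open>(N, 2)\<close>. So the truncation \<open>F'\<close> at \<open>(N, 2)\<close> has length 3 and is just the truncation in \<open>y\<close>-degree.

  In \<open>x\<close>-degrees at least \<open>N - 1\<close> the Koszul homology on the variables \<open>y\<close> alone vanishes in \<open>y\<close>-degrees at least 3.
  Shifting dimensions along \<open>F'\<close> and inducting on the \<open>y\<close>-degree, \<open>F'\<close> is exact in these \<open>x\<close>-degrees, so its
  homology is killed by the power \<open>N - 1\<close> of the irrelevant ideal.\<close>

section \<open>Koszul complexes\<close>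

text \<open>The truncation \<open>F'\<close> need not be exact, and no bound on the length of
  \<open>F\<close> is given in advance. So everything is read off from the degrees in which
  generators can occur. The constants: the Hilbert function at \<open>(i, 0)\<close> is
  \<open>min N (i + 1)\<close>, so \<open>(N - 1, 0)\<close> is the first degree on the
  \<open>x\<close>-axis in which evaluation is onto. A Koszul complex lowers
  \<open>x\<close>-degrees by at most 2, so generators have \<open>x\<close>-degree below
  \<open>N - 1 + 2\<close>. There are three \<open>y\<close>-variables, and 2 is the last
  \<open>y\<close>-degree in which exterior monomials containing all of them have zero coefficients.
  In \<open>y\<close>-degrees at most 2 no discarded generator can contribute. In higher
  \<open>y\<close>-degrees \<open>F'\<close> has no generators, so its elements are built from lower
  \<open>y\<close>-degrees; this is what the induction on the \<open>y\<close>-degree uses. The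
  homology of \<open>F'\<close> at 0 is \<open>S / J\<close> for an ideal \<open>J\<close> that may
  be smaller than \<open>I\<^sub>X\<close>, as generators of \<open>F\<^sub>1\<close> may be lost.
  The quotient \<open>I\<^sub>X / J\<close> is torsion by exactness in large
  \<open>x\<close>-degrees, and it is all of the torsion, because an element that is killed by a
  power of the irrelevant ideal modulo \<open>I\<^sub>X\<close> vanishes at every point.\<close>

definition rank_of :: "'i::finite \<Rightarrow> nat" where
  "rank_of = (SOME r. inj r)"

lemma inj_rank_of: "inj (rank_of :: 'i::finite \<Rightarrow> nat)"
proof -
  have "\<exists>r :: 'i \<Rightarrow> nat. inj r"
    using finite_imp_inj_to_nat_seg[OF finite[of "UNIV :: 'i set"]] by blast
  then show ?thesis unfolding rank_of_def by (rule someI_ex)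
qed

definition sg :: "'i::finite \<Rightarrow> 'i set \<Rightarrow> 'm::ab_group_add \<Rightarrow> 'm" where
  "sg i A x = (if even (card {w\<in>A. rank_of w < rank_of i}) then x else - x)"

lemma sg_simps [simp]:
  "sg i A (sg i A x) = x" "sg i A 0 = 0" "sg i A (- x) = - sg i A x"
  by (auto simp: sg_def)

lemma sg_add: "sg i A (x + y) = sg i A x + sg i A y"
  and sg_diff: "sg i A (x - y) = sg i A x - sg i A y"
  by (auto simp: sg_def)

lemma sg_sum: "sg i A (sum f B) = (\<Sum>b\<in>B. sg i A (f b))"
  by (auto simp: sg_def sum_negf)

text \<open>This is the anticommutation of \<open>e\<^sub>i\<close> and \<open>e\<^sub>j\<close> on
  \<open>e\<^sub>A\<close>: of two distinct indices exactly one has the smaller rank, and inserting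
  that one changes the parity counted by the other.\<close>

lemma sg_swap:
  assumes "i \<noteq> j" "i \<notin> A" "j \<notin> A"
  shows "sg i A (sg j (insert i A) x) = - sg j A (sg i (insert j A) x)"
proof -
  have ne: "rank_of i \<noteq> rank_of j"
    using inj_rank_of assms(1) by (auto dest: injD)
  have ins: "card {w \<in> insert k A. rank_of w < rank_of l} =
      (if rank_of k < rank_of l then 1 else 0) + card {w \<in> A. rank_of w < rank_of l}" if "k \<notin> A" for k l
  proof -
    have "{w \<in> insert k A. rank_of w < rank_of l} =
      (if rank_of k < rank_of l then insert k {w \<in> A. rank_of w < rank_of l} else {w \<in> A. rank_of w < rank_of l})"
      by auto
    then show ?thesis using that by simp
  qed
  show ?thesis
    unfolding sg_def ins[OF assms(2)] ins[OF assms(3)] using ne by auto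
qed

text \<open>An element of a Koszul complex is given by its coefficients \<open>z A\<close> of the exterior monomials
  \<open>e\<^sub>A\<close>, and \<open>sg i A\<close> is multiplication by the sign in \<open>e\<^sub>i \<and> e\<^sub>A = \<plusminus> e\<^bsub>insert i A\<^esub>\<close> for the order given by
  \<open>rank_of\<close>.\<close>

definition kd :: "('i::finite \<Rightarrow> 'm \<Rightarrow> 'm) \<Rightarrow> 'i set \<Rightarrow> ('i set \<Rightarrow> 'm::ab_group_add) \<Rightarrow> 'i set \<Rightarrow> 'm" where
  "kd v J z A = (if A \<subseteq> J then \<Sum>i\<in>J - A. sg i A (v i (z (insert i A))) else 0)"

text \<open>Additivity and commutation suffice, so one theory covers multiplication by variables on
  polynomials (\<open>gmul\<close>) and on vectors (\<open>fmul\<close>), and multiplication by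
  coordinates on functions on the points (\<open>pmul\<close>).\<close>

locale commuting_ops =
  fixes v :: "'i::finite \<Rightarrow> 'm::ab_group_add \<Rightarrow> 'm"
  assumes op_add: "v i (x + y) = v i x + v i y"
    and op_commute: "v i (v j x) = v j (v i x)"
begin

lemma op_zero [simp]: "v i 0 = 0"
  using op_add[of i 0 0] by simp

lemma op_neg: "v i (- x) = - v i x"
  using op_add[of i x "- x"] by (simp add: eq_neg_iff_add_eq_0 add.commute)

lemma op_diff: "v i (x - y) = v i x - v i y"
  using op_add[of i x "- y"] by (simp add: op_neg)

lemma op_sum: "v i (sum f B) = (\<Sum>b\<in>B. v i (f b))"
  by (induction B rule: infinite_finite_induct) (auto simp: op_add)

lemma op_sg: "v i (sg j A x) = sg j A (v i x)"
  by (simp add: sg_def op_neg)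

lemma kd_add: "kd v J (\<lambda>A. z A + w A) A = kd v J z A + kd v J w A"
  by (simp add: kd_def op_add sg_add sum.distrib)

lemma kd_diff: "kd v J (\<lambda>A. z A - w A) A = kd v J z A - kd v J w A"
  by (simp add: kd_def op_diff sg_diff sum_subtractf)

lemma kd_zero: "kd v J (\<lambda>A. 0) A = 0" "kd v J 0 A = 0"
  by (simp_all add: kd_def)

lemma kd_sum: "kd v J (\<lambda>A. \<Sum>b\<in>B. z b A) A = (\<Sum>b\<in>B. kd v J (z b) A)"
  by (induction B rule: infinite_finite_induct) (auto simp: kd_add kd_zero)

lemma kd_kd: "kd v J (kd v J z) A = 0"
proof (cases "A \<subseteq> J")
  case True
  define f where "f i l = sg i A (sg l (insert i A) (v i (v l (z (insert l (insert i A))))))" for i l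
  have anti: "f i l + f l i = 0" if "i \<in> J - A" "l \<in> J - A" "i \<noteq> l" for i l
    using that sg_swap[of i l A "v l (v i (z (insert l (insert i A))))"]
    by (simp add: f_def op_commute[of i l] insert_commute[of i l])
  \<comment> \<open>Splitting the ordered pairs by rank pairs every term with its negative. Showing
    that the whole sum equals its own negative would not be enough in characteristic 2.\<close>
  define R where "R = {(i, l). i \<in> J - A \<and> l \<in> J - A \<and> rank_of i < rank_of l}"
  define R' where "R' = {(i, l). i \<in> J - A \<and> l \<in> J - A \<and> rank_of l < rank_of i}"
  have fin: "finite R" "finite R'" by simp_all
  have "kd v J (kd v J z) A = (\<Sum>i\<in>J - A. \<Sum>l\<in>J - insert i A. f i l)"
    using True by (simp add: kd_def f_def op_sum sg_sum op_sg)
  also have "\<dots> = (\<Sum>(i, l)\<in>(SIGMA i:J - A. J - insert i A). f i l)"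
    by (rule sum.Sigma) auto
  also have "(SIGMA i:J - A. J - insert i A) = R \<union> R'"
  proof -
    have "rank_of i < rank_of l \<or> rank_of l < rank_of i" if "i \<noteq> l" for i l :: 'i
      using inj_rank_of that by (meson injD linorder_neqE_nat)
    then show ?thesis unfolding R_def R'_def by blast
  qed
  also have "(\<Sum>(i, l)\<in>R \<union> R'. f i l) = (\<Sum>(i, l)\<in>R. f i l) + (\<Sum>(i, l)\<in>R'. f i l)"
    by (rule sum.union_disjoint) (auto simp: R_def R'_def)
  also have "(\<Sum>(i, l)\<in>R'. f i l) = (\<Sum>(i, l)\<in>R. f l i)"
    by (rule sum.reindex_bij_witness[of _ prod.swap prod.swap]) (auto simp: R_def R'_def)
  also have "(\<Sum>(i, l)\<in>R. f i l) + (\<Sum>(i, l)\<in>R. f l i) = (\<Sum>(i, l)\<in>R. f i l + f l i)"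
    by (simp add: sum.distrib case_prod_unfold)
  also have "\<dots> = 0"
    by (rule sum.neutral) (auto simp: R_def intro!: anti)
  finally show ?thesis .
qed (simp add: kd_def)

text \<open>This is the identity \<open>d (e\<^sub>j \<and> q z) + e\<^sub>j \<and> q (d z) = v\<^sub>j q z\<close>, for cycles \<open>z\<close>; \<open>q\<close> need not
  commute with \<open>v\<^sub>j\<close>.\<close>

lemma kd_homotopy:
  fixes q :: "'m \<Rightarrow> 'm"
  assumes "j \<in> J" "A \<subseteq> J"
    and q_add: "\<And>x y. q (x + y) = q x + q y"
    and q_comm: "\<And>i x. i \<in> J \<Longrightarrow> i \<noteq> j \<Longrightarrow> q (v i x) = v i (q x)"
    and cyc: "\<And>A. kd v J z A = 0"
  shows "kd v J (\<lambda>B. if j \<in> B then sg j (B - {j}) (q (z (B - {j}))) else 0) A =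
    (if j \<in> A then q (v j (z A)) else v j (q (z A)))"
proof (cases "j \<in> A")
  case False
  have "kd v J (\<lambda>B. if j \<in> B then sg j (B - {j}) (q (z (B - {j}))) else 0) A =
    (\<Sum>i\<in>J - A. if i = j then v j (q (z A)) else 0)"
    unfolding kd_def if_P[OF assms(2)] using False
    by (intro sum.cong) (auto simp: op_sg)
  then show ?thesis using False assms(1) by simp
next
  case True
  define C where "C = A - {j}"
  have A: "A = insert j C" "j \<notin> C" using True by (auto simp: C_def)
  have q0: "q 0 = 0" using q_add[of 0 0] by simp
  have q_neg: "q (- x) = - q x" for x
    using q_add[of x "- x"] q0 by (simp add: eq_neg_iff_add_eq_0 add.commute)
  have q_sum: "q (sum f B) = (\<Sum>b\<in>B. q (f b))" for f :: "'i \<Rightarrow> 'm" and B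
    by (induction B rule: infinite_finite_induct) (auto simp: q_add q0)
  have q_sg: "q (sg i B x) = sg i B (q x)" for i B x
    by (simp add: sg_def q_neg)
  have ins: "J - C = insert j (J - A)" using assms(1) A by auto
  \<comment> \<open>The cycle condition at \<open>A - {j}\<close>, solved for its
    \<open>j\<close>-term, expresses \<open>v j (z A)\<close> by the terms with
    \<open>i \<in> J - A\<close>; these are the terms of the differential to be computed, up to the
    anticommutation sign.\<close>
  have "kd v J z C = 0" by (rule cyc)
  then have "sg j C (v j (z A)) = - (\<Sum>i\<in>J - A. sg i C (v i (z (insert i C))))"
    using assms(2) A(2) unfolding kd_def ins by (simp add: A(1) eq_neg_iff_add_eq_0)
  then have "q (sg j C (sg j C (v j (z A)))) = q (sg j C (- (\<Sum>i\<in>J - A. sg i C (v i (z (insert i C))))))"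
    by simp
  then have 1: "q (v j (z A)) = - (\<Sum>i\<in>J - A. sg j C (sg i C (q (v i (z (insert i C))))))"
    by (simp add: q_neg q_sg q_sum sg_sum)
  have "kd v J (\<lambda>B. if j \<in> B then sg j (B - {j}) (q (z (B - {j}))) else 0) A =
    (\<Sum>i\<in>J - A. sg i A (v i (sg j (insert i C) (q (z (insert i C))))))"
    unfolding kd_def using assms(2) A
    by (auto intro!: sum.cong simp: insert_Diff_if)
  also have "\<dots> = (\<Sum>i\<in>J - A. - sg j C (sg i C (q (v i (z (insert i C))))))"
  proof (rule sum.cong[OF refl])
    fix i assume i: "i \<in> J - A"
    have "sg i A (sg j (insert i C) y) = - sg j C (sg i C y)" for y :: 'm
    proof -
      have "sg j C (sg i A (sg j (insert i C) y)) = - sg i C y"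
        using sg_swap[of j i C "sg j (insert i C) y"] i A by auto
      then have "sg j C (sg j C (sg i A (sg j (insert i C) y))) = sg j C (- sg i C y)"
        by (rule arg_cong)
      then show ?thesis by simp
    qed
    then show "sg i A (v i (sg j (insert i C) (q (z (insert i C))))) =
        - sg j C (sg i C (q (v i (z (insert i C)))))"
      using i q_comm[of i] A by (auto simp: op_sg)
  qed
  finally show ?thesis using 1 True by (simp add: sum_negf)
qed

end

section \<open>Homogeneous Koszul chains and the vanishing of their homology\<close>

definition kel :: "('i::finite \<Rightarrow> 'd::ab_group_add) \<Rightarrow> 'i set \<Rightarrow> ('d \<Rightarrow> 'm::ab_group_add set) \<Rightarrow>
    nat \<Rightarrow> 'd \<Rightarrow> ('i set \<Rightarrow> 'm) set" where
  "kel \<delta> J T a d = {z. \<forall>A. if A \<subseteq> J \<and> card A = a then z A \<in> T (d - sum \<delta> A) else z A = 0}"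

text \<open>Vanishing of the \<open>a\<close>-th Koszul homology, in degree \<open>d\<close>, of the quotient \<open>T / I\<close>.\<close>

definition kex :: "('i::finite \<Rightarrow> 'm \<Rightarrow> 'm) \<Rightarrow> ('i \<Rightarrow> 'd::ab_group_add) \<Rightarrow> 'i set \<Rightarrow>
    ('d \<Rightarrow> 'm::ab_group_add set) \<Rightarrow> 'm set \<Rightarrow> nat \<Rightarrow> 'd \<Rightarrow> bool" where
  "kex v \<delta> J T I a d \<longleftrightarrow> (\<forall>z\<in>kel \<delta> J T a d. (\<forall>A. kd v J z A \<in> I) \<longrightarrow>
     (\<exists>u\<in>kel \<delta> J T (Suc a) d. \<forall>A. z A - kd v J u A \<in> I))"

lemma kel_in: "z \<in> kel \<delta> J T a d \<Longrightarrow> A \<subseteq> J \<Longrightarrow> card A = a \<Longrightarrow> z A \<in> T (d - sum \<delta> A)"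
  by (auto simp: kel_def)

lemma kel_zero: "z \<in> kel \<delta> J T a d \<Longrightarrow> \<not> (A \<subseteq> J \<and> card A = a) \<Longrightarrow> z A = 0"
  unfolding kel_def by (metis (mono_tags, lifting) mem_Collect_eq)

lemma kelI: "(\<And>A. A \<subseteq> J \<Longrightarrow> card A = a \<Longrightarrow> z A \<in> T (d - sum \<delta> A)) \<Longrightarrow>
    (\<And>A. \<not> (A \<subseteq> J \<and> card A = a) \<Longrightarrow> z A = 0) \<Longrightarrow> z \<in> kel \<delta> J T a d"
  by (auto simp: kel_def)

lemma kel_mono: "(\<And>e. T e \<subseteq> T' e) \<Longrightarrow> kel \<delta> J T a d \<subseteq> kel \<delta> J T' a d"
  by (auto intro!: kelI dest: kel_in kel_zero)

lemma kel_0_iff: "z \<in> kel \<delta> J T 0 d \<longleftrightarrow> z {} \<in> T d \<and> (\<forall>A. A \<noteq> {} \<longrightarrow> z A = 0)"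
  for z :: "'i::finite set \<Rightarrow> 'm::ab_group_add"
  unfolding kel_def by (auto simp: card_eq_0_iff finite)

locale graded_ops = commuting_ops v for v :: "'i::finite \<Rightarrow> 'm::ab_group_add \<Rightarrow> 'm" +
  fixes \<delta> :: "'i \<Rightarrow> 'd::ab_group_add" and T :: "'d \<Rightarrow> 'm set"
  assumes gr_zero: "0 \<in> T e"
    and gr_diff: "x \<in> T e \<Longrightarrow> y \<in> T e \<Longrightarrow> x - y \<in> T e"
    and gr_op: "x \<in> T e \<Longrightarrow> v i x \<in> T (e + \<delta> i)"
begin

lemma gr_neg: "x \<in> T e \<Longrightarrow> - x \<in> T e"
  using gr_diff[of 0 e x] gr_zero by simp

lemma gr_add: "x \<in> T e \<Longrightarrow> y \<in> T e \<Longrightarrow> x + y \<in> T e"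
  using gr_diff[of x e "- y"] gr_neg by simp

lemma gr_sum: "(\<And>b. b \<in> B \<Longrightarrow> f b \<in> T e) \<Longrightarrow> sum f B \<in> T e"
  by (induction B rule: infinite_finite_induct) (auto simp: gr_zero gr_add)

lemma gr_sg: "x \<in> T e \<Longrightarrow> sg i A x \<in> T e"
  by (auto simp: sg_def gr_neg)

lemma kd_kel: assumes "z \<in> kel \<delta> J T (Suc a) d" shows "kd v J z \<in> kel \<delta> J T a d"
proof (rule kelI)
  fix A assume A: "A \<subseteq> J" "card A = a"
  have "v i (z (insert i A)) \<in> T (d - sum \<delta> A)" if "i \<in> J - A" for i
    using gr_op[OF kel_in[OF assms, of "insert i A"], of i] that A
    by (simp add: algebra_simps)
  then show "kd v J z A \<in> T (d - sum \<delta> A)"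
    using A by (auto simp: kd_def intro!: gr_sum gr_sg)
next
  fix A assume "\<not> (A \<subseteq> J \<and> card A = a)"
  then have "z (insert i A) = 0" if "A \<subseteq> J" "i \<in> J - A" for i
    using that by (intro kel_zero[OF assms]) (auto simp: card_insert_if finite_subset)
  then show "kd v J z A = 0"
    by (auto simp: kd_def intro!: sum.neutral)
qed

lemma kel_diff: "z \<in> kel \<delta> J T a d \<Longrightarrow> w \<in> kel \<delta> J T a d \<Longrightarrow> (\<lambda>A. z A - w A) \<in> kel \<delta> J T a d"
  by (rule kelI) (simp_all only: kel_in gr_diff kel_zero diff_self simp_thms)

lemma kd_kel_1: "u \<in> kel \<delta> J T (Suc 0) d \<Longrightarrow> A \<noteq> {} \<Longrightarrow> kd v J u A = 0"
  using kel_zero[OF kd_kel] by (metis card_0_eq finite)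

text \<open>In exterior degree 0 every chain is a cycle, so vanishing means that \<open>T d\<close>,
  modulo \<open>I\<close>, is generated from lower degrees by the operators. This is the form in
  which Nakayama arguments use it.\<close>

lemma kex_0_iff:
  assumes "0 \<in> I"
  shows "kex v \<delta> J T I 0 d \<longleftrightarrow> (\<forall>x\<in>T d. \<exists>u\<in>kel \<delta> J T (Suc 0) d. x - kd v J u {} \<in> I)"
proof
  assume kex: "kex v \<delta> J T I 0 d"
  show "\<forall>x\<in>T d. \<exists>u\<in>kel \<delta> J T (Suc 0) d. x - kd v J u {} \<in> I"
  proof
    fix x assume x: "x \<in> T d"
    define z where "z = (\<lambda>A :: 'i set. if A = {} then x else 0)"
    have z: "z \<in> kel \<delta> J T 0 d" using x by (simp add: kel_0_iff z_def)
    have "\<forall>A. kd v J z A \<in> I" using assms by (simp add: kd_def z_def)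
    then obtain u where "u \<in> kel \<delta> J T (Suc 0) d" "z {} - kd v J u {} \<in> I"
      using kex z unfolding kex_def by blast
    then show "\<exists>u\<in>kel \<delta> J T (Suc 0) d. x - kd v J u {} \<in> I" by (auto simp: z_def)
  qed
next
  assume red: "\<forall>x\<in>T d. \<exists>u\<in>kel \<delta> J T (Suc 0) d. x - kd v J u {} \<in> I"
  show "kex v \<delta> J T I 0 d"
    unfolding kex_def
  proof (intro ballI impI)
    fix z assume z: "z \<in> kel \<delta> J T 0 d"
    then obtain u where u: "u \<in> kel \<delta> J T (Suc 0) d" "z {} - kd v J u {} \<in> I"
      using red by (auto simp: kel_0_iff)
    have "z A - kd v J u A \<in> I" for A
      using u(2) kd_kel_1[OF u(1), of A] z assms by (cases "A = {}") (auto simp: kel_0_iff)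
    then show "\<exists>u\<in>kel \<delta> J T (Suc 0) d. \<forall>A. z A - kd v J u A \<in> I" using u(1) by blast
  qed
qed

end

text \<open>A homomorphism from \<open>G\<close> to the quotient \<open>T / I\<close>, expressed
  without the quotient. It is used with \<open>I\<close> the ideal for augmentations and with
  \<open>I = {0}\<close> for boundary maps.\<close>

locale graded_hom = G: graded_ops vm \<delta> G + T: graded_ops vn \<delta> T
  for vm :: "'i::finite \<Rightarrow> 'm::ab_group_add \<Rightarrow> 'm" and vn :: "'i \<Rightarrow> 'n::ab_group_add \<Rightarrow> 'n"
    and \<delta> :: "'i \<Rightarrow> 'd::ab_group_add" and G T +
  fixes D :: "'m \<Rightarrow> 'n" and I :: "'n set"
  assumes D_diff: "D (x - y) = D x - D y"
    and D_op: "D (vm i x) = vn i (D x)"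
    and D_deg: "x \<in> G e \<Longrightarrow> D x \<in> T e"
    and I_zero: "0 \<in> I"
    and I_diff: "p \<in> I \<Longrightarrow> q \<in> I \<Longrightarrow> p - q \<in> I"
    and I_op: "p \<in> I \<Longrightarrow> vn i p \<in> I"
begin

lemma D_zero [simp]: "D 0 = 0"
  using D_diff[of 0 0] by simp

lemma D_neg: "D (- x) = - D x"
  using D_diff[of 0 x] by simp

lemma D_add: "D (x + y) = D x + D y"
  using D_diff[of x "- y"] by (simp add: D_neg)

lemma D_sum: "D (sum f B) = (\<Sum>b\<in>B. D (f b))"
  by (induction B rule: infinite_finite_induct) (auto simp: D_add)

lemma D_sg: "D (sg i A x) = sg i A (D x)"
  by (simp add: sg_def D_neg)

lemma D_kd: "D (kd vm J w A) = kd vn J (\<lambda>A. D (w A)) A"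
  by (simp add: kd_def D_sum D_sg D_op)

lemma I_neg: "x \<in> I \<Longrightarrow> - x \<in> I"
  using I_diff[of 0 x] I_zero by simp

lemma I_add: "x \<in> I \<Longrightarrow> y \<in> I \<Longrightarrow> x + y \<in> I"
  using I_diff[of x "- y"] I_neg by simp

lemma I_kd: "(\<And>A. z A \<in> I) \<Longrightarrow> kd vn J z A \<in> I"
proof -
  assume z: "\<And>A. z A \<in> I"
  have "sum f B \<in> I" if "\<And>b. b \<in> B \<Longrightarrow> f b \<in> I" for f :: "'i \<Rightarrow> 'n" and B
    using that by (induction B rule: infinite_finite_induct) (auto simp: I_zero I_add)
  moreover have "sg i A x \<in> I" if "x \<in> I" for i x
    using that by (auto simp: sg_def I_neg)
  ultimately show ?thesis
    unfolding kd_def using z by (auto simp: I_zero I_op)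
qed

lemma D_kel: "w \<in> kel \<delta> J G a d \<Longrightarrow> (\<lambda>A. D (w A)) \<in> kel \<delta> J T a d"
  by (rule kelI) (simp_all only: kel_in D_deg kel_zero D_zero simp_thms)

lemma lift_kel:
  assumes onto: "\<And>A u. A \<subseteq> J \<Longrightarrow> card A = a \<Longrightarrow> u \<in> T (d - sum \<delta> A) \<Longrightarrow>
      \<exists>x\<in>G (d - sum \<delta> A). u - D x \<in> I"
    and u: "u \<in> kel \<delta> J T a d"
  obtains u' where "u' \<in> kel \<delta> J G a d" "\<And>A. u A - D (u' A) \<in> I"
proof -
  have "\<forall>A. \<exists>x. (A \<subseteq> J \<and> card A = a \<longrightarrow> x \<in> G (d - sum \<delta> A)) \<and>
      (\<not> (A \<subseteq> J \<and> card A = a) \<longrightarrow> x = 0) \<and> u A - D x \<in> I"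
  proof
    fix A
    show "\<exists>x. (A \<subseteq> J \<and> card A = a \<longrightarrow> x \<in> G (d - sum \<delta> A)) \<and>
      (\<not> (A \<subseteq> J \<and> card A = a) \<longrightarrow> x = 0) \<and> u A - D x \<in> I"
    proof (cases "A \<subseteq> J \<and> card A = a")
      case True
      then show ?thesis using onto kel_in[OF u] by blast
    next
      case False
      then show ?thesis using kel_zero[OF u False] by (auto simp: I_zero)
    qed
  qed
  then obtain u' where "\<forall>A. (A \<subseteq> J \<and> card A = a \<longrightarrow> u' A \<in> G (d - sum \<delta> A)) \<and>
      (\<not> (A \<subseteq> J \<and> card A = a) \<longrightarrow> u' A = 0) \<and> u A - D (u' A) \<in> I"
    by metis
  then show ?thesis by (intro that[of u'] kelI) auto
qed

lemma lift_kd: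
  assumes "\<And>A u. A \<subseteq> J \<Longrightarrow> card A = Suc a \<Longrightarrow> u \<in> T (d - sum \<delta> A) \<Longrightarrow>
      \<exists>x\<in>G (d - sum \<delta> A). u - D x \<in> I"
    and "u \<in> kel \<delta> J T (Suc a) d"
  obtains u' where "u' \<in> kel \<delta> J G (Suc a) d" "\<And>A. kd vn J u A - D (kd vm J u' A) \<in> I"
proof -
  obtain u' where u': "u' \<in> kel \<delta> J G (Suc a) d" "\<And>A. u A - D (u' A) \<in> I"
    using lift_kel[OF assms] by blast
  show ?thesis
    by (rule that[OF u'(1)]) (simp add: D_kd T.kd_diff[symmetric] I_kd u'(2))
qed

text \<open>The image \<open>D x\<close> is a combination of operator multiples modulo
  \<open>I\<close>; subtracting a lift of that combination from \<open>x\<close> leaves an element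
  of the kernel. Applied to a basis element, this will contradict minimality.\<close>

lemma reduce_into_kernel:
  assumes onto: "\<And>A u. A \<subseteq> J \<Longrightarrow> card A = Suc 0 \<Longrightarrow> u \<in> T (d - sum \<delta> A) \<Longrightarrow>
      \<exists>x\<in>G (d - sum \<delta> A). u - D x \<in> I"
    and T: "kex vn \<delta> J T I 0 d" and x: "x \<in> G d"
  shows "\<exists>w. x - kd vm J w {} \<in> {x \<in> G d. D x \<in> I}"
proof -
  obtain u where u: "u \<in> kel \<delta> J T (Suc 0) d" "D x - kd vn J u {} \<in> I"
    using T D_deg[OF x] by (auto simp: T.kex_0_iff I_zero)
  obtain u' where u': "u' \<in> kel \<delta> J G (Suc 0) d" "\<And>A. kd vn J u A - D (kd vm J u' A) \<in> I"
    using lift_kd[OF onto u(1)] by blast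
  have "D (x - kd vm J u' {}) = (D x - kd vn J u {}) + (kd vn J u {} - D (kd vm J u' {}))"
    by (simp add: D_diff)
  also have "\<dots> \<in> I" by (rule I_add[OF u(2) u'(2)])
  finally show ?thesis
    using x kel_in[OF G.kd_kel[OF u'(1)], of "{}"] by (intro exI[of _ u']) (auto intro: G.gr_diff)
qed

lemma kex_kernel:
  assumes onto: "\<And>A u. A \<subseteq> J \<Longrightarrow> card A = Suc (Suc a) \<Longrightarrow> u \<in> T (d - sum \<delta> A) \<Longrightarrow>
      \<exists>x\<in>G (d - sum \<delta> A). u - D x \<in> I"
    and free: "\<And>z. z \<in> kel \<delta> J G a d \<Longrightarrow> (\<And>A. kd vm J z A = 0) \<Longrightarrow> (\<And>A. D (z A) \<in> I) \<Longrightarrow>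
      \<exists>w\<in>kel \<delta> J G (Suc a) d. \<forall>A. kd vm J w A = z A"
    and T: "kex vn \<delta> J T I (Suc a) d"
  shows "kex vm \<delta> J (\<lambda>e. {x \<in> G e. D x \<in> I}) {0} a d"
  unfolding kex_def
proof (intro ballI impI)
  fix z assume z: "z \<in> kel \<delta> J (\<lambda>e. {x \<in> G e. D x \<in> I}) a d" and "\<forall>A. kd vm J z A \<in> {0}"
  then have cyc: "kd vm J z A = 0" for A by simp
  have zG: "z \<in> kel \<delta> J G a d"
    using z kel_mono[of "\<lambda>e. {x \<in> G e. D x \<in> I}" G] by blast
  have DzI: "D (z A) \<in> I" for A
    using kel_in[OF z, of A] kel_zero[OF z, of A] I_zero by (cases "A \<subseteq> J \<and> card A = a") auto
  obtain w where w: "w \<in> kel \<delta> J G (Suc a) d" "\<And>A. kd vm J w A = z A"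
    using free[OF zG cyc DzI] by blast
  have "\<forall>A. kd vn J (\<lambda>A. D (w A)) A \<in> I"
    using DzI by (simp add: D_kd[symmetric] w(2))
  then obtain u where u: "u \<in> kel \<delta> J T (Suc (Suc a)) d" "\<And>A. D (w A) - kd vn J u A \<in> I"
    using T D_kel[OF w(1)] unfolding kex_def by blast
  obtain u' where u': "u' \<in> kel \<delta> J G (Suc (Suc a)) d" "\<And>A. u A - D (u' A) \<in> I"
    using lift_kel[OF onto u(1)] by blast
  define w' where "w' = (\<lambda>A. w A - kd vm J u' A)"
  have w'G: "w' \<in> kel \<delta> J G (Suc a) d"
    unfolding w'_def by (intro G.kel_diff w(1) G.kd_kel u'(1))
  have "D (w' A) \<in> I" for A
  proof -
    have "D (w' A) = (D (w A) - kd vn J u A) + kd vn J (\<lambda>A. u A - D (u' A)) A"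
      by (simp add: w'_def D_diff D_kd T.kd_diff)
    then show ?thesis using u(2) u'(2) by (auto intro: I_add I_kd)
  qed
  then have "w' \<in> kel \<delta> J (\<lambda>e. {x \<in> G e. D x \<in> I}) (Suc a) d"
    using w'G by (auto intro!: kelI dest: kel_in kel_zero)
  moreover have "z A - kd vm J w' A = 0" for A
    by (simp add: w'_def G.kd_diff G.kd_kd w(2))
  ultimately show "\<exists>u\<in>kel \<delta> J (\<lambda>e. {x \<in> G e. D x \<in> I}) (Suc a) d. \<forall>A. z A - kd vm J u A \<in> {0}"
    by blast
qed

lemma kex_image:
  assumes onto: "\<And>A u. A \<subseteq> J \<Longrightarrow> card A = Suc a \<Longrightarrow> u \<in> T (d - sum \<delta> A) \<Longrightarrow>
      \<exists>x\<in>G (d - sum \<delta> A). u - D x \<in> I"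
    and free: "kex vm \<delta> J G {0} (Suc a) d"
    and Z: "kex vm \<delta> J (\<lambda>e. {x \<in> G e. D x \<in> I}) {0} a d"
  shows "kex vn \<delta> J T I (Suc a) d"
  unfolding kex_def
proof (intro ballI impI)
  fix z assume z: "z \<in> kel \<delta> J T (Suc a) d" and cyc: "\<forall>A. kd vn J z A \<in> I"
  obtain w where w: "w \<in> kel \<delta> J G (Suc a) d" "\<And>A. z A - D (w A) \<in> I"
    using lift_kel[OF onto z] by blast
  have DdwI: "D (kd vm J w A) \<in> I" for A
  proof -
    have "kd vn J (\<lambda>A. D (w A)) A = kd vn J z A - kd vn J (\<lambda>A. z A - D (w A)) A"
      by (simp add: T.kd_diff)
    then show ?thesis
      unfolding D_kd using I_diff I_kd cyc w(2) by simp
  qed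
  have dwZ: "kd vm J w \<in> kel \<delta> J (\<lambda>e. {x \<in> G e. D x \<in> I}) a d"
    using G.kd_kel[OF w(1)] DdwI by (auto intro!: kelI dest: kel_in kel_zero)
  then have "\<exists>c\<in>kel \<delta> J (\<lambda>e. {x \<in> G e. D x \<in> I}) (Suc a) d. \<forall>A. kd vm J w A - kd vm J c A \<in> {0}"
    using Z[unfolded kex_def, rule_format, OF dwZ] G.kd_kd by simp
  then obtain c where c: "c \<in> kel \<delta> J (\<lambda>e. {x \<in> G e. D x \<in> I}) (Suc a) d"
    "\<And>A. kd vm J w A = kd vm J c A"
    by auto
  have cG: "c \<in> kel \<delta> J G (Suc a) d"
    using c(1) kel_mono[of "\<lambda>e. {x \<in> G e. D x \<in> I}" G] by blast
  have DcI: "D (c A) \<in> I" for A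
    using kel_in[OF c(1), of A] kel_zero[OF c(1), of A] I_zero
    by (cases "A \<subseteq> J \<and> card A = Suc a") auto
  have "(\<lambda>A. w A - c A) \<in> kel \<delta> J G (Suc a) d"
    by (rule G.kel_diff[OF w(1) cG])
  moreover have "\<forall>A. kd vm J (\<lambda>A. w A - c A) A \<in> {0}"
    by (simp add: G.kd_diff c(2))
  ultimately obtain b where b: "b \<in> kel \<delta> J G (Suc (Suc a)) d" "\<And>A. w A - c A = kd vm J b A"
    using free unfolding kex_def by (metis (no_types, lifting) eq_iff_diff_eq_0 singletonD)
  have "z A - kd vn J (\<lambda>A. D (b A)) A \<in> I" for A
  proof -
    have "z A - kd vn J (\<lambda>A. D (b A)) A = (z A - D (w A)) + D (c A)"
      by (simp add: D_kd[symmetric] b(2)[symmetric] D_diff)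
    also have "\<dots> \<in> I" by (rule I_add[OF w(2) DcI])
    finally show ?thesis .
  qed
  then show "\<exists>u\<in>kel \<delta> J T (Suc (Suc a)) d. \<forall>A. z A - kd vn J u A \<in> I"
    using D_kel[OF b(1)] by blast
qed

end

section \<open>The grading of the Cox ring\<close>

abbreviation "lk \<equiv> Poly_Mapping.lookup"
abbreviation "ks \<equiv> Poly_Mapping.keys"
abbreviation "mdeg m \<equiv> cox_deg (lk m)"

instance cox_var :: finite
proof
  have "(UNIV :: cox_var set) = range Xv \<union> range Yv"
    by (auto intro: cox_var.exhaust)
  moreover have "finite (range Xv \<union> range Yv)" by simp
  ultimately show "finite (UNIV :: cox_var set)" by metis
qed

primrec vdeg :: "cox_var \<Rightarrow> int \<times> int" where
  "vdeg (Xv i) = (1, 0)"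
| "vdeg (Yv j) = (0, 1)"

lemma mdeg_add: "mdeg (m + n) = mdeg m + mdeg n"
  by (simp add: cox_deg_def lookup_add sum.distrib)

lemma mdeg_0 [simp]: "mdeg 0 = 0"
  by (simp add: cox_deg_def zero_prod_def)

lemma mdeg_single [simp]: "mdeg (Poly_Mapping.single v 1) = vdeg v"
  by (cases v) (simp_all add: cox_deg_def lookup_single when_def if_distrib[of int] cong: if_cong)

lemmas mdeg_single' [simp] = mdeg_single[simplified]

lemma mdeg_ge_0: "0 \<le> mdeg m"
  by (auto simp: cox_deg_def zero_prod_def intro: sum_nonneg)

lemma mdeg_eq_0_iff: "mdeg m = 0 \<longleftrightarrow> m = 0"
proof
  assume "mdeg m = 0"
  then have "lk m (Xv i) = 0" "lk m (Yv j) = 0" for i j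
    by (auto simp: cox_deg_def zero_prod_def sum_nonneg_eq_0_iff)
  then have "lk m v = 0" for v by (cases v) auto
  then show "m = 0" by (intro poly_mapping_eqI) simp
qed simp

lemma poly_mapping_sum_single: "f = (\<Sum>m\<in>ks f. Poly_Mapping.single m (lk f m))"
proof (rule poly_mapping_eqI)
  fix k
  have "lk (\<Sum>m\<in>ks f. Poly_Mapping.single m (lk f m)) k = (\<Sum>m\<in>ks f. if m = k then lk f k else 0)"
    unfolding lookup_sum by (rule sum.cong) (auto simp: lookup_single when_def)
  also have "\<dots> = lk f k"
    by (simp add: in_keys_iff)
  finally show "lk f k = lk (\<Sum>m\<in>ks f. Poly_Mapping.single m (lk f m)) k" by simp
qed

lemma cox_partD: "f \<in> cox_part d \<Longrightarrow> lk f m \<noteq> 0 \<Longrightarrow> mdeg m = d"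
  by (auto simp: cox_part_def in_keys_iff)

lemma cox_partI: "(\<And>m. lk f m \<noteq> 0 \<Longrightarrow> mdeg m = d) \<Longrightarrow> f \<in> cox_part d"
  by (auto simp: cox_part_def in_keys_iff)

lemma cox_part_0 [simp]: "0 \<in> cox_part d"
  by (auto simp: cox_part_def)

lemma cox_part_add: "f \<in> cox_part d \<Longrightarrow> g \<in> cox_part d \<Longrightarrow> f + g \<in> cox_part d"
  for f g :: "'k::field cox"
  by (rule cox_partI) (metis add_0 cox_partD lookup_add)

lemma cox_part_diff: "f \<in> cox_part d \<Longrightarrow> g \<in> cox_part d \<Longrightarrow> f - g \<in> cox_part d"
  for f g :: "'k::field cox"
  by (rule cox_partI) (metis cox_partD lookup_minus right_minus_eq)

lemma cox_part_sum: "(\<And>b. b \<in> B \<Longrightarrow> f b \<in> cox_part d) \<Longrightarrow> sum f B \<in> cox_part d"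
  for f :: "'b \<Rightarrow> 'k::field cox"
  by (induction B rule: infinite_finite_induct) (auto intro: cox_part_add)

lemma cox_part_mult: "f \<in> cox_part d \<Longrightarrow> g \<in> cox_part e \<Longrightarrow> f * g \<in> cox_part (d + e)"
  for f g :: "'k::field cox"
  unfolding cox_part_def using keys_mult[of f g] by (fastforce simp: mdeg_add)

lemma cox_part_gen [simp]: "cox_gen v \<in> cox_part (vdeg v)"
  by (simp add: cox_part_def cox_gen_def)

lemma cox_part_const [simp]: "cox_const c \<in> cox_part 0"
  by (simp add: cox_part_def cox_const_def)

lemma cox_part_const_mult: "f \<in> cox_part d \<Longrightarrow> cox_const c * f \<in> cox_part d"
  for f :: "'k::field cox"
  using cox_part_mult[OF cox_part_const, of f d c] by simp

lemma cox_part_one [simp]: "(1 :: 'k::field cox) \<in> cox_part 0"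
  by (auto simp: cox_part_def)

lemma cox_part_not_ge_0: "\<not> 0 \<le> d \<Longrightarrow> f \<in> cox_part d \<Longrightarrow> f = 0"
  using mdeg_ge_0 cox_partD[of f d] by (metis lookup_zero poly_mapping_eqI)

lemma cox_part_0_const: "f \<in> cox_part 0 \<Longrightarrow> f = cox_const (lk f 0)"
proof (rule poly_mapping_eqI)
  fix k assume "f \<in> cox_part 0"
  then show "lk f k = lk (cox_const (lk f 0)) k"
    using cox_partD[of f 0 k] mdeg_eq_0_iff[of k] by (auto simp: cox_const_def lookup_single when_def)
qed

lemma cox_const_simps [simp]:
  "cox_const 0 = 0" "cox_const 1 = 1" "lk (cox_const c) 0 = c"
  by (simp_all add: cox_const_def)

lemma cox_const_add: "cox_const (a + b) = cox_const a + cox_const b"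
  and cox_const_mult: "cox_const (a * b) = (cox_const a * cox_const b :: 'k::field cox)"
  by (simp_all add: cox_const_def single_add mult_single)

lemma lookup_single_mult:
  fixes f :: "('a::cancel_comm_monoid_add) \<Rightarrow>\<^sub>0 'b::comm_semiring_1"
  shows "lk (Poly_Mapping.single k c * f) m = (\<Sum>n\<in>ks f. if k + n = m then c * lk f n else 0)"
proof -
  have "Poly_Mapping.single k c * f = (\<Sum>n\<in>ks f. Poly_Mapping.single (k + n) (c * lk f n))"
    by (subst poly_mapping_sum_single[of f]) (simp add: sum_distrib_left mult_single)
  then show ?thesis
    by (simp add: lookup_sum lookup_single when_def)
qed

lemma lookup_single_mult_add:
  fixes f :: "('a::cancel_comm_monoid_add) \<Rightarrow>\<^sub>0 'b::comm_semiring_1"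
  shows "lk (Poly_Mapping.single k c * f) (k + m) = c * lk f m"
  unfolding lookup_single_mult by (simp add: in_keys_iff)

text \<open>The subtraction of exponents is truncated, so monomials without \<open>v\<close> have to
  be separated.\<close>

lemma lookup_gen_mult: "lk (cox_gen v * f) m =
    (if lk m v = 0 then 0 else lk (f :: 'k::field cox) (m - Poly_Mapping.single v 1))"
proof (cases "lk m v = 0")
  case True
  then have "Poly_Mapping.single v 1 + n \<noteq> m" for n
    by (metis add_is_0 lookup_add lookup_single_eq one_neq_zero)
  then show ?thesis using True by (simp add: cox_gen_def lookup_single_mult)
next
  case False
  then have "m = Poly_Mapping.single v 1 + (m - Poly_Mapping.single v 1)"
    by (intro poly_mapping_eqI) (auto simp: lookup_add lookup_minus lookup_single when_def)
  then show ?thesis using False lookup_single_mult_add[of "Poly_Mapping.single v 1" 1 f "m - Poly_Mapping.single v 1"]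
    by (simp add: cox_gen_def)
qed

text \<open>Exponents add up to 0 only if both are 0. Hence constant coefficients multiply, and
  minimality can be tested on the constant coefficients of matrix entries.\<close>

lemma lookup_mult_0: "lk (f * g) 0 = lk f 0 * lk (g :: 'k::field cox) 0"
proof -
  have "lk (f * g) 0 = (\<Sum>m\<in>ks f. lk (Poly_Mapping.single m (lk f m) * g) 0)"
    by (subst poly_mapping_sum_single[of f]) (simp add: sum_distrib_right lookup_sum)
  also have "\<dots> = (\<Sum>m\<in>ks f. if m = 0 then lk f 0 * lk g 0 else 0)"
  proof (rule sum.cong[OF refl])
    fix m assume "m \<in> ks f"
    have "m + n = 0 \<longleftrightarrow> m = 0 \<and> n = 0" for n :: "cox_var \<Rightarrow>\<^sub>0 nat"
      by (auto simp: poly_mapping_eq_iff fun_eq_iff lookup_add)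
    then show "lk (Poly_Mapping.single m (lk f m) * g) 0 = (if m = 0 then lk f 0 * lk g 0 else 0)"
      by (auto simp: lookup_single_mult in_keys_iff)
  qed
  also have "\<dots> = lk f 0 * lk g 0" by (simp add: in_keys_iff)
  finally show ?thesis .
qed

lemma cox_gen_add_single: "lk (cox_gen v * f) (m + Poly_Mapping.single v 1) = lk (f :: 'k::field cox) m"
  by (simp add: lookup_gen_mult lookup_add)

subsection \<open>Homogeneous components\<close>

definition hc :: "int \<times> int \<Rightarrow> 'k::field cox \<Rightarrow> 'k cox" where
  "hc d f = (\<Sum>m\<in>{m \<in> ks f. mdeg m = d}. Poly_Mapping.single m (lk f m))"

lemma lookup_hc: "lk (hc d f) m = (if mdeg m = d then lk f m else 0)"
proof -
  have "lk (hc d f) m = (\<Sum>n\<in>{n \<in> ks f. mdeg n = d}. if n = m then lk f m else 0)"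
    unfolding hc_def lookup_sum by (rule sum.cong) (auto simp: lookup_single when_def)
  then show ?thesis by (auto simp: in_keys_iff)
qed

lemma hc_part [simp]: "hc d f \<in> cox_part d"
  by (rule cox_partI) (auto simp: lookup_hc split: if_splits)

lemma hc_add: "hc d (f + g) = hc d f + hc d g"
  by (rule poly_mapping_eqI) (simp add: lookup_hc lookup_add)

lemma hc_0 [simp]: "hc d 0 = 0"
  by (rule poly_mapping_eqI) (simp add: lookup_hc)

lemma hc_diff: "hc d (f - g) = hc d f - hc d g"
  by (rule poly_mapping_eqI) (simp add: lookup_hc lookup_minus)

lemma hc_sum: "hc d (sum f B) = (\<Sum>b\<in>B. hc d (f b))"
  by (induction B rule: infinite_finite_induct) (auto simp: hc_add)

lemma hc_of_part: "f \<in> cox_part e \<Longrightarrow> hc d f = (if d = e then f else 0)"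
  by (rule poly_mapping_eqI) (auto simp: lookup_hc dest: cox_partD)

lemma sum_hc: assumes "finite E" "mdeg ` ks f \<subseteq> E" shows "f = (\<Sum>e\<in>E. hc e f)"
proof (rule poly_mapping_eqI)
  fix m
  have "lk (\<Sum>e\<in>E. hc e f) m = (\<Sum>e\<in>E. if e = mdeg m then lk f m else 0)"
    by (simp add: lookup_sum lookup_hc eq_commute)
  then show "lk f m = lk (\<Sum>e\<in>E. hc e f) m"
    using assms by (cases "m \<in> ks f") (auto simp: in_keys_iff)
qed

lemma hc_mult: assumes "a \<in> cox_part d" shows "hc e (a * f) = a * hc (e - d) f"
proof -
  define E where "E = insert (e - d) (mdeg ` ks f)"
  have E: "finite E" "f = (\<Sum>x\<in>E. hc x f)"
    by (auto simp: E_def intro!: sum_hc)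
  have "hc e (a * f) = (\<Sum>x\<in>E. hc e (a * hc x f))"
    by (subst E(2)) (simp add: sum_distrib_left hc_sum)
  also have "\<dots> = (\<Sum>x\<in>E. if x = e - d then a * hc x f else 0)"
  proof (rule sum.cong[OF refl])
    fix x
    show "hc e (a * hc x f) = (if x = e - d then a * hc x f else 0)"
      using hc_of_part[OF cox_part_mult[OF assms hc_part], of e x f] by (auto simp: algebra_simps)
  qed
  also have "\<dots> = a * hc (e - d) f" using E(1) by (simp add: E_def)
  finally show ?thesis .
qed

section \<open>Exactness of Koszul complexes on variables\<close>

abbreviation gmul :: "cox_var \<Rightarrow> 'k::field cox \<Rightarrow> 'k cox" where
  "gmul i f \<equiv> cox_gen i * f"

interpretation cox: graded_ops gmul vdeg "cox_part :: int \<times> int \<Rightarrow> 'k::field cox set"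
  by unfold_locales
    (auto simp: algebra_simps intro: cox_part_diff, metis add.commute cox_part_gen cox_part_mult)

text \<open>\<open>qop j\<close> divides by the variable \<open>j\<close> and discards the monomials that do not contain it; in
  Koszul complexes it yields a contraction onto the part free of \<open>j\<close>.\<close>

definition qop :: "cox_var \<Rightarrow> 'k::field cox \<Rightarrow> 'k cox" where
  "qop j f = Poly_Mapping.map_key (\<lambda>m. m + Poly_Mapping.single j 1) f"

lemma lookup_qop: "lk (qop j f) m = lk f (m + Poly_Mapping.single j 1)"
  unfolding qop_def by (subst map_key.rep_eq) (auto intro: injI)

lemma qop_add: "qop j (f + g) = qop j f + qop j g"
  by (rule poly_mapping_eqI) (simp add: lookup_qop lookup_add)

lemma qop_0 [simp]: "qop j 0 = 0"
  by (rule poly_mapping_eqI) (simp add: lookup_qop)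

lemma qop_gmul_same: "qop j (gmul j f) = f"
  by (rule poly_mapping_eqI) (simp add: lookup_qop cox_gen_add_single[simplified])

lemma qop_gmul: assumes "i \<noteq> j" shows "qop j (gmul i f) = gmul i (qop j f)"
proof (rule poly_mapping_eqI)
  fix m
  show "lk (qop j (gmul i f)) m = lk (gmul i (qop j f)) m"
  proof (cases "lk m i = 0")
    case True
    then show ?thesis using assms by (simp add: lookup_qop lookup_gen_mult lookup_add lookup_single)
  next
    case False
    then have "m + Poly_Mapping.single j 1 - Poly_Mapping.single i 1 =
        m - Poly_Mapping.single i 1 + Poly_Mapping.single j 1"
      using assms by (intro poly_mapping_eqI) (auto simp: lookup_add lookup_minus lookup_single when_def)
    then show ?thesis using False assms
      by (simp add: lookup_qop lookup_gen_mult lookup_add lookup_single)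
  qed
qed

lemma qop_part: "f \<in> cox_part d \<Longrightarrow> qop j f \<in> cox_part (d - vdeg j)"
  by (rule cox_partI) (auto simp: lookup_qop mdeg_add dest!: cox_partD)

lemma lookup_gmul_qop: "lk (gmul j (qop j f)) m = (if lk m j = 0 then 0 else lk f m)"
proof (cases "lk m j = 0")
  case False
  then have "m - Poly_Mapping.single j 1 + Poly_Mapping.single j 1 = m"
    by (intro poly_mapping_eqI) (auto simp: lookup_add lookup_minus lookup_single when_def)
  then show ?thesis using False by (simp add: lookup_gen_mult lookup_qop)
qed (simp add: lookup_gen_mult)

text \<open>The variables of \<open>J'\<close> are treated one at a time. The homotopy of
  \<open>qop j\<close> removes from a cycle the coefficients at sets containing \<open>j\<close> and
  all monomials containing \<open>j\<close>; it introduces no variable removed earlier. For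
  \<open>J' = J\<close> only the part at the empty set that is free of \<open>J\<close> survives, up
  to boundaries.\<close>

lemma koszul_contract:
  fixes z :: "cox_var set \<Rightarrow> 'k::field cox"
  assumes z: "z \<in> kel vdeg J cox_part a d" "\<And>A. kd gmul J z A = 0" and "J' \<subseteq> J"
  shows "\<exists>w\<in>kel vdeg J cox_part (Suc a) d. (\<forall>A. A \<inter> J' \<noteq> {} \<longrightarrow> z A - kd gmul J w A = 0) \<and>
    (\<forall>A m v. v \<in> J' \<longrightarrow> lk m v \<noteq> 0 \<longrightarrow> lk (z A - kd gmul J w A) m = 0)"
  using finite[of J'] \<open>J' \<subseteq> J\<close>
proof (induction J' rule: finite_induct)
  case empty
  have "(\<lambda>A. 0) \<in> kel vdeg J cox_part (Suc a) d"
    by (rule kelI) auto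
  then show ?case by (auto simp: cox.kd_zero intro!: bexI[of _ "\<lambda>A. 0"])
next
  case (insert j J')
  then obtain w where w: "w \<in> kel vdeg J cox_part (Suc a) d"
    "\<forall>A. A \<inter> J' \<noteq> {} \<longrightarrow> z A - kd gmul J w A = 0"
    "\<forall>A m v. v \<in> J' \<longrightarrow> lk m v \<noteq> 0 \<longrightarrow> lk (z A - kd gmul J w A) m = 0"
    by auto
  define y where "y = (\<lambda>A. z A - kd gmul J w A)"
  have y: "y \<in> kel vdeg J cox_part a d"
    unfolding y_def by (intro cox.kel_diff z(1) cox.kd_kel w(1))
  have ycyc: "kd gmul J y A = 0" for A
    by (simp add: y_def cox.kd_diff z(2) cox.kd_kd)
  define s where "s = (\<lambda>B. if j \<in> B then sg j (B - {j}) (qop j (y (B - {j}))) else 0)"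
  have s: "s \<in> kel vdeg J cox_part (Suc a) d"
  proof (rule kelI)
    fix A assume A: "A \<subseteq> J" "card A = Suc a"
    show "s A \<in> cox_part (d - sum vdeg A)"
    proof (cases "j \<in> A")
      case True
      have "y (A - {j}) \<in> cox_part (d - sum vdeg (A - {j}))"
        using A True by (intro kel_in[OF y]) auto
      then have "qop j (y (A - {j})) \<in> cox_part (d - sum vdeg (A - {j}) - vdeg j)"
        by (rule qop_part)
      then show ?thesis using True
        by (auto simp: s_def sum.remove[OF finite, of j A] algebra_simps intro!: cox.gr_sg)
    qed (simp add: s_def)
  next
    fix A assume A: "\<not> (A \<subseteq> J \<and> card A = Suc a)"
    have "y (A - {j}) = 0" if "j \<in> A"
      using A that insert.prems card_Suc_Diff1[OF finite that] by (intro kel_zero[OF y]) auto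
    then show "s A = 0" by (simp add: s_def)
  qed
  \<comment> \<open>Since \<open>qop j\<close> undoes multiplication by \<open>j\<close>, the
    homotopy reproduces \<open>y A\<close> when \<open>j \<in> A\<close>; otherwise it yields the
    part of \<open>y A\<close> divisible by \<open>j\<close>.\<close>
  have ds: "kd gmul J s A = (if j \<in> A then y A else gmul j (qop j (y A)))" if "A \<subseteq> J" for A
    unfolding s_def using insert.prems that
    by (subst cox.kd_homotopy[of j J A "qop j" y]) (auto simp: qop_add qop_gmul qop_gmul_same ycyc)
  have out: "y A = 0" if "\<not> A \<subseteq> J" for A using kel_zero[OF y] that by blast
  have "(\<lambda>A. w A + s A) \<in> kel vdeg J cox_part (Suc a) d"
    by (rule kelI) (simp_all only: kel_in[OF w(1)] kel_in[OF s] cox_part_add kel_zero[OF w(1)] kel_zero[OF s] add_0 simp_thms)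
  moreover have eq: "z A - kd gmul J (\<lambda>A. w A + s A) A = y A - kd gmul J s A" for A
    by (simp add: cox.kd_add y_def)
  moreover have "y A - kd gmul J s A = 0" if "A \<inter> insert j J' \<noteq> {}" for A
  proof (cases "A \<subseteq> J \<and> j \<notin> A")
    case True
    then have "y A = 0" using w(2) that by (auto simp: y_def)
    then show ?thesis using True ds by simp
  qed (use ds out in \<open>auto simp: kd_def\<close>)
  moreover have "lk (y A - kd gmul J s A) m = 0" if v: "v \<in> insert j J'" "lk m v \<noteq> 0" for A m v
  proof (cases "A \<subseteq> J \<and> j \<notin> A")
    case True
    then have "lk (y A - kd gmul J s A) m = (if lk m j = 0 then lk (y A) m else 0)"
      by (simp add: ds lookup_minus lookup_gmul_qop)
    moreover have "z A - kd gmul J w A = y A" by (simp add: y_def)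
    ultimately show ?thesis using w(3)[rule_format, of v m A] v by (auto split: if_splits)
  qed (use ds out in \<open>auto simp: kd_def\<close>)
  ultimately show ?case unfolding eq[symmetric] by blast
qed

lemma kex_cox:
  assumes "0 < a" shows "kex gmul vdeg J (cox_part :: _ \<Rightarrow> 'k::field cox set) {0} a d"
  unfolding kex_def
proof (intro ballI impI)
  fix z :: "cox_var set \<Rightarrow> 'k cox"
  assume z: "z \<in> kel vdeg J cox_part a d" and "\<forall>A. kd gmul J z A \<in> {0}"
  then have "kd gmul J z A = 0" for A by simp
  from koszul_contract[OF z this order_refl] obtain w
    where w: "w \<in> kel vdeg J cox_part (Suc a) d" "\<forall>A. A \<inter> J \<noteq> {} \<longrightarrow> z A - kd gmul J w A = 0" by (elim bexE conjE) (rule that)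
  have "z A = kd gmul J w A" for A
  proof (cases "A \<subseteq> J \<and> A \<noteq> {}")
    case False
    then have "\<not> (A \<subseteq> J \<and> card A = a)" using assms by auto
    then show ?thesis using kel_zero[OF z, of A] kel_zero[OF cox.kd_kel[OF w(1)], of A] by argo
  qed (use w(2) in \<open>auto simp: Int_absorb2\<close>)
  then show "\<exists>u\<in>kel vdeg J cox_part (Suc a) d. \<forall>A. z A - kd gmul J u A \<in> {0}"
    using w(1) by auto
qed

text \<open>A polynomial at the empty set is a Koszul cycle. After contraction the difference has no
  monomial involving \<open>J\<close>, while \<open>f\<close> and every boundary consist only of
  such monomials, so the difference is 0.\<close>

lemma cox_part_in_vars:
  fixes f :: "'k::field cox"
  assumes "f \<in> cox_part d" "\<And>m. lk f m \<noteq> 0 \<Longrightarrow> \<exists>v\<in>J. lk m v \<noteq> 0"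
  shows "\<exists>w\<in>kel vdeg J cox_part (Suc 0) d. kd gmul J w {} = f"
proof -
  define z where "z = (\<lambda>A::cox_var set. if A = {} then f else 0)"
  have z: "z \<in> kel vdeg J cox_part 0 d" using assms(1) by (simp add: kel_0_iff z_def)
  have "kd gmul J z A = 0" for A by (simp add: kd_def z_def)
  from koszul_contract[OF z this order_refl] obtain w
    where w: "w \<in> kel vdeg J cox_part (Suc 0) d"
      "\<forall>A m v. v \<in> J \<longrightarrow> lk m v \<noteq> 0 \<longrightarrow> lk (z A - kd gmul J w A) m = 0" by (elim bexE conjE) (rule that)
  have dw: "kd gmul J w {} = (\<Sum>i\<in>J. sg i {} (gmul i (w {i})))" by (simp add: kd_def)
  have "lk (kd gmul J w {}) m = 0" if "\<And>v. v \<in> J \<Longrightarrow> lk m v = 0" for m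
    unfolding dw lookup_sum using that by (intro sum.neutral) (auto simp: sg_def lookup_gen_mult)
  then have "lk (f - kd gmul J w {}) m = 0" for m
    using w(2)[rule_format, of _ m "{}"] assms(2)[of m]
    by (cases "\<exists>v\<in>J. lk m v \<noteq> 0") (auto simp: z_def lookup_minus)
  then have "f = kd gmul J w {}"
    by (metis eq_iff_diff_eq_0 lookup_zero poly_mapping_eqI)
  then show ?thesis using w(1) by auto
qed

section \<open>Graded free modules\<close>

definition fcar :: "nat set \<Rightarrow> (nat \<Rightarrow> 'k::field cox) set" where
  "fcar G = {v. \<forall>g. g \<notin> G \<longrightarrow> v g = 0}"

definition fpart :: "nat set \<Rightarrow> (nat \<Rightarrow> int \<times> int) \<Rightarrow> int \<times> int \<Rightarrow> (nat \<Rightarrow> 'k::field cox) set" where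
  "fpart G \<gamma> d = {v \<in> fcar G. \<forall>g\<in>G. v g \<in> cox_part (d - \<gamma> g)}"

definition fmul :: "cox_var \<Rightarrow> (nat \<Rightarrow> 'k::field cox) \<Rightarrow> nat \<Rightarrow> 'k cox" where
  "fmul i v = (\<lambda>g. gmul i (v g))"

lemma fpart_cox_part: "v \<in> fpart G \<gamma> d \<Longrightarrow> v g \<in> cox_part (d - \<gamma> g)"
  by (cases "g \<in> G") (auto simp: fpart_def fcar_def)

lemma fpart_fcar: "v \<in> fpart G \<gamma> d \<Longrightarrow> v \<in> fcar G"
  by (simp add: fpart_def)

interpretation fm: graded_ops fmul vdeg "fpart G \<gamma> :: int \<times> int \<Rightarrow> (nat \<Rightarrow> 'k::field cox) set" for G \<gamma>
proof
  fix i j e and x y :: "nat \<Rightarrow> 'k cox"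
  show "fmul i (x + y) = fmul i x + fmul i y" "fmul i (fmul j x) = fmul j (fmul i x)"
    by (auto simp: fmul_def fun_eq_iff algebra_simps)
  show "0 \<in> fpart G \<gamma> e" by (auto simp: fpart_def fcar_def)
  show "x - y \<in> fpart G \<gamma> e" if "x \<in> fpart G \<gamma> e" "y \<in> fpart G \<gamma> e"
    using that by (auto simp: fpart_def fcar_def intro: cox_part_diff)
  show "fmul i x \<in> fpart G \<gamma> (e + vdeg i)" if "x \<in> fpart G \<gamma> e"
  proof -
    have "gmul i (x g) \<in> cox_part (e + vdeg i - \<gamma> g)" if "g \<in> G" for g
      using cox.gr_op[of "x g" "e - \<gamma> g" i] \<open>x \<in> fpart G \<gamma> e\<close> that
      by (simp add: fpart_def algebra_simps)
    then show ?thesis using that by (auto simp: fpart_def fcar_def fmul_def)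
  qed
qed

lemma fun_zero [simp]: "(\<lambda>x. 0) = (0 :: 'a \<Rightarrow> 'b::zero)"
  by (simp add: zero_fun_def)

lemma sg_apply: "sg i A v g = sg i A (v g)" for v :: "'b \<Rightarrow> 'm::ab_group_add"
  by (simp add: sg_def)

lemma sum_apply: "sum f B g = (\<Sum>b\<in>B. f b g)" for f :: "'a \<Rightarrow> 'b \<Rightarrow> 'm::comm_monoid_add"
  by (induction B rule: infinite_finite_induct) auto

lemma kd_fmul_apply: "kd fmul J z A g = kd gmul J (\<lambda>A. z A g) A"
  by (simp add: kd_def sum_apply sg_apply fmul_def)

lemma kel_fpart_apply: "z \<in> kel vdeg J (fpart G \<gamma>) a d \<Longrightarrow> (\<lambda>A. z A g) \<in> kel vdeg J cox_part a (d - \<gamma> g)"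
proof (rule kelI)
  assume z: "z \<in> kel vdeg J (fpart G \<gamma>) a d"
  show "z A g \<in> cox_part (d - \<gamma> g - sum vdeg A)" if "A \<subseteq> J" "card A = a" for A
    using fpart_cox_part[OF kel_in[OF z that], of g] by (simp add: algebra_simps)
  show "z A g = 0" if "\<not> (A \<subseteq> J \<and> card A = a)" for A
    using kel_zero[OF z that] by simp
qed

lemma kel_fpartI:
  assumes "\<And>g. g \<in> G \<Longrightarrow> w g \<in> kel vdeg J cox_part a (d - \<gamma> g)"
  shows "(\<lambda>A g. if g \<in> G then w g A else 0) \<in> kel vdeg J (fpart G \<gamma>) a d"
proof (rule kelI)
  fix A assume "A \<subseteq> J" "card A = a"
  then show "(\<lambda>g. if g \<in> G then w g A else 0) \<in> fpart G \<gamma> (d - sum vdeg A)"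
    using kel_in[OF assms] by (auto simp: fpart_def fcar_def algebra_simps)
next
  fix A assume "\<not> (A \<subseteq> J \<and> card A = a)"
  then show "(\<lambda>g. if g \<in> G then w g A else 0) = 0"
    using kel_zero[OF assms] by (auto simp: fun_eq_iff)
qed

lemma kex_free:
  assumes "0 < a" shows "kex fmul vdeg J (fpart G \<gamma> :: _ \<Rightarrow> (nat \<Rightarrow> 'k::field cox) set) {0} a d"
  unfolding kex_def
proof (intro ballI impI)
  fix z :: "cox_var set \<Rightarrow> nat \<Rightarrow> 'k cox"
  assume z: "z \<in> kel vdeg J (fpart G \<gamma>) a d" and "\<forall>A. kd fmul J z A \<in> {0}"
  then have cyc: "kd gmul J (\<lambda>A. z A g) A = 0" for A g
    by (metis kd_fmul_apply singletonD zero_fun_apply)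
  have "\<exists>w\<in>kel vdeg J cox_part (Suc a) (d - \<gamma> g). \<forall>A. z A g - kd gmul J w A = 0" for g
    using kex_cox[OF assms, of J "d - \<gamma> g", unfolded kex_def, rule_format, OF kel_fpart_apply[OF z, of g]] cyc
    by auto
  then obtain w where w: "\<And>g. w g \<in> kel vdeg J cox_part (Suc a) (d - \<gamma> g)"
    "\<And>g A. z A g = kd gmul J (w g) A"
    by (metis eq_iff_diff_eq_0)
  have out: "z A g = 0" if "g \<notin> G" for A g
    using kel_in[OF z, of A] kel_zero[OF z, of A] that
    by (cases "A \<subseteq> J \<and> card A = a") (auto simp: fpart_def fcar_def)
  have "z A - kd fmul J (\<lambda>A g. if g \<in> G then w g A else 0) A = 0" for A
  proof
    fix g show "(z A - kd fmul J (\<lambda>A g. if g \<in> G then w g A else 0) A) g = 0 g"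
      using out[of g A] by (cases "g \<in> G") (simp_all add: kd_fmul_apply w(2)[symmetric] cox.kd_zero)
  qed
  moreover have "(\<lambda>A g. if g \<in> G then w g A else 0) \<in> kel vdeg J (fpart G \<gamma>) (Suc a) d"
    by (rule kel_fpartI) (rule w(1))
  ultimately show "\<exists>u\<in>kel vdeg J (fpart G \<gamma>) (Suc a) d. \<forall>A. z A - kd fmul J u A \<in> {0}"
    by blast
qed

lemma fpart_in_vars:
  fixes v :: "nat \<Rightarrow> 'k::field cox"
  assumes v: "v \<in> fpart G \<gamma> d" and vars: "\<And>g m. g \<in> G \<Longrightarrow> lk (v g) m \<noteq> 0 \<Longrightarrow> \<exists>i\<in>J. lk m i \<noteq> 0"
  shows "\<exists>w\<in>kel vdeg J (fpart G \<gamma>) (Suc 0) d. kd fmul J w {} = v"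
proof -
  have "\<exists>w\<in>kel vdeg J cox_part (Suc 0) (d - \<gamma> g). kd gmul J w {} = v g" if "g \<in> G" for g
    using vars[OF that] fpart_cox_part[OF v] by (intro cox_part_in_vars) auto
  then obtain w where w: "\<And>g. g \<in> G \<Longrightarrow> w g \<in> kel vdeg J cox_part (Suc 0) (d - \<gamma> g)"
    "\<And>g. g \<in> G \<Longrightarrow> kd gmul J (w g) {} = v g"
    by metis
  have "(\<lambda>A g. if g \<in> G then w g A else 0) \<in> kel vdeg J (fpart G \<gamma>) (Suc 0) d"
    by (rule kel_fpartI) (rule w(1))
  moreover have "kd fmul J (\<lambda>A g. if g \<in> G then w g A else 0) {} = v"
  proof
    fix g
    show "kd fmul J (\<lambda>A g. if g \<in> G then w g A else 0) {} g = v g"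
      using fpart_fcar[OF v] w(2)[of g] by (cases "g \<in> G") (auto simp: kd_fmul_apply cox.kd_zero fcar_def)
  qed
  ultimately show ?thesis by blast
qed

lemma exists_var: "m \<noteq> 0 \<Longrightarrow> \<exists>i\<in>UNIV. lk m i \<noteq> 0"
  by (auto simp: poly_mapping_eq_iff fun_eq_iff)

lemma fpart_in_max:
  fixes v :: "nat \<Rightarrow> 'k::field cox"
  assumes v: "v \<in> fpart G \<gamma> d" and "\<And>g. g \<in> G \<Longrightarrow> lk (v g) 0 = 0"
  shows "\<exists>w\<in>kel vdeg UNIV (fpart G \<gamma>) (Suc 0) d. kd fmul UNIV w {} = v"
proof (rule fpart_in_vars[OF v])
  fix g m assume "g \<in> G" "lk (v g) m \<noteq> 0"
  then have "m \<noteq> 0" using assms(2) by auto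
  then show "\<exists>i\<in>UNIV. lk m i \<noteq> 0" by (rule exists_var)
qed

text \<open>The Koszul homology of a free module sits in exterior degree 0, where it is the quotient
  by the variables in \<open>J\<close>. The hypothesis \<open>vars\<close> says that the class in
  that quotient is zero.\<close>

lemma fpart_cycle_boundary:
  fixes z :: "cox_var set \<Rightarrow> nat \<Rightarrow> 'k::field cox"
  assumes z: "z \<in> kel vdeg J (fpart G \<gamma>) a d" "\<And>A. kd fmul J z A = 0"
    and vars: "\<And>g m. a = 0 \<Longrightarrow> g \<in> G \<Longrightarrow> lk (z {} g) m \<noteq> 0 \<Longrightarrow> \<exists>i\<in>J. lk m i \<noteq> 0"
  shows "\<exists>w\<in>kel vdeg J (fpart G \<gamma>) (Suc a) d. \<forall>A. kd fmul J w A = z A"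
proof (cases "a = 0")
  case True
  have "z {} \<in> fpart G \<gamma> d" using kel_in[OF z(1), of "{}"] True by simp
  then obtain w where w: "w \<in> kel vdeg J (fpart G \<gamma>) (Suc 0) d" "kd fmul J w {} = z {}"
    using fpart_in_vars vars[OF True] by metis
  have "kd fmul J w A = z A" for A
    using w z(1) fm.kd_kel_1[OF w(1), of A] True by (cases "A = {}") (auto simp: kel_0_iff)
  then show ?thesis using w(1) True by blast
next
  case False
  then show ?thesis
    using kex_free[of a, unfolded kex_def, rule_format, OF _ z(1)] z(2) by force
qed

lemma lookup_kd_fmul_0: "lk (kd fmul J w A g) 0 = 0"
  unfolding kd_fmul_apply by (auto simp: kd_def lookup_sum sg_def lookup_gen_mult intro!: sum.neutral)

section \<open>Homogeneous matrices and homogeneous components of vectors\<close>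

definition mat_map :: "nat set \<Rightarrow> nat set \<Rightarrow> (nat \<Rightarrow> nat \<Rightarrow> 'k::field cox) \<Rightarrow> (nat \<Rightarrow> 'k cox) \<Rightarrow> nat \<Rightarrow> 'k cox" where
  "mat_map R C M v = (\<lambda>r. if r \<in> R then \<Sum>c\<in>C. M r c * v c else 0)"

lemma mat_map_fcar [simp]: "mat_map R C M v \<in> fcar R"
  by (simp add: mat_map_def fcar_def)

lemma mat_map_diff: "mat_map R C M (x - y) = mat_map R C M x - mat_map R C M y"
  by (auto simp: mat_map_def fun_eq_iff algebra_simps sum_subtractf)

lemma mat_map_add: "mat_map R C M (x + y) = mat_map R C M x + mat_map R C M y"
  by (auto simp: mat_map_def fun_eq_iff algebra_simps sum.distrib)

lemma mat_map_0 [simp]: "mat_map R C M 0 = 0"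
  by (auto simp: mat_map_def fun_eq_iff)

lemma mat_map_smult: "mat_map R C M (\<lambda>g. f * x g) = (\<lambda>g. f * mat_map R C M x g)"
  by (auto simp: mat_map_def fun_eq_iff sum_distrib_left algebra_simps)

lemma mat_map_fmul: "mat_map R C M (fmul i x) = fmul i (mat_map R C M x)"
  unfolding fmul_def by (rule mat_map_smult)

lemma mat_map_fpart:
  assumes "\<And>r c. r \<in> R \<Longrightarrow> c \<in> C \<Longrightarrow> M r c \<in> cox_part (\<gamma>' c - \<gamma> r)" "x \<in> fpart C \<gamma>' d"
  shows "mat_map R C M x \<in> fpart R \<gamma> d"
proof -
  have "M r c * x c \<in> cox_part (d - \<gamma> r)" if "r \<in> R" "c \<in> C" for r c
    using cox_part_mult[OF assms(1)[OF that] fpart_cox_part[OF assms(2), of c]]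
    by (simp add: algebra_simps)
  then show ?thesis by (auto simp: fpart_def fcar_def mat_map_def intro!: cox_part_sum)
qed

definition hcv :: "nat set \<Rightarrow> (nat \<Rightarrow> int \<times> int) \<Rightarrow> int \<times> int \<Rightarrow> (nat \<Rightarrow> 'k::field cox) \<Rightarrow> nat \<Rightarrow> 'k cox" where
  "hcv G \<gamma> d v = (\<lambda>g. if g \<in> G then hc (d - \<gamma> g) (v g) else 0)"

lemma hcv_fpart [simp]: "hcv G \<gamma> d v \<in> fpart G \<gamma> d"
  by (simp add: hcv_def fpart_def fcar_def)

lemma hcv_of_fpart: "v \<in> fpart G \<gamma> d \<Longrightarrow> hcv G \<gamma> d v = v"
  by (rule ext) (auto simp: hcv_def fpart_def fcar_def hc_of_part)

lemma hcv_zero: "hcv G \<gamma> d 0 = 0"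
  by (rule ext) (simp add: hcv_def)

lemma mat_map_hcv:
  assumes "\<And>r c. r \<in> R \<Longrightarrow> c \<in> C \<Longrightarrow> M r c \<in> cox_part (\<gamma>' c - \<gamma> r)"
  shows "mat_map R C M (hcv C \<gamma>' d x) = hcv R \<gamma> d (mat_map R C M x)"
proof
  fix r
  show "mat_map R C M (hcv C \<gamma>' d x) r = hcv R \<gamma> d (mat_map R C M x) r"
  proof (cases "r \<in> R")
    case True
    have "hc (d - \<gamma> r) (M r c * x c) = M r c * hc (d - \<gamma>' c) (x c)" if "c \<in> C" for c
      using hc_mult[OF assms[OF True that], of "d - \<gamma> r" "x c"] by simp
    then show ?thesis using True by (simp add: mat_map_def hcv_def hc_sum)
  qed (simp add: mat_map_def hcv_def)
qed

lemma sum_hcv: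
  assumes "finite G" "v \<in> fcar G"
  shows "\<exists>E. finite E \<and> v = (\<Sum>d\<in>E. hcv G \<gamma> d v)"
proof -
  define E where "E = (\<Union>g\<in>G. (\<lambda>m. mdeg m + \<gamma> g) ` ks (v g))"
  have E: "finite E" using assms(1) by (simp add: E_def)
  have "v g = (\<Sum>d\<in>E. hcv G \<gamma> d v g)" for g
  proof (cases "g \<in> G")
    case True
    have "v g = (\<Sum>e\<in>(\<lambda>d. d - \<gamma> g) ` E. hc e (v g))"
      using True E by (intro sum_hc) (force simp: E_def image_iff)+
    also have "\<dots> = (\<Sum>d\<in>E. hc (d - \<gamma> g) (v g))"
      by (subst sum.reindex) (auto intro: inj_onI)
    finally show ?thesis using True by (simp add: hcv_def)
  qed (use assms(2) in \<open>simp add: hcv_def fcar_def\<close>)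
  then have "v = (\<Sum>d\<in>E. hcv G \<gamma> d v)" by (auto simp: fun_eq_iff sum_apply)
  then show ?thesis using E by blast
qed

section \<open>Resolutions of the quotient by a graded ideal\<close>

lemma free_mod_simps [simp]:
  "carrier (free_mod F k) = fcar (gens F k)"
  "part (free_mod F k) d = fpart (gens F k) (gdeg F k) d"
  "zero (free_mod F k) = 0"
  "add (free_mod F k) u v = u + v"
  "smult (free_mod F k) f v = (\<lambda>g. f * v g)"
  by (simp_all add: free_mod_def Let_def fcar_def fpart_def fun_eq_iff)

lemma boundary_Suc: "boundary F (Suc k) = mat_map (gens F k) (gens F (Suc k)) (diff F (Suc k))"
  by (rule ext) (simp add: mat_map_def)

declare boundary.simps(2) [simp del]

definition eps_map :: "nat set \<Rightarrow> (nat \<Rightarrow> 'k::field cox) \<Rightarrow> (nat \<Rightarrow> 'k cox) \<Rightarrow> 'k cox" where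
  "eps_map G eps v = (\<Sum>g\<in>G. v g * eps g)"

lemma eps_map_diff: "eps_map G eps (x - y) = eps_map G eps x - eps_map G eps y"
  by (simp add: eps_map_def algebra_simps sum_subtractf)

lemma eps_map_add: "eps_map G eps (x + y) = eps_map G eps x + eps_map G eps y"
  by (simp add: eps_map_def algebra_simps sum.distrib)

lemma eps_map_smult: "eps_map G eps (\<lambda>g. f * x g) = f * eps_map G eps x"
  by (simp add: eps_map_def sum_distrib_left algebra_simps)

lemma eps_map_fpart:
  assumes "\<And>g. g \<in> G \<Longrightarrow> eps g \<in> cox_part (\<gamma> g)" "x \<in> fpart G \<gamma> d"
  shows "eps_map G eps x \<in> cox_part d"
  unfolding eps_map_def
proof (rule cox_part_sum)
  fix g assume "g \<in> G"
  then show "x g * eps g \<in> cox_part d"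
    using cox_part_mult[OF fpart_cox_part[OF assms(2), of g] assms(1)[of g]] by simp
qed

lemma eps_map_hcv:
  assumes "\<And>g. g \<in> G \<Longrightarrow> eps g \<in> cox_part (\<gamma> g)"
  shows "eps_map G eps (hcv G \<gamma> d x) = hc d (eps_map G eps x)"
  unfolding eps_map_def hc_sum
proof (rule sum.cong[OF refl])
  fix g assume "g \<in> G"
  then show "hcv G \<gamma> d x g * eps g = hc d (x g * eps g)"
    using hc_mult[OF assms[of g], of d "x g"] by (simp add: hcv_def mult.commute)
qed

locale graded_ideal =
  fixes I :: "'k::field cox set"
  assumes id_zero: "0 \<in> I"
    and id_diff: "f \<in> I \<Longrightarrow> g \<in> I \<Longrightarrow> f - g \<in> I"
    and id_mult: "f \<in> I \<Longrightarrow> a * f \<in> I"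
    and id_hc: "f \<in> I \<Longrightarrow> hc d f \<in> I"

text \<open>\<open>eps g\<close> is the image of the basis element \<open>g\<close> under a lift \<open>F\<^sub>0 \<rightarrow> S\<close> of the augmentation to \<open>S / I\<close>.\<close>

locale aug_complex = graded_ideal I for I :: "'k::field cox set" +
  fixes F :: "'k free_complex" and eps :: "nat \<Rightarrow> 'k cox"
  assumes graded: "graded_free_complex F"
    and eps_part: "g \<in> gens F 0 \<Longrightarrow> eps g \<in> cox_part (gdeg F 0 g)"
    and eps_onto: "\<exists>v\<in>fcar (gens F 0). s - eps_map (gens F 0) eps v \<in> I"
    and eps_boundary: "v \<in> fcar (gens F (Suc 0)) \<Longrightarrow> eps_map (gens F 0) eps (boundary F (Suc 0) v) \<in> I"
begin

abbreviation "Fp k \<equiv> fpart (gens F k) (gdeg F k)"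
abbreviation "E \<equiv> eps_map (gens F 0) eps"

lemma fin_gens: "finite (gens F k)"
  using graded by (simp add: graded_free_complex_def)

lemma diff_part: "r \<in> gens F k \<Longrightarrow> c \<in> gens F (Suc k) \<Longrightarrow> diff F (Suc k) r c \<in> cox_part (gdeg F (Suc k) c - gdeg F k r)"
  using graded by (simp add: graded_free_complex_def)

lemma boundary_boundary: "v \<in> fcar (gens F (Suc k)) \<Longrightarrow> boundary F k (boundary F (Suc k) v) = 0"
  using graded by (simp add: graded_free_complex_def)

lemma boundary_part: "x \<in> Fp (Suc k) d \<Longrightarrow> boundary F (Suc k) x \<in> Fp k d"
  unfolding boundary_Suc by (rule mat_map_fpart[OF diff_part])

lemma boundary_hcv: "boundary F (Suc k) (hcv (gens F (Suc k)) (gdeg F (Suc k)) d x) =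
    hcv (gens F k) (gdeg F k) d (boundary F (Suc k) x)"
  unfolding boundary_Suc by (rule mat_map_hcv[OF diff_part])

text \<open>The \<open>k\<close>-th syzygy module. At \<open>k = 0\<close> it is the kernel of the
  augmentation and not of the zero map \<open>boundary F 0\<close>, so that
  \<open>F\<^sub>k\<^sub>+\<^sub>1\<close> maps into \<open>Zp k\<close> for all \<open>k\<close>
  and dimension shifting starts at \<open>S / I\<close>. The membership in \<open>{0}\<close>
  matches the kernels of \<open>graded_hom\<close>.\<close>

definition Zp :: "nat \<Rightarrow> int \<times> int \<Rightarrow> (nat \<Rightarrow> 'k cox) set" where
  "Zp k d = (if k = 0 then {v \<in> Fp 0 d. E v \<in> I} else {v \<in> Fp k d. boundary F k v \<in> {0}})"

lemma Zp_sub: "Zp k d \<subseteq> Fp k d" by (auto simp: Zp_def)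

lemma boundary_Zp: "x \<in> Fp (Suc k) d \<Longrightarrow> boundary F (Suc k) x \<in> Zp k d"
  using boundary_part[of x k d] eps_boundary[OF fpart_fcar, of x] boundary_boundary[OF fpart_fcar, of x k]
  by (cases k) (auto simp: Zp_def)

lemma eps_hom: "graded_hom fmul gmul vdeg (Fp 0) cox_part E I"
proof (unfold_locales)
  fix i and x y :: "nat \<Rightarrow> 'k cox" and e
  show "E (x - y) = E x - E y" by (rule eps_map_diff)
  show "E (fmul i x) = gmul i (E x)" unfolding fmul_def by (rule eps_map_smult)
  show "E x \<in> cox_part e" if "x \<in> Fp 0 e" using eps_map_fpart[OF eps_part that] .
qed (auto intro: id_zero id_diff id_mult)

lemma Zp_ops: "graded_ops fmul vdeg (Zp k)"
proof (unfold_locales)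
  interpret e: graded_hom fmul gmul vdeg "Fp 0" cox_part E I by (rule eps_hom)
  have b: "boundary F k (x - y) = boundary F k x - boundary F k y" "boundary F k (fmul i x) = fmul i (boundary F k x)"
    if "k \<noteq> 0" for x y i
    using that by (cases k; simp add: boundary_Suc mat_map_diff mat_map_fmul)+
  fix i e and x y :: "nat \<Rightarrow> 'k cox"
  show "0 \<in> Zp k e"
    using b(1)[of 0 0] fm.gr_zero[of _ _ e] by (auto simp: Zp_def id_zero)
  show "x - y \<in> Zp k e" if "x \<in> Zp k e" "y \<in> Zp k e"
    using that by (auto simp: Zp_def e.D_diff b fm.gr_diff id_diff split: if_splits)
  show "fmul i x \<in> Zp k (e + vdeg i)" if "x \<in> Zp k e"
    using that by (auto simp: Zp_def e.D_op b fm.gr_op id_mult split: if_splits)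
qed

lemma boundary_hom: "graded_hom fmul fmul vdeg (Fp (Suc k)) (Zp k) (boundary F (Suc k)) {0}"
proof -
  interpret Z: graded_ops fmul vdeg "Zp k" by (rule Zp_ops)
  show ?thesis
    by unfold_locales (auto simp: boundary_Zp, auto simp: boundary_Suc mat_map_diff mat_map_fmul)
qed

lemma eps_onto_part: "u \<in> cox_part d \<Longrightarrow> \<exists>x\<in>Fp 0 d. u - E x \<in> I"
proof -
  assume u: "u \<in> cox_part d"
  obtain v where v: "v \<in> fcar (gens F 0)" "u - E v \<in> I" using eps_onto by blast
  have "hc d (u - E v) = u - E (hcv (gens F 0) (gdeg F 0) d v)"
    using u by (simp add: hc_diff hc_of_part eps_map_hcv[OF eps_part])
  then show ?thesis using id_hc[OF v(2), of d] by (intro bexI[OF _ hcv_fpart]) auto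
qed

end

locale aug_resolution = aug_complex I F eps for I :: "'k::field cox set" and F :: "'k free_complex" and eps :: "nat \<Rightarrow> 'k cox" +
  assumes exact: "v \<in> fcar (gens F k) \<Longrightarrow> (if k = 0 then E v \<in> I else boundary F k v = 0) \<Longrightarrow>
      \<exists>w\<in>fcar (gens F (Suc k)). boundary F (Suc k) w = v"
begin

lemma exact_part: assumes "v \<in> Zp k d" shows "\<exists>w\<in>Fp (Suc k) d. boundary F (Suc k) w = v"
proof -
  have v: "v \<in> Fp k d" using assms Zp_sub by blast
  obtain w where "boundary F (Suc k) w = v"
    using exact[of v k] assms fpart_fcar[OF v] by (auto simp: Zp_def split: if_splits)
  then have "boundary F (Suc k) (hcv (gens F (Suc k)) (gdeg F (Suc k)) d w) = v"
    using hcv_of_fpart[OF v] by (simp add: boundary_hcv)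
  then show ?thesis by (intro bexI[OF _ hcv_fpart])
qed

end

text \<open>For the homogeneous entries of a graded complex, a zero constant coefficient amounts to
  membership in the maximal graded ideal.\<close>

locale min_resolution = aug_resolution I F eps for I :: "'k::field cox set" and F :: "'k free_complex" and eps :: "nat \<Rightarrow> 'k cox" +
  assumes minimal: "r \<in> gens F k \<Longrightarrow> c \<in> gens F (Suc k) \<Longrightarrow> lk (diff F (Suc k) r c) 0 = 0"
begin

lemma boundary_const: "lk (boundary F (Suc k) w g) 0 = 0"
  by (auto simp: boundary_Suc mat_map_def lookup_sum lookup_mult_0 minimal intro!: sum.neutral)

lemma Zp_const: "v \<in> Zp k d \<Longrightarrow> lk (v g) 0 = 0"
  using exact_part boundary_const by metis

text \<open>By minimality and exactness a syzygy has no constant entries, so the obstruction in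
  exterior degree 0 disappears.\<close>

lemma free_kernel:
  assumes "z \<in> kel vdeg UNIV (Fp k) a d" "\<And>A. kd fmul UNIV z A = 0" "\<And>A. z A \<in> Zp k (d - sum vdeg A) \<or> z A = 0"
  shows "\<exists>w\<in>kel vdeg UNIV (Fp k) (Suc a) d. \<forall>A. kd fmul UNIV w A = z A"
proof (rule fpart_cycle_boundary[OF assms(1,2)])
  fix g m assume "lk (z {} g) m \<noteq> 0"
  then have "m \<noteq> 0" using assms(3)[of "{}"] Zp_const[of "z {}" k "d - sum vdeg {}" g] by auto
  then show "\<exists>i\<in>UNIV. lk m i \<noteq> 0" by (rule exists_var)
qed

text \<open>Dimension shifting along the resolution: each step from \<open>S / I\<close> to
  \<open>Zp 0\<close>, or from \<open>Zp k\<close> to \<open>Zp (Suc k)\<close>, lowers the exterior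
  degree by one. Hence \<open>a\<close> must be arbitrary in the induction.\<close>

lemma kex_Zp:
  assumes "kex gmul vdeg UNIV cox_part I (Suc (k + a)) d"
  shows "kex fmul vdeg UNIV (Zp k) {0} a d"
  using assms
proof (induction k arbitrary: a)
  case 0
  interpret e: graded_hom fmul gmul vdeg "Fp 0" cox_part E I by (rule eps_hom)
  have "kex fmul vdeg UNIV (\<lambda>e. {x \<in> Fp 0 e. E x \<in> I}) {0} a d"
  proof (rule e.kex_kernel)
    fix z :: "cox_var set \<Rightarrow> nat \<Rightarrow> 'k cox"
    assume z: "z \<in> kel vdeg UNIV (Fp 0) a d" "\<And>A. kd fmul UNIV z A = 0" "\<And>A. E (z A) \<in> I"
    have "z A \<in> Zp 0 (d - sum vdeg A) \<or> z A = 0" for A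
      using kel_in[OF z(1), of A] kel_zero[OF z(1), of A] z(3)[of A] by (auto simp: Zp_def)
    then show "\<exists>w\<in>kel vdeg UNIV (Fp 0) (Suc a) d. \<forall>A. kd fmul UNIV w A = z A"
      using free_kernel[OF z(1,2)] by blast
  qed (use 0 eps_onto_part in auto)
  then show ?case by (simp add: Zp_def[abs_def])
next
  case (Suc k)
  interpret b: graded_hom fmul fmul vdeg "Fp (Suc k)" "Zp k" "boundary F (Suc k)" "{0}" by (rule boundary_hom)
  have "kex fmul vdeg UNIV (\<lambda>e. {x \<in> Fp (Suc k) e. boundary F (Suc k) x \<in> {0}}) {0} a d"
  proof (rule b.kex_kernel)
    fix z :: "cox_var set \<Rightarrow> nat \<Rightarrow> 'k cox"
    assume z: "z \<in> kel vdeg UNIV (Fp (Suc k)) a d" "\<And>A. kd fmul UNIV z A = 0" "\<And>A. boundary F (Suc k) (z A) \<in> {0}"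
    have "z A \<in> Zp (Suc k) (d - sum vdeg A) \<or> z A = 0" for A
      using kel_in[OF z(1), of A] kel_zero[OF z(1), of A] z(3)[of A] by (auto simp: Zp_def)
    then show "\<exists>w\<in>kel vdeg UNIV (Fp (Suc k)) (Suc a) d. \<forall>A. kd fmul UNIV w A = z A"
      using free_kernel[OF z(1,2)] by blast
  next
    fix A u assume "u \<in> Zp k (d - sum vdeg A)"
    then show "\<exists>x\<in>Fp (Suc k) (d - sum vdeg A). u - boundary F (Suc k) x \<in> {0}"
      using exact_part by fastforce
  next
    show "kex fmul vdeg UNIV (Zp k) {0} (Suc a) d" using Suc by simp
  qed
  then show ?case by (simp add: Zp_def[abs_def])
qed

text \<open>The reverse shift works in positive exterior degree, where free modules have no Koszul
  homology.\<close>

lemma kex_of_Zp: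
  assumes "kex fmul vdeg UNIV (Zp k) {0} a d"
  shows "kex gmul vdeg UNIV cox_part I (Suc (k + a)) d"
  using assms
proof (induction k arbitrary: a)
  case 0
  interpret e: graded_hom fmul gmul vdeg "Fp 0" cox_part E I by (rule eps_hom)
  show ?case
    using e.kex_image[of UNIV a d, OF eps_onto_part kex_free] 0 by (simp add: Zp_def[abs_def])
next
  case (Suc k)
  interpret b: graded_hom fmul fmul vdeg "Fp (Suc k)" "Zp k" "boundary F (Suc k)" "{0}" by (rule boundary_hom)
  have "kex fmul vdeg UNIV (Zp k) {0} (Suc a) d"
  proof (rule b.kex_image)
    fix A u assume "u \<in> Zp k (d - sum vdeg A)"
    then show "\<exists>x\<in>Fp (Suc k) (d - sum vdeg A). u - boundary F (Suc k) x \<in> {0}"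
      using exact_part by fastforce
  next
    show "kex fmul vdeg UNIV (\<lambda>e. {x \<in> Fp (Suc k) e. boundary F (Suc k) x \<in> {0}}) {0} a d"
      using Suc.prems by (simp add: Zp_def[abs_def])
  qed (rule kex_free, simp)
  then show ?case using Suc.IH[of "Suc a"] by simp
qed

text \<open>If the homology vanished, the basis element \<open>g\<close> would differ from a syzygy
  by multiples of variables. Neither of these has a constant entry, but the basis element has the
  entry 1.\<close>

lemma gens_imp_not_kex:
  assumes g: "g \<in> gens F k" "gdeg F k g = d"
  shows "\<not> kex gmul vdeg UNIV cox_part I k d"
proof
  assume kex: "kex gmul vdeg UNIV cox_part I k d"
  define e :: "nat \<Rightarrow> 'k cox" where "e = (\<lambda>h. if h = g then 1 else 0)"
  have e: "e \<in> Fp k d" using g by (auto simp: e_def fpart_def fcar_def zero_prod_def[symmetric])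
  have "\<exists>w. e - kd fmul UNIV w {} \<in> Zp k d"
  proof (cases k)
    case 0
    interpret e: graded_hom fmul gmul vdeg "Fp 0" cox_part E I by (rule eps_hom)
    show ?thesis
      using e.reduce_into_kernel[OF eps_onto_part kex[unfolded 0] e[unfolded 0]] by (simp add: Zp_def 0)
  next
    case (Suc j)
    interpret b: graded_hom fmul fmul vdeg "Fp (Suc j)" "Zp j" "boundary F (Suc j)" "{0}" by (rule boundary_hom)
    have "kex fmul vdeg UNIV (Zp j) {0} 0 d" using kex_Zp[of j 0 d] kex Suc by simp
    moreover have "\<exists>x\<in>Fp (Suc j) d. u - boundary F (Suc j) x \<in> {0}" if "u \<in> Zp j d" for u d
      using exact_part[OF that] by fastforce
    ultimately show ?thesis
      using b.reduce_into_kernel[OF _ _ e[unfolded Suc]] by (simp add: Zp_def Suc)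
  qed
  then obtain w where "e - kd fmul UNIV w {} \<in> Zp k d" ..
  from Zp_const[OF this, of g] show False
    by (simp add: lookup_minus lookup_kd_fmul_0 e_def)
qed

text \<open>Without generators of degree \<open>d\<close>, vectors of degree \<open>d\<close> in
  \<open>F\<^sub>k\<^sub>+\<^sub>1\<close> have no constant entries and so are combinations of
  multiples of variables. Their boundaries are all of \<open>Zp k d\<close>, so the Koszul homology
  of \<open>Zp k\<close> vanishes at 0, and the shift carries this back to
  \<open>S / I\<close>.\<close>

lemma not_kex_imp_gens:
  assumes "\<not> kex gmul vdeg UNIV cox_part I (Suc k) d"
  shows "\<exists>g\<in>gens F (Suc k). gdeg F (Suc k) g = d"
proof (rule ccontr)
  assume no: "\<not> (\<exists>g\<in>gens F (Suc k). gdeg F (Suc k) g = d)"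
  interpret b: graded_hom fmul fmul vdeg "Fp (Suc k)" "Zp k" "boundary F (Suc k)" "{0}" by (rule boundary_hom)
  have "kex fmul vdeg UNIV (Zp k) {0} 0 d"
    unfolding graded_ops.kex_0_iff[OF Zp_ops singletonI]
  proof
    fix x assume "x \<in> Zp k d"
    then obtain u where u: "u \<in> Fp (Suc k) d" "boundary F (Suc k) u = x" using exact_part by blast
    have "lk (u g) 0 = 0" if "g \<in> gens F (Suc k)" for g
      using cox_partD[OF fpart_cox_part[OF u(1)], of g 0] no that by (metis eq_iff_diff_eq_0 mdeg_0)
    then obtain w where w: "w \<in> kel vdeg UNIV (Fp (Suc k)) (Suc 0) d" "kd fmul UNIV w {} = u"
      using fpart_in_max[OF u(1)] by blast
    have "x - kd fmul UNIV (\<lambda>A. boundary F (Suc k) (w A)) {} \<in> {0}"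
      by (simp add: b.D_kd[symmetric] w(2) u(2))
    then show "\<exists>u\<in>kel vdeg UNIV (Zp k) (Suc 0) d. x - kd fmul UNIV u {} \<in> {0}"
      using b.D_kel[OF w(1)] by blast
  qed
  then show False using assms kex_of_Zp[of k 0 d] by simp
qed

end

section \<open>Truncation\<close>

lemma virtual_of_pair_simps [simp]:
  "gens (virtual_of_pair F d) k = {g \<in> gens F k. gdeg F k g \<le> d + (1, 2)}"
  "gdeg (virtual_of_pair F d) = gdeg F"
  "diff (virtual_of_pair F d) = diff F"
  by (simp_all add: virtual_of_pair_def)

lemma fcar_mono: "G \<subseteq> H \<Longrightarrow> fcar G \<subseteq> fcar H"
  by (auto simp: fcar_def)

lemma vdeg_Y_sum: "A \<subseteq> range Yv \<Longrightarrow> sum vdeg A = (0, int (card A))"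
proof -
  assume "A \<subseteq> range Yv"
  then have "sum vdeg A = (\<Sum>v\<in>A. (0, 1))"
    by (intro sum.cong) auto
  also have "\<dots> = (0, int (card A))"
    by (induction A rule: infinite_finite_induct) (auto simp: zero_prod_def)
  finally show ?thesis .
qed

text \<open>An entry from a kept column to a discarded row would have a degree that is not
  \<open>\<ge> 0\<close>, so it is zero.\<close>

lemma (in aug_complex) boundary_virtual_of_pair:
  assumes "v \<in> fcar (gens (virtual_of_pair F d) (Suc k))"
  shows "boundary (virtual_of_pair F d) (Suc k) v = boundary F (Suc k) v"
proof
  fix r
  have out: "v c = 0" if "c \<notin> gens (virtual_of_pair F d) (Suc k)" for c
    using assms that by (simp add: fcar_def)
  have sums: "(\<Sum>c\<in>gens (virtual_of_pair F d) (Suc k). diff F (Suc k) r c * v c) =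
      (\<Sum>c\<in>gens F (Suc k). diff F (Suc k) r c * v c)"
    using out by (intro sum.mono_neutral_left) (auto simp: fin_gens)
  have "(\<Sum>c\<in>gens F (Suc k). diff F (Suc k) r c * v c) = 0"
    if r: "r \<in> gens F k" "r \<notin> gens (virtual_of_pair F d) k"
  proof (rule sum.neutral, rule ballI)
    fix c assume c: "c \<in> gens F (Suc k)"
    show "diff F (Suc k) r c * v c = 0"
    proof (cases "c \<in> gens (virtual_of_pair F d) (Suc k)")
      case True
      have "\<not> 0 \<le> gdeg F (Suc k) c - gdeg F k r"
        using True r by (auto simp: zero_prod_def less_eq_prod_def)
      then have "diff F (Suc k) r c = 0"
        using cox_part_not_ge_0 diff_part[OF r(1) c] by blast
      then show ?thesis by simp
    qed (simp add: out)
  qed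
  then show "boundary (virtual_of_pair F d) (Suc k) v r = boundary F (Suc k) v r"
    using sums by (auto simp: boundary_Suc mat_map_def)
qed

lemma (in aug_complex) aug_complex_virtual_of_pair:
  assumes "\<And>g. g \<in> gens F 0 \<Longrightarrow> gdeg F 0 g \<le> d + (1, 2)"
  shows "aug_complex I (virtual_of_pair F d) eps"
proof -
  have sub: "fcar (gens (virtual_of_pair F d) k) \<subseteq> fcar (gens F k)" for k
    by (intro fcar_mono) auto
  have bb: "boundary (virtual_of_pair F d) k (boundary (virtual_of_pair F d) (Suc k) v) = 0"
    if v: "v \<in> fcar (gens (virtual_of_pair F d) (Suc k))" for k v
  proof (cases k)
    case (Suc j)
    have "boundary (virtual_of_pair F d) (Suc k) v \<in> fcar (gens (virtual_of_pair F d) k)"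
      unfolding boundary_Suc by (rule mat_map_fcar)
    then show ?thesis
      using v sub[of "Suc k"] boundary_boundary[of v k] by (auto simp: Suc boundary_virtual_of_pair)
  qed simp
  have "graded_free_complex (virtual_of_pair F d)"
    unfolding graded_free_complex_def using fin_gens diff_part bb by (simp del: fun_zero add: fun_zero)
  moreover have G0: "gens (virtual_of_pair F d) 0 = gens F 0"
    using assms by auto
  moreover have "E (boundary (virtual_of_pair F d) (Suc 0) v) \<in> I"
    if "v \<in> fcar (gens (virtual_of_pair F d) (Suc 0))" for v
    using eps_boundary[of v] sub[of "Suc 0"] that by (auto simp: boundary_virtual_of_pair)
  ultimately show ?thesis
    using eps_part eps_onto by unfold_locales (simp_all only: virtual_of_pair_simps(2,3) G0)
qed

text \<open>The \<open>x\<close>-degree \<open>p\<close> stays fixed because only the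
  \<open>y\<close>-variables enter the Koszul complexes. Thus exactness in degree
  \<open>(p, q)\<close> depends only on exactness in degrees \<open>(p, q')\<close> with
  \<open>q' < q\<close>, and on the \<open>y\<close>-Koszul homology of \<open>S / I\<close> for
  this single \<open>p\<close>.\<close>

lemma (in aug_resolution) truncation_exact:
  fixes p :: int
  assumes G0: "\<And>g. g \<in> gens F 0 \<Longrightarrow> gdeg F 0 g \<le> d + (1, 2)"
    and low: "\<And>k g. g \<in> gens F k \<Longrightarrow> snd (gdeg F k g) \<le> 2 \<Longrightarrow> gdeg F k g \<le> d + (1, 2)"
    and d: "snd d = 0"
    and kexY: "\<And>q a. q \<ge> 3 \<Longrightarrow> kex gmul vdeg (range Yv) cox_part I a (p, q)"
    and v: "v \<in> aug_complex.Zp I (virtual_of_pair F d) eps k (p, q)"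
  shows "\<exists>w\<in>fpart (gens (virtual_of_pair F d) (Suc k)) (gdeg F (Suc k)) (p, q).
    boundary (virtual_of_pair F d) (Suc k) w = v"
  using v
proof (induction "nat q" arbitrary: q k v rule: less_induct)
  case less
  let ?F = "virtual_of_pair F d"
  interpret T: aug_complex I ?F eps by (rule aug_complex_virtual_of_pair[OF G0])
  have G0': "gens ?F 0 = gens F 0" using G0 by auto
  have sub: "fcar (gens ?F k) \<subseteq> fcar (gens F k)" for k
    by (intro fcar_mono) auto
  show ?case
  proof (cases "q \<le> 2")
    case True
    have v: "v \<in> T.Fp k (p, q)" using less.prems T.Zp_sub by blast
    have "v \<in> Fp k (p, q)" using fpart_cox_part[OF v] fpart_fcar[OF v] sub
      by (auto simp: fpart_def)
    then have "v \<in> Zp k (p, q)"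
      using less.prems fpart_fcar[OF v] unfolding T.Zp_def Zp_def
      by (cases k) (auto simp: G0'[simplified] boundary_virtual_of_pair)
    then obtain w where w: "w \<in> Fp (Suc k) (p, q)" "boundary F (Suc k) w = v"
      using exact_part by blast
    \<comment> \<open>A discarded generator has \<open>y\<close>-degree above 2 by
      \<open>low\<close>, hence coefficient zero in degree \<open>(p, q)\<close>: the preimage in
      \<open>F\<close> already lies in the truncation.\<close>
    have "w g = 0" if "g \<notin> gens ?F (Suc k)" for g
    proof (cases "g \<in> gens F (Suc k)")
      case g: True
      then have "\<not> snd (gdeg F (Suc k) g) \<le> 2" using low[OF g] that g by auto
      then have "\<not> 0 \<le> (p, q) - gdeg F (Suc k) g"
        using \<open>q \<le> 2\<close> by (auto simp: zero_prod_def less_eq_prod_def)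
      then show ?thesis using cox_part_not_ge_0 fpart_cox_part[OF w(1), of g] by blast
    qed (use fpart_fcar[OF w(1)] in \<open>simp add: fcar_def\<close>)
    then have car: "w \<in> fcar (gens ?F (Suc k))" by (simp add: fcar_def)
    then have "w \<in> T.Fp (Suc k) (p, q)" using fpart_cox_part[OF w(1)] by (simp add: fpart_def)
    then show ?thesis using w(2) boundary_virtual_of_pair[OF car] by auto
  next
    case False
    then have q: "q \<ge> 3" by simp
    have degq: "(p, q) - sum vdeg A = (p, q - int (card A))" if "A \<subseteq> range Yv" for A
      by (simp add: vdeg_Y_sum[OF that])
    \<comment> \<open>A nonempty set of \<open>y\<close>-variables lowers the
      \<open>y\<close>-degree strictly. The induction hypothesis thus gives the surjectivity onto
      syzygies that lifting Koszul chains requires.\<close>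
    have IH: "\<exists>x\<in>T.Fp (Suc j) ((p, q) - sum vdeg A). u - boundary ?F (Suc j) x \<in> {0}"
      if "A \<subseteq> range Yv" "card A > 0" "u \<in> T.Zp j ((p, q) - sum vdeg A)" for A u j
      using less.hyps[of "q - int (card A)" u j] that q by (fastforce simp: degq)
    \<comment> \<open>Generators of the truncation have \<open>y\<close>-degree at most 2, so for
      \<open>q \<ge> 3\<close> every monomial of a coefficient contains a \<open>y\<close>-variable.
      This makes even exterior degree 0 harmless.\<close>
    have free: "\<exists>w\<in>kel vdeg (range Yv) (T.Fp j) (Suc a) (p, q). \<forall>A. kd fmul (range Yv) w A = z A"
      if z: "z \<in> kel vdeg (range Yv) (T.Fp j) a (p, q)" "\<And>A. kd fmul (range Yv) z A = 0" for z a j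
    proof (rule fpart_cycle_boundary[OF z])
      fix g m assume a: "a = 0" and g: "g \<in> gens ?F j" and "lk (z {} g) m \<noteq> 0"
      then have "mdeg m = (p, q) - gdeg F j g"
        using cox_partD fpart_cox_part[OF kel_in[OF z(1), of "{}"], of g] by simp
      then have "snd (mdeg m) > 0"
        using g d q by (auto simp: less_eq_prod_def)
      then have "(\<Sum>i\<in>UNIV. int (lk m (Yv i))) \<noteq> 0" by (simp add: cox_deg_def)
      then obtain i where "int (lk m (Yv i)) \<noteq> 0" by (meson sum.neutral)
      then show "\<exists>i\<in>range Yv. lk m i \<noteq> 0" by auto
    qed
    have kexZ: "kex fmul vdeg (range Yv) (T.Zp j) {0} a (p, q)" for j a
    proof (induction j arbitrary: a)
      case 0
      interpret e: graded_hom fmul gmul vdeg "T.Fp 0" cox_part T.E I by (rule T.eps_hom)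
      have "kex fmul vdeg (range Yv) (\<lambda>e. {x \<in> T.Fp 0 e. T.E x \<in> I}) {0} a (p, q)"
        by (rule e.kex_kernel[OF T.eps_onto_part free kexY[OF q]])
      then show ?case by (simp add: T.Zp_def[abs_def])
    next
      case (Suc j)
      interpret b: graded_hom fmul fmul vdeg "T.Fp (Suc j)" "T.Zp j" "boundary ?F (Suc j)" "{0}"
        by (rule T.boundary_hom)
      have "kex fmul vdeg (range Yv) (\<lambda>e. {x \<in> T.Fp (Suc j) e. boundary ?F (Suc j) x \<in> {0}}) {0} a (p, q)"
        by (rule b.kex_kernel[OF IH free Suc]) auto
      then show ?case by (simp add: T.Zp_def[abs_def])
    qed
    interpret b: graded_hom fmul fmul vdeg "T.Fp (Suc k)" "T.Zp k" "boundary ?F (Suc k)" "{0}"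
      by (rule T.boundary_hom)
    \<comment> \<open>Vanishing at exterior degree 0 writes \<open>v\<close> as a combination of
      \<open>y\<close>-multiples of syzygies of degree \<open>(p, q - 1)\<close>; these lift by
      induction, and the same combination of the lifts maps to \<open>v\<close>.\<close>
    obtain u where u: "u \<in> kel vdeg (range Yv) (T.Zp k) (Suc 0) (p, q)" "v = kd fmul (range Yv) u {}"
      using kexZ[of k 0] less.prems by (auto simp: graded_ops.kex_0_iff[OF T.Zp_ops])
    have IH1: "\<exists>x\<in>T.Fp (Suc k) ((p, q) - sum vdeg A). u - boundary ?F (Suc k) x \<in> {0}"
      if "A \<subseteq> range Yv" "card A = Suc 0" "u \<in> T.Zp k ((p, q) - sum vdeg A)" for A u
      using IH[of A u k] that by simp
    obtain u' where u': "u' \<in> kel vdeg (range Yv) (T.Fp (Suc k)) (Suc 0) (p, q)"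
        "\<And>A. kd fmul (range Yv) u A - boundary ?F (Suc k) (kd fmul (range Yv) u' A) \<in> {0}"
      using b.lift_kd[OF IH1 u(1)] by blast
    have "boundary ?F (Suc k) (kd fmul (range Yv) u' {}) = v" using u'(2)[of "{}"] u(2) by simp
    moreover have "kd fmul (range Yv) u' {} \<in> T.Fp (Suc k) (p, q)"
      using kel_in[OF fm.kd_kel[OF u'(1)], of "{}"] by simp
    ultimately show ?thesis by auto
  qed
qed

section \<open>Evaluation at points\<close>

definition mon :: "(cox_var \<Rightarrow> 'k::comm_ring_1) \<Rightarrow> (cox_var \<Rightarrow>\<^sub>0 nat) \<Rightarrow> 'k" where
  "mon a m = (\<Prod>v\<in>UNIV. a v ^ lk m v)"

lemma mon_add: "mon a (m + n) = mon a m * mon a n"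
  by (simp add: mon_def lookup_add power_add prod.distrib)

lemma mon_mult: "mon (\<lambda>v. s v * a v) m = mon s m * mon a m"
  by (simp add: mon_def power_mult_distrib prod.distrib)

lemma eval_mpoly_superset:
  assumes "finite S" "ks f \<subseteq> S"
  shows "eval_mpoly a f = (\<Sum>m\<in>S. lk f m * mon a m)"
proof -
  have "(\<Prod>v\<in>ks m. a v ^ lk m v) = mon a m" for m
    unfolding mon_def by (rule prod.mono_neutral_left) (auto simp: in_keys_iff)
  then have "eval_mpoly a f = (\<Sum>m\<in>ks f. lk f m * mon a m)"
    by (simp add: eval_mpoly_def)
  also have "\<dots> = (\<Sum>m\<in>S. lk f m * mon a m)"
    using assms by (intro sum.mono_neutral_left) (auto simp: in_keys_iff)
  finally show ?thesis .
qed

lemma eval_mpoly_add: "eval_mpoly a (f + g) = eval_mpoly a f + eval_mpoly a (g :: 'k::field cox)"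
proof -
  have "ks (f + g) \<subseteq> ks f \<union> ks g" by (rule keys_add)
  then show ?thesis
    by (simp add: eval_mpoly_superset[of "ks f \<union> ks g"] lookup_add algebra_simps sum.distrib)
qed

lemma eval_mpoly_single: "eval_mpoly a (Poly_Mapping.single m c) = c * mon a m"
  using eval_mpoly_superset[of "{m}" "Poly_Mapping.single m c" a] by simp

lemma eval_mpoly_0 [simp]: "eval_mpoly a 0 = 0"
  by (simp add: eval_mpoly_def)

lemma eval_mpoly_sum: "eval_mpoly a (sum f B) = (\<Sum>b\<in>B. eval_mpoly a (f b))"
  for f :: "'b \<Rightarrow> 'k::field cox"
  by (induction B rule: infinite_finite_induct) (auto simp: eval_mpoly_add)

lemma eval_mpoly_mult: "eval_mpoly a (f * g) = eval_mpoly a f * eval_mpoly a (g :: 'k::field cox)"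
proof -
  have "eval_mpoly a (Poly_Mapping.single m c * g) = c * mon a m * eval_mpoly a g" for m c
    by (subst (1 2) poly_mapping_sum_single[of g])
      (simp add: sum_distrib_left mult_single eval_mpoly_sum eval_mpoly_single mon_add algebra_simps)
  then show ?thesis
    by (subst (1 2) poly_mapping_sum_single[of f])
      (simp add: sum_distrib_right eval_mpoly_sum eval_mpoly_single)
qed

lemma eval_mpoly_neg: "eval_mpoly a (- f) = - eval_mpoly a (f :: 'k::field cox)"
  using eval_mpoly_add[of a f "- f"] by (simp add: eq_neg_iff_add_eq_0 add.commute)

lemma eval_mpoly_diff: "eval_mpoly a (f - g) = eval_mpoly a f - eval_mpoly a (g :: 'k::field cox)"
  using eval_mpoly_add[of a f "- g"] by (simp add: eval_mpoly_neg)

lemma eval_mpoly_gen: "eval_mpoly a (cox_gen v) = (a v :: 'k::field)"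
proof -
  have "(\<Prod>w\<in>UNIV. a w ^ lk (Poly_Mapping.single v 1) w) = (\<Prod>w\<in>UNIV. if w = v then a v else 1)"
    by (rule prod.cong) (auto simp: lookup_single when_def)
  then show ?thesis by (simp add: cox_gen_def eval_mpoly_single mon_def)
qed

lemma eval_mpoly_const: "eval_mpoly a (cox_const c) = (c :: 'k::field)"
  by (simp add: cox_const_def eval_mpoly_single mon_def)

lemma eval_mpoly_power: "eval_mpoly a (f ^ n) = eval_mpoly a (f :: 'k::field cox) ^ n"
  using eval_mpoly_const[of a 1] by (induction n) (auto simp: eval_mpoly_mult)

lemma UNIV_cox_var: "(UNIV :: cox_var set) = range Xv \<union> range Yv"
  by (auto intro: cox_var.exhaust)

lemma mon_scale: "mon (case_cox_var (\<lambda>_. c) (\<lambda>_. e)) m = c ^ nat (fst (mdeg m)) * e ^ nat (snd (mdeg m))"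
proof -
  have "mon (case_cox_var (\<lambda>_. c) (\<lambda>_. e)) m = (\<Prod>v\<in>range Xv. c ^ lk m v) * (\<Prod>v\<in>range Yv. e ^ lk m v)"
    unfolding mon_def UNIV_cox_var by (subst prod.union_disjoint) (auto intro!: arg_cong2[of _ _ _ _ "(*)"] prod.cong)
  also have "\<dots> = (\<Prod>i\<in>UNIV. c ^ lk m (Xv i)) * (\<Prod>j\<in>UNIV. e ^ lk m (Yv j))"
    by (simp add: prod.reindex inj_on_def)
  also have "\<dots> = c ^ (\<Sum>i\<in>UNIV. lk m (Xv i)) * e ^ (\<Sum>j\<in>UNIV. lk m (Yv j))"
    by (simp add: power_sum)
  finally show ?thesis
    by (simp add: cox_deg_def flip: of_nat_sum)
qed

text \<open>Coordinates of a point are determined up to one scalar on the \<open>x\<close> and one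
  on the \<open>y\<close>; this is why vanishing of a form does not depend on their choice.\<close>

lemma eval_mpoly_scale:
  fixes f :: "'k::field cox"
  assumes "f \<in> cox_part d"
  shows "eval_mpoly (\<lambda>v. case_cox_var (\<lambda>_. c) (\<lambda>_. e) v * a v) f =
    c ^ nat (fst d) * e ^ nat (snd d) * eval_mpoly a f"
proof -
  have "lk f m * mon (\<lambda>v. case_cox_var (\<lambda>_. c) (\<lambda>_. e) v * a v) m =
      c ^ nat (fst d) * e ^ nat (snd d) * (lk f m * mon a m)" for m
    unfolding mon_mult mon_scale using cox_partD[OF assms, of m] by (cases "lk f m = 0") auto
  then show ?thesis
    by (simp only: eval_mpoly_superset[of "ks f"] finite_keys order_refl sum_distrib_left)
qed

section \<open>The vanishing ideal of a finite set of points\<close>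

lemma module_mult: "Modules.module ((*) :: 'a::comm_ring_1 \<Rightarrow> 'a \<Rightarrow> 'a)"
  by unfold_locales (auto simp: algebra_simps)

lemma sum_vdeg: "sum vdeg A = (int (card (A \<inter> range Xv)), int (card (A \<inter> range Yv)))"
proof -
  have "sum vdeg A = sum vdeg (A \<inter> range Xv) + sum vdeg (A \<inter> range Yv)"
    using UNIV_cox_var by (subst sum.union_disjoint[symmetric]) (auto intro!: sum.cong)
  also have "sum vdeg (A \<inter> range Xv) = (\<Sum>v\<in>A \<inter> range Xv. (1, 0))"
    by (rule sum.cong) auto
  also have "sum vdeg (A \<inter> range Yv) = (\<Sum>v\<in>A \<inter> range Yv. (0, 1))"
    by (rule sum.cong) auto
  also have "(\<Sum>v\<in>B. (1, 0)) = (int (card B), 0)" for B :: "cox_var set"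
    by (induction B rule: infinite_finite_induct) (auto simp: zero_prod_def)
  also have "(\<Sum>v\<in>B. (0, 1)) = (0, int (card B))" for B :: "cox_var set"
    by (induction B rule: infinite_finite_induct) (auto simp: zero_prod_def)
  finally show ?thesis by simp
qed

lemma card_X_le: "card (A \<inter> range Xv) \<le> 2" and card_Y_le: "card (A \<inter> range Yv) \<le> 3"
proof -
  have "card (A \<inter> range Xv) \<le> card (range Xv)" "card (A \<inter> range Yv) \<le> card (range Yv)"
    by (auto intro: card_mono)
  then show "card (A \<inter> range Xv) \<le> 2" "card (A \<inter> range Yv) \<le> 3"
    by (auto simp: card_image inj_on_def)
qed

lemma card_vars: "card A = card (A \<inter> range Xv) + card (A \<inter> range Yv)"
proof -
  have "A = (A \<inter> range Xv) \<union> (A \<inter> range Yv)"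
    unfolding Int_Un_distrib[symmetric] UNIV_cox_var[symmetric] by simp
  then have "card A = card ((A \<inter> range Xv) \<union> (A \<inter> range Yv))" by (rule arg_cong[of _ _ card])
  also have "\<dots> = card (A \<inter> range Xv) + card (A \<inter> range Yv)"
    by (intro card_Un_disjoint finite) blast
  finally show ?thesis .
qed

section \<open>Coordinates of points and evaluation of forms\<close>

lemma proj_space_nonempty:
  assumes "C \<in> proj_space" shows "\<exists>u\<in>C. u \<noteq> 0"
proof -
  obtain x where x: "x \<noteq> 0" "C = {(u, v). u \<noteq> 0 \<and> v \<noteq> 0 \<and> (\<exists>c. c \<noteq> 0 \<and> v = c *s u)} `` {x}"
    using assms unfolding proj_space_def quotient_def by blast
  then have "x \<in> C" by (auto intro: exI[of _ 1])
  then show ?thesis using x(1) by blast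
qed

lemma proj_space_scale:
  assumes "C \<in> proj_space" "u \<in> C" "w \<in> C"
  shows "u \<noteq> 0 \<and> (\<exists>c. c \<noteq> 0 \<and> w = c *s u)"
proof -
  obtain x where x: "x \<noteq> 0" "C = {(u, v). u \<noteq> 0 \<and> v \<noteq> 0 \<and> (\<exists>c. c \<noteq> 0 \<and> v = c *s u)} `` {x}"
    using assms(1) unfolding proj_space_def quotient_def by blast
  then obtain c c' where c: "c \<noteq> 0" "u = c *s x" "c' \<noteq> 0" "w = c' *s x" "u \<noteq> 0"
    using assms(2,3) by auto
  then have "w = (c' / c) *s u" by (simp add: vec_eq_iff)
  then show ?thesis using c by (metis divide_eq_0_iff)
qed

locale points =
  fixes X :: "'k::field point set"
  assumes finite_X: "finite X" and X_sub: "X \<subseteq> P1xP2"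
begin

abbreviation "I \<equiv> vanishing_ideal X"

text \<open>Fixing coordinates for each point turns evaluation into a ring homomorphism; on forms of
  a given degree another choice changes it only by a factor.\<close>

definition rep :: "'k point \<Rightarrow> cox_var \<Rightarrow> 'k" where
  "rep P = (SOME a. homog_coords a P)"

abbreviation ev :: "'k point \<Rightarrow> 'k cox \<Rightarrow> 'k" where
  "ev P \<equiv> eval_mpoly (rep P)"

lemma rep: assumes "P \<in> X" shows "homog_coords (rep P) P"
proof -
  have "fst P \<in> proj_space" "snd P \<in> proj_space" using assms X_sub by (auto simp: P1xP2_def)
  then obtain u w where "u \<in> fst P" "w \<in> snd P" using proj_space_nonempty by metis
  then have "homog_coords (case_cox_var (\<lambda>i. u $ i) (\<lambda>j. w $ j)) P"
    by (simp add: homog_coords_def)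
  then show ?thesis unfolding rep_def by (rule someI[of "\<lambda>a. homog_coords a P"])
qed

lemma coords_scale:
  assumes "P \<in> X" "homog_coords b P"
  shows "\<exists>c e. b = (\<lambda>v. case_cox_var (\<lambda>_. c) (\<lambda>_. e) v * rep P v)"
proof -
  have P: "fst P \<in> proj_space" "snd P \<in> proj_space" using assms X_sub by (auto simp: P1xP2_def)
  obtain c where c: "(\<chi> i. b (Xv i)) = c *s (\<chi> i. rep P (Xv i))"
    using proj_space_scale[OF P(1)] assms(2) rep[OF assms(1)] unfolding homog_coords_def by metis
  obtain e where e: "(\<chi> j. b (Yv j)) = e *s (\<chi> j. rep P (Yv j))"
    using proj_space_scale[OF P(2)] assms(2) rep[OF assms(1)] unfolding homog_coords_def by metis
  have "b v = case_cox_var (\<lambda>_. c) (\<lambda>_. e) v * rep P v" for v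
    using c e by (cases v) (auto simp: vec_eq_iff)
  then show ?thesis by blast
qed

lemma rep_nonzero:
  assumes "P \<in> X" shows "\<exists>i. rep P (Xv i) \<noteq> 0" "\<exists>j. rep P (Yv j) \<noteq> 0"
proof -
  have P: "fst P \<in> proj_space" "snd P \<in> proj_space" using assms X_sub by (auto simp: P1xP2_def)
  have "(\<chi> i. rep P (Xv i)) \<noteq> 0" "(\<chi> j. rep P (Yv j)) \<noteq> 0"
    using proj_space_scale[OF P(1)] proj_space_scale[OF P(2)] rep[OF assms] unfolding homog_coords_def by blast+
  then show "\<exists>i. rep P (Xv i) \<noteq> 0" "\<exists>j. rep P (Yv j) \<noteq> 0"
    by (auto simp: vec_eq_iff)
qed

lemma ideal_facts:
  shows "0 \<in> I" "f \<in> I \<Longrightarrow> g \<in> I \<Longrightarrow> f + g \<in> I" "f \<in> I \<Longrightarrow> g \<in> I \<Longrightarrow> f - g \<in> I"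
    "f \<in> I \<Longrightarrow> a * f \<in> I"
  unfolding vanishing_ideal_def
  using module.span_zero[OF module_mult] module.span_add[OF module_mult]
    module.span_diff[OF module_mult] module.span_scale[OF module_mult] by blast+

lemma ideal_ev: assumes "f \<in> I" "P \<in> X" shows "ev P f = 0"
  using assms(1) unfolding vanishing_ideal_def
proof (induction rule: module.span_induct_alt[OF module_mult, consumes 1, case_names base step])
  case (step c x y)
  then show ?case using rep[OF assms(2)] assms(2) by (auto simp: eval_mpoly_add eval_mpoly_mult)
qed simp

lemma ideal_iff: assumes "f \<in> cox_part d" shows "f \<in> I \<longleftrightarrow> (\<forall>P\<in>X. ev P f = 0)"
proof
  assume 0: "\<forall>P\<in>X. ev P f = 0"
  have "eval_mpoly a f = 0" if "P \<in> X" "homog_coords a P" for P a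
    using coords_scale[OF that] eval_mpoly_scale[OF assms] 0 that(1) by auto
  then show "f \<in> I"
    unfolding vanishing_ideal_def using assms by (intro module.span_base[OF module_mult]) blast
qed (auto intro: ideal_ev)

lemma hc_ideal: assumes "f \<in> I" shows "hc d f \<in> I"
proof -
  have "\<forall>d. hc d f \<in> I"
    using assms unfolding vanishing_ideal_def
  proof (induction rule: module.span_induct_alt[OF module_mult, consumes 1, case_names base step])
    case base
    then show ?case using ideal_facts(1) unfolding vanishing_ideal_def by simp
  next
    case (step c x y)
    then obtain e where e: "x \<in> cox_part e" by blast
    have x: "x \<in> I" unfolding vanishing_ideal_def using step by (intro module.span_base[OF module_mult]) blast
    have "hc d (c * x) = hc (d - e) c * x" for d
      using hc_mult[OF e, of d c] by (simp add: mult.commute)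
    moreover have "hc d y \<in> I" for d
      using step unfolding vanishing_ideal_def by blast
    ultimately have "hc d (c * x + y) \<in> I" for d
      unfolding hc_add by (simp only: ideal_facts(2,4) x)
    then show ?case unfolding vanishing_ideal_def by blast
  qed
  then show ?thesis by (rule spec)
qed

sublocale graded_ideal I
  by unfold_locales (auto intro: ideal_facts hc_ideal)

text \<open>The classical condition that the points impose independent conditions on forms of degree
  \<open>d\<close>.\<close>

definition ev_surj :: "int \<times> int \<Rightarrow> bool" where
  "ev_surj d \<longleftrightarrow> (\<forall>\<tau>. \<exists>f\<in>cox_part d. \<forall>P\<in>X. ev P f = \<tau> P)"

lemma nonvanishing_form:
  assumes "P \<in> X" "0 \<le> e" shows "\<exists>h\<in>cox_part e. ev P h \<noteq> 0"
proof -
  obtain i j where ij: "rep P (Xv i) \<noteq> 0" "rep P (Yv j) \<noteq> 0" using rep_nonzero[OF assms(1)] by blast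
  have pw: "(cox_gen v :: 'k cox) ^ n \<in> cox_part (int n * fst (vdeg v), int n * snd (vdeg v))" for v n
  proof (induction n)
    case (Suc n)
    then show ?case using cox_part_mult[OF cox_part_gen[of v] Suc] by (simp add: algebra_simps plus_prod_def)
  qed (simp add: zero_prod_def[symmetric])
  have "(cox_gen (Xv i) ^ nat (fst e) * cox_gen (Yv j) ^ nat (snd e) :: 'k cox) \<in> cox_part e"
    using cox_part_mult[OF pw[of "Xv i" "nat (fst e)"] pw[of "Yv j" "nat (snd e)"]] assms(2)
    by (simp add: less_eq_prod_def)
  moreover have "ev P (cox_gen (Xv i) ^ nat (fst e) * cox_gen (Yv j) ^ nat (snd e)) \<noteq> 0"
    using ij by (simp add: eval_mpoly_mult eval_mpoly_power eval_mpoly_gen)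
  ultimately show ?thesis by blast
qed

text \<open>Over a finite field there may be no form that is nonzero at all points at once. So each
  point is interpolated separately, the result is multiplied by a form that is nonzero at that
  point, and the products are summed.\<close>

lemma ev_surj_mono: assumes "ev_surj d" "d \<le> e" shows "ev_surj e"
  unfolding ev_surj_def
proof
  fix \<tau> :: "'k point \<Rightarrow> 'k"
  have "\<exists>f\<in>cox_part e. \<forall>Q\<in>X. ev Q f = (if Q = P then \<tau> P else 0)" if P: "P \<in> X" for P
  proof -
    have "0 \<le> e - d" using assms(2) by (auto simp: less_eq_prod_def zero_prod_def)
    from nonvanishing_form[OF P this]
    obtain h where h: "h \<in> cox_part (e - d)" "ev P h \<noteq> 0" by blast
    obtain f where f: "f \<in> cox_part d" "\<forall>Q\<in>X. ev Q f = (if Q = P then \<tau> P / ev P h else 0)"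
      using assms(1)[unfolded ev_surj_def, rule_format, of "\<lambda>Q. if Q = P then \<tau> P / ev P h else 0"] by blast
    show ?thesis
      using cox_part_mult[OF f(1) h(1)] f(2) h(2)
      by (intro bexI[of _ "f * h"]) (auto simp: eval_mpoly_mult)
  qed
  then obtain f where f: "\<And>P. P \<in> X \<Longrightarrow> f P \<in> cox_part e"
    "\<And>P Q. P \<in> X \<Longrightarrow> Q \<in> X \<Longrightarrow> ev Q (f P) = (if Q = P then \<tau> P else 0)" by metis
  have "(\<Sum>P\<in>X. f P) \<in> cox_part e" by (rule cox_part_sum) (rule f)
  moreover have "ev Q (\<Sum>P\<in>X. f P) = \<tau> Q" if "Q \<in> X" for Q
    using that finite_X by (simp add: eval_mpoly_sum f)
  ultimately show "\<exists>f\<in>cox_part e. \<forall>P\<in>X. ev P f = \<tau> P" by blast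
qed

section \<open>Functions on the points and the transfer of Koszul cycles\<close>

definition pmul :: "cox_var \<Rightarrow> ('k point \<Rightarrow> 'k) \<Rightarrow> 'k point \<Rightarrow> 'k" where
  "pmul i t = (\<lambda>P. rep P i * t P)"

sublocale pm: commuting_ops pmul
  by unfold_locales (auto simp: pmul_def fun_eq_iff algebra_simps)

definition evX :: "'k cox \<Rightarrow> 'k point \<Rightarrow> 'k" where
  "evX f = (\<lambda>P. if P \<in> X then ev P f else 0)"

lemma evX_simps [simp]: "evX 0 = 0" "evX (- f) = - evX f" "evX (gmul i f) = pmul i (evX f)"
  by (auto simp: evX_def fun_eq_iff pmul_def eval_mpoly_neg eval_mpoly_mult eval_mpoly_gen)

lemma evX_sum: "evX (sum f B) = (\<Sum>b\<in>B. evX (f b))"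
  by (auto simp: evX_def fun_eq_iff eval_mpoly_sum sum_apply)

lemma evX_diff: "evX (f - g) = evX f - evX g"
  by (auto simp: evX_def fun_eq_iff eval_mpoly_diff)

lemma evX_kd: "evX (kd gmul J z A) = kd pmul J (\<lambda>A. evX (z A)) A"
  by (auto simp: kd_def evX_sum sg_def intro!: sum.cong)

lemma ideal_evX: "f \<in> I \<Longrightarrow> evX f = 0"
  using ideal_ev by (auto simp: evX_def)

lemma evX_ideal: "f \<in> cox_part d \<Longrightarrow> evX f = 0 \<Longrightarrow> f \<in> I"
  unfolding ideal_iff by (metis evX_def zero_fun_apply)

lemma ev_surj_evX: assumes "ev_surj d" "\<And>P. P \<notin> X \<Longrightarrow> \<tau> P = 0" shows "\<exists>f\<in>cox_part d. evX f = \<tau>"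
  using assms unfolding ev_surj_def evX_def fun_eq_iff by metis

text \<open>Koszul homology of \<open>S / I\<close> vanishes when a variable that does not vanish at a given point can
  be divided out pointwise; the hypothesis makes the resulting functions values of forms.\<close>

lemma kex_points:
  assumes JX: "JX \<subseteq> J" "\<And>P. P \<in> X \<Longrightarrow> \<exists>j\<in>JX. rep P j \<noteq> 0"
    and deg: "\<And>A. A \<subseteq> J \<Longrightarrow> card A = Suc a \<Longrightarrow> A \<inter> JX \<noteq> {} \<Longrightarrow>
      ev_surj (d - sum vdeg A) \<or> (\<forall>j\<in>A \<inter> JX. \<not> 0 \<le> d - sum vdeg (A - {j}))"
  shows "kex gmul vdeg J cox_part I a d"
  unfolding kex_def
proof (intro ballI impI)
  fix z :: "cox_var set \<Rightarrow> 'k cox"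
  assume z: "z \<in> kel vdeg J cox_part a d" and cyc: "\<forall>A. kd gmul J z A \<in> I"
  define y where "y = (\<lambda>A. evX (z A))"
  have ycyc: "kd pmul J y A = 0" for A
    using ideal_evX cyc by (simp add: y_def evX_kd[symmetric])
  \<comment> \<open>Different points may need different variables, so no single homotopy contracts
    the complex. The operator \<open>q j\<close> divides by coordinate \<open>j\<close> only at the
    points assigned to \<open>j\<close>, and in the sum \<open>s\<close> of these homotopies exactly
    one term acts at each point.\<close>
  obtain jj where jj: "\<And>P. P \<in> X \<Longrightarrow> jj P \<in> JX" "\<And>P. P \<in> X \<Longrightarrow> rep P (jj P) \<noteq> 0"
    using JX(2) by metis
  define q where "q j t = (\<lambda>P. if P \<in> X \<and> j = jj P then t P / rep P j else 0)" for j and t :: "'k point \<Rightarrow> 'k"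
  define s where "s A = (\<Sum>j\<in>JX. if j \<in> A then sg j (A - {j}) (q j (y (A - {j}))) else 0)" for A
  have ds: "kd pmul J s A = y A" if A: "A \<subseteq> J" for A
  proof
    fix P
    have "kd pmul J s A = (\<Sum>j\<in>JX. kd pmul J (\<lambda>A. if j \<in> A then sg j (A - {j}) (q j (y (A - {j}))) else 0) A)"
      unfolding s_def[abs_def] by (rule pm.kd_sum)
    also have "\<dots> = (\<Sum>j\<in>JX. if j \<in> A then q j (pmul j (y A)) else pmul j (q j (y A)))"
      using JX(1) A ycyc by (intro sum.cong refl pm.kd_homotopy)
        (auto simp: q_def pmul_def fun_eq_iff add_divide_distrib)
    finally have "kd pmul J s A P = (\<Sum>j\<in>JX. if P \<in> X \<and> j = jj P then y A P else 0)"
      using jj(2)[of P] by (auto simp: sum_apply q_def pmul_def intro!: sum.cong)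
    also have "\<dots> = y A P"
      using jj(1)[of P] by (cases "P \<in> X") (simp_all add: y_def evX_def)
    finally show "kd pmul J s A P = y A P" .
  qed
  \<comment> \<open>The contraction lives on functions and must come from forms. Either its degree
    admits interpolation, or all coefficients \<open>y (A - {j})\<close> that enter
    \<open>s A\<close> vanish, by degree or by support.\<close>
  have "\<exists>f. (if A \<subseteq> J \<and> card A = Suc a then f \<in> cox_part (d - sum vdeg A) else f = 0) \<and> evX f = s A" for A
  proof (cases "A \<subseteq> J \<and> card A = Suc a \<and> A \<inter> JX \<noteq> {} \<and> ev_surj (d - sum vdeg A)")
    case True
    moreover have "s A P = 0" if "P \<notin> X" for P
      using that by (auto simp: s_def sum_apply q_def sg_def intro!: sum.neutral)
    ultimately show ?thesis using ev_surj_evX[of "d - sum vdeg A" "s A"] by auto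
  next
    case False
    have "y (A - {j}) = 0" if j: "j \<in> JX" "j \<in> A" for j
    proof (cases "A \<subseteq> J \<and> card A = Suc a")
      case True
      then have "\<not> 0 \<le> d - sum vdeg (A - {j})" using False deg[of A] j by blast
      moreover have "z (A - {j}) \<in> cox_part (d - sum vdeg (A - {j}))"
        using True j by (intro kel_in[OF z]) auto
      ultimately show ?thesis using cox_part_not_ge_0 by (fastforce simp: y_def)
    next
      case F: False
      have "\<not> (A - {j} \<subseteq> J \<and> card (A - {j}) = a)"
        using F j JX(1) card_Suc_Diff1[OF finite j(2)] by auto
      then show ?thesis using kel_zero[OF z] by (simp add: y_def)
    qed
    then have "s A = 0" by (auto simp: s_def q_def fun_eq_iff sum_apply sg_def intro!: sum.neutral)
    then show ?thesis by (intro exI[of _ 0]) auto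
  qed
  then obtain w where w: "\<And>A. (if A \<subseteq> J \<and> card A = Suc a then w A \<in> cox_part (d - sum vdeg A) else w A = 0)"
    "\<And>A. evX (w A) = s A" by metis
  have wk: "w \<in> kel vdeg J cox_part (Suc a) d"
    using w(1) by (intro kelI) (auto split: if_splits)
  have "z A - kd gmul J w A \<in> I" for A
  proof (cases "A \<subseteq> J \<and> card A = a")
    case True
    have "z A - kd gmul J w A \<in> cox_part (d - sum vdeg A)"
      using True by (intro cox_part_diff kel_in[OF z] kel_in[OF cox.kd_kel[OF wk]]) auto
    moreover have "evX (z A - kd gmul J w A) = 0"
      using True by (simp add: evX_diff evX_kd w(2) ds y_def)
    ultimately show ?thesis by (rule evX_ideal)
  next
    case False
    then show ?thesis using kel_zero[OF z False] kel_zero[OF cox.kd_kel[OF wk] False] ideal_facts(1) by simp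
  qed
  then show "\<exists>u\<in>kel vdeg J cox_part (Suc a) d. \<forall>A. z A - kd gmul J u A \<in> I"
    using wk by blast
qed

text \<open>At most two \<open>x\<close>-variables occur in \<open>A\<close>, so the
  \<open>x\<close>-degree stays at least \<open>n\<close>. If the \<open>y\<close>-degree becomes
  negative, putting an \<open>x\<close>-variable back does not help, which is the second alternative
  of \<open>kex_points\<close>.\<close>

lemma kex_large_x:
  assumes "ev_surj (n, 0)" "n + 2 \<le> i" shows "kex gmul vdeg UNIV cox_part I a (i, j)"
proof (rule kex_points[of "range Xv"])
  fix A
  show "ev_surj ((i, j) - sum vdeg A) \<or> (\<forall>k\<in>A \<inter> range Xv. \<not> 0 \<le> (i, j) - sum vdeg (A - {k}))"
  proof (cases "0 \<le> j - int (card (A \<inter> range Yv))")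
    case True
    then have "(n, 0) \<le> (i, j) - sum vdeg A"
      using assms(2) card_X_le[of A] by (simp add: sum_vdeg less_eq_prod_def)
    then show ?thesis using ev_surj_mono[OF assms(1)] by blast
  next
    case False
    have "(A - {k}) \<inter> range Yv = A \<inter> range Yv" if "k \<in> range Xv" for k using that by auto
    then show ?thesis using False by (auto simp: sum_vdeg less_eq_prod_def zero_prod_def)
  qed
qed (use rep_nonzero in auto)

lemma kex_large_y:
  assumes "ev_surj (0, n)" "n + 3 \<le> j" shows "kex gmul vdeg UNIV cox_part I a (i, j)"
proof (rule kex_points[of "range Yv"])
  fix A
  show "ev_surj ((i, j) - sum vdeg A) \<or> (\<forall>k\<in>A \<inter> range Yv. \<not> 0 \<le> (i, j) - sum vdeg (A - {k}))"
  proof (cases "0 \<le> i - int (card (A \<inter> range Xv))")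
    case True
    then have "(0, n) \<le> (i, j) - sum vdeg A"
      using assms(2) card_Y_le[of A] by (simp add: sum_vdeg less_eq_prod_def)
    then show ?thesis using ev_surj_mono[OF assms(1)] by blast
  next
    case False
    have "(A - {k}) \<inter> range Xv = A \<inter> range Xv" if "k \<in> range Yv" for k using that by auto
    then show ?thesis using False by (auto simp: sum_vdeg less_eq_prod_def zero_prod_def)
  qed
qed (use rep_nonzero in auto)

text \<open>Without \<open>x\<close>-variables the \<open>x\<close>-degree does not drop, and
  \<open>y\<close>-degree at least 3 survives the removal of all three \<open>y\<close>; so
  interpolation is available for every \<open>A\<close>.\<close>

lemma kex_Y:
  assumes "ev_surj (n, 0)" "n \<le> i" "3 \<le> j" shows "kex gmul vdeg (range Yv) cox_part I a (i, j)"
proof (rule kex_points[of "range Yv"])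
  fix A :: "cox_var set" assume A: "A \<subseteq> range Yv"
  then have "(n, 0) \<le> (i, j) - sum vdeg A"
    using assms(2,3) card_Y_le[of A] by (auto simp: vdeg_Y_sum[OF A] less_eq_prod_def Int_absorb2)
  then show "ev_surj ((i, j) - sum vdeg A) \<or> (\<forall>k\<in>A \<inter> range Yv. \<not> 0 \<le> (i, j) - sum vdeg (A - {k}))"
    using ev_surj_mono[OF assms(1)] by blast
qed (use rep_nonzero in auto)

lemma kex_zeroI:
  assumes "\<And>z A. z \<in> kel vdeg J cox_part a d \<Longrightarrow> (\<And>A. kd gmul J z A \<in> I) \<Longrightarrow> A \<subseteq> J \<Longrightarrow> card A = a \<Longrightarrow> z A \<in> I"
  shows "kex gmul vdeg J cox_part I a d"
  unfolding kex_def
proof (intro ballI impI)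
  fix z :: "cox_var set \<Rightarrow> 'k cox" assume z: "z \<in> kel vdeg J cox_part a d" "\<forall>A. kd gmul J z A \<in> I"
  have "z A \<in> I" for A
    using assms[OF z(1), of A] z(2) kel_zero[OF z(1), of A] ideal_facts(1) by (cases "A \<subseteq> J \<and> card A = a") auto
  moreover have "(\<lambda>A. 0) \<in> kel vdeg J cox_part (Suc a) d" by (rule kelI) auto
  ultimately show "\<exists>u\<in>kel vdeg J cox_part (Suc a) d. \<forall>A. z A - kd gmul J u A \<in> I"
    by (intro bexI[of _ "\<lambda>A. 0"]) (auto simp: cox.kd_zero)
qed

lemma kex_not_ge_0:
  assumes "\<not> 0 \<le> d" shows "kex gmul vdeg J cox_part I a d"
proof (rule kex_zeroI)
  fix z :: "cox_var set \<Rightarrow> 'k cox" and A :: "cox_var set"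
  assume z: "z \<in> kel vdeg J cox_part a d" "A \<subseteq> J" "card A = a"
  have "0 \<le> sum vdeg A" by (simp add: sum_vdeg zero_prod_def)
  then have "\<not> 0 \<le> d - sum vdeg A" using assms by (auto simp: less_eq_prod_def)
  then have "z A = 0" using cox_part_not_ge_0 kel_in[OF z] by blast
  then show "z A \<in> I" using ideal_facts(1) by simp
qed

text \<open>In \<open>y\<close>-degree at most 2 a coefficient at a set with all three
  \<open>y\<close> is zero. So at least four variables leave only sets with both \<open>x\<close>
  and two \<open>y\<close>. Removing from such a set an \<open>x\<close> that is nonzero at a point,
  the cycle condition there has a single term, since every other term involves the third
  \<open>y\<close>; hence the coefficient vanishes at the point.\<close>

lemma kex_ge_4:
  assumes "4 \<le> a" "j \<le> 2" shows "kex gmul vdeg UNIV cox_part I a (i, j)"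
proof (rule kex_zeroI)
  fix z :: "cox_var set \<Rightarrow> 'k cox" and A :: "cox_var set"
  assume z: "z \<in> kel vdeg UNIV cox_part a (i, j)" "\<And>A. kd gmul UNIV z A \<in> I" and A: "card A = a"
  have Y3: "z B = 0" if "card (B \<inter> range Yv) = 3" for B
  proof (cases "card B = a")
    case True
    have "\<not> 0 \<le> (i, j) - sum vdeg B" using that assms(2) by (simp add: sum_vdeg zero_prod_def less_eq_prod_def)
    then show ?thesis using cox_part_not_ge_0 kel_in[OF z(1), of B] True by blast
  qed (use kel_zero[OF z(1)] in auto)
  show "z A \<in> I"
  proof (cases "card (A \<inter> range Yv) = 3")
    case False
    then have X2: "card (A \<inter> range Xv) = 2" and Y2: "card (A \<inter> range Yv) = 2"
      using card_vars[of A] card_X_le[of A] card_Y_le[of A] A assms(1) by auto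
    have RX: "range Xv \<subseteq> A"
    proof -
      have "A \<inter> range Xv = range Xv"
        using X2 by (intro card_subset_eq) (auto simp: card_image inj_on_def)
      then show ?thesis by blast
    qed
    have "ev P (z A) = 0" if P: "P \<in> X" for P
    proof -
      obtain x where x: "rep P (Xv x) \<noteq> 0" using rep_nonzero[OF P] by blast
      define B where "B = A - {Xv x}"
      have insB: "insert (Xv x) B = A" "Xv x \<notin> B" using RX by (auto simp: B_def)
      have "kd gmul UNIV z B = (\<Sum>l\<in>{Xv x}. sg l B (gmul l (z (insert l B))))"
        unfolding kd_def if_P[OF subset_UNIV]
      proof (rule sum.mono_neutral_right)
        show "\<forall>l\<in>UNIV - B - {Xv x}. sg l B (gmul l (z (insert l B))) = 0"
        proof
          fix l assume l: "l \<in> UNIV - B - {Xv x}"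
          then have "l \<notin> A" using insB by auto
          then have "l \<in> range Yv" using RX UNIV_cox_var by blast
          then have "insert l B \<inter> range Yv = insert l (A \<inter> range Yv)" by (auto simp: B_def)
          then have "card (insert l B \<inter> range Yv) = 3" using Y2 \<open>l \<notin> A\<close> by simp
          then show "sg l B (gmul l (z (insert l B))) = 0" using Y3 by simp
        qed
      qed (use insB in auto)
      then have "ev P (sg (Xv x) B (gmul (Xv x) (z A))) = 0"
        using z(2)[of B] ideal_ev P insB by simp
      then show ?thesis using x by (auto simp: sg_def eval_mpoly_neg eval_mpoly_mult eval_mpoly_gen split: if_splits)
    qed
    then show ?thesis using ideal_iff kel_in[OF z(1), of A] A by blast
  qed (use Y3 ideal_facts(1) in simp)
qed

text \<open>The nonzero class is the boundary of \<open>\<tau> e\<^bsub>A0\<^esub>\<close>, where the function \<open>\<tau>\<close> on \<open>X\<close> is not given by a form of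
  degree \<open>(n, 0)\<close> although the coefficients of that boundary are given by forms.\<close>

lemma not_kex_3:
  assumes "ev_surj (n + 1, 0)" "ev_surj (n, 1)" "\<not> ev_surj (n, 0)"
  shows "\<not> kex gmul vdeg UNIV cox_part I 3 (n + 2, 2)"
proof
  assume kex: "kex gmul vdeg UNIV cox_part I 3 (n + 2, 2)"
  obtain \<tau> where tau: "\<not> (\<exists>f\<in>cox_part (n, 0). \<forall>P\<in>X. ev P f = \<tau> P)"
    using assms(3) unfolding ev_surj_def by blast
  \<comment> \<open>Both \<open>x\<close> and two of the \<open>y\<close>: the degree
    \<open>(2, 2)\<close> of this set brings \<open>(n + 2, 2)\<close> down to
    \<open>(n, 0)\<close>, where interpolation fails.\<close>
  define A0 where "A0 = range Xv \<union> {Yv 0, Yv 1}"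
  have A0Y: "A0 \<inter> range Yv = {Yv 0, Yv 1}" by (auto simp: A0_def)
  have A0X: "A0 \<inter> range Xv = range Xv" by (auto simp: A0_def)
  have "card (range Xv) = 2" by (simp add: card_image inj_on_def)
  then have degA0: "(n + 2, 2) - sum vdeg A0 = (n, 0)" and cardA0: "card A0 = 4"
    using card_vars[of A0] by (simp_all add: sum_vdeg A0X A0Y)
  define r where "r A = (if A = A0 then (\<lambda>P. if P \<in> X then \<tau> P else 0) else 0)" for A
  define y where "y = kd pmul UNIV r"
  have yB: "y (A0 - {l}) = sg l (A0 - {l}) (pmul l (r A0))" if l: "l \<in> A0" for l
  proof -
    have "y (A0 - {l}) = (\<Sum>i\<in>{l}. sg i (A0 - {l}) (pmul i (r (insert i (A0 - {l})))))"
      unfolding y_def kd_def if_P[OF subset_UNIV]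
      by (rule sum.mono_neutral_right) (use l in \<open>auto simp: r_def\<close>)
    then show ?thesis using l by (simp add: insert_absorb)
  qed
  have y0: "y B = 0" if "\<not> (\<exists>l\<in>A0. B = A0 - {l})" for B
    unfolding y_def kd_def if_P[OF subset_UNIV]
  proof (rule sum.neutral, rule ballI)
    fix i assume "i \<in> UNIV - B"
    then have "insert i B \<noteq> A0" using that by auto
    then show "sg i B (pmul i (r (insert i B))) = 0" by (simp add: r_def)
  qed
  have "\<exists>f. (if card B = 3 then f \<in> cox_part ((n + 2, 2) - sum vdeg B) else f = 0) \<and> evX f = y B" for B
  proof (cases "\<exists>l\<in>A0. B = A0 - {l}")
    case True
    then obtain l where l: "l \<in> A0" "B = A0 - {l}" by blast
    have "sum vdeg A0 = vdeg l + sum vdeg B" using l by (simp add: sum.remove)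
    then have "(n + 2, 2) - sum vdeg B = (n, 0) + vdeg l" using degA0 by (simp add: algebra_simps)
    \<comment> \<open>The degree is \<open>(n + 1, 0)\<close> if \<open>l\<close> is an
      \<open>x\<close> and \<open>(n, 1)\<close> if it is a \<open>y\<close>; this is where both
      surjectivity hypotheses enter.\<close>
    then have "ev_surj ((n + 2, 2) - sum vdeg B)" using assms(1,2) by (cases l) simp_all
    moreover have "y B P = 0" if "P \<notin> X" for P
      using that l by (simp add: yB sg_def pmul_def r_def)
    moreover have "card B = 3" using cardA0 l by simp
    ultimately show ?thesis using ev_surj_evX[of "(n + 2, 2) - sum vdeg B" "y B"] by auto
  next
    case False
    then show ?thesis using y0 by (intro exI[of _ 0]) auto
  qed
  then obtain z where z: "\<And>B. if card B = 3 then z B \<in> cox_part ((n + 2, 2) - sum vdeg B) else z B = 0"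
    "\<And>B. evX (z B) = y B" by metis
  have zk: "z \<in> kel vdeg UNIV cox_part (Suc 2) (n + 2, 2)"
    using z(1) by (intro kelI) (auto split: if_splits)
  have "kd gmul UNIV z A \<in> I" for A
  proof (cases "card A = 2")
    case True
    then have "kd gmul UNIV z A \<in> cox_part ((n + 2, 2) - sum vdeg A)"
      using kel_in[OF cox.kd_kel[OF zk], of A] by simp
    moreover have "evX (kd gmul UNIV z A) = 0"
      by (simp add: evX_kd z(2)) (simp add: y_def pm.kd_kd)
    ultimately show ?thesis by (rule evX_ideal)
  qed (use kel_zero[OF cox.kd_kel[OF zk]] ideal_facts(1) in auto)
  then obtain u where u: "u \<in> kel vdeg UNIV cox_part 4 (n + 2, 2)" "\<And>A. z A - kd gmul UNIV u A \<in> I"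
    using kex zk unfolding kex_def by (auto simp: eval_nat_numeral)
  have uA0: "u A0 \<in> cox_part (n, 0)" using kel_in[OF u(1), of A0] cardA0 degA0 by simp
  \<comment> \<open>If the class bounded, the coefficient of the bounding chain at \<open>A0\<close>
    would be a form with values \<open>\<tau>\<close>: at \<open>A0\<close> without a nonvanishing
    \<open>x\<close>, all other terms involve the third \<open>y\<close> and are zero by
    degree.\<close>
  have "ev P (u A0) = \<tau> P" if P: "P \<in> X" for P
  proof -
    obtain x where x: "rep P (Xv x) \<noteq> 0" using rep_nonzero[OF P] by blast
    define B where "B = A0 - {Xv x}"
    have insB: "insert (Xv x) B = A0" "Xv x \<notin> B" "Xv x \<in> A0" by (auto simp: B_def A0_def)
    have "kd gmul UNIV u B = (\<Sum>l\<in>{Xv x}. sg l B (gmul l (u (insert l B))))"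
      unfolding kd_def if_P[OF subset_UNIV]
    proof (rule sum.mono_neutral_right)
      show "\<forall>l\<in>UNIV - B - {Xv x}. sg l B (gmul l (u (insert l B))) = 0"
      proof
        fix l assume l: "l \<in> UNIV - B - {Xv x}"
        then have "l \<notin> A0" using insB by auto
        then have "l \<in> range Yv" using UNIV_cox_var by (auto simp: A0_def)
        then have "insert l B \<inter> range Yv = insert l {Yv 0, Yv 1}" using A0Y by (auto simp: B_def)
        then have "card (insert l B \<inter> range Yv) = 3" using \<open>l \<notin> A0\<close> by (simp add: A0_def)
        then have "\<not> 0 \<le> (n + 2, 2) - sum vdeg (insert l B)"
          by (simp add: sum_vdeg zero_prod_def less_eq_prod_def)
        moreover have "card (insert l B) = 4" using cardA0 insB l by (metis DiffD2 card_insert_disjoint finite Diff_iff)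
        ultimately have "u (insert l B) = 0" using cox_part_not_ge_0 kel_in[OF u(1), of "insert l B"] by blast
        then show "sg l B (gmul l (u (insert l B))) = 0" by simp
      qed
    qed (use insB in auto)
    then have du: "kd gmul UNIV u B = sg (Xv x) B (gmul (Xv x) (u A0))" using insB by simp
    have "ev P (z B) = ev P (kd gmul UNIV u B)"
      using ideal_ev[OF u(2) P, of B] by (simp add: eval_mpoly_diff)
    moreover have "ev P (z B) = y B P" using z(2)[of B] P by (metis evX_def)
    moreover have "y B P = sg (Xv x) B (rep P (Xv x) * \<tau> P)"
      using yB[OF insB(3)] P by (simp add: B_def sg_def r_def pmul_def)
    ultimately have "sg (Xv x) B (rep P (Xv x) * \<tau> P) = sg (Xv x) B (rep P (Xv x) * ev P (u A0))"
      by (simp add: du sg_def eval_mpoly_neg eval_mpoly_mult eval_mpoly_gen split: if_splits)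
    then show ?thesis using x by (simp add: sg_def split: if_splits)
  qed
  then show False using tau uA0 by blast
qed

end

section \<open>Existence of minimal resolutions\<close>

definition fscale :: "'k::field \<Rightarrow> (nat \<Rightarrow> 'k cox) \<Rightarrow> nat \<Rightarrow> 'k cox" where
  "fscale c v = (\<lambda>g. cox_const c * v g)"

interpretation fv: vector_space "fscale :: 'k::field \<Rightarrow> _"
  by unfold_locales (auto simp: fscale_def fun_eq_iff algebra_simps cox_const_add cox_const_mult)

lemma finite_mdeg: "finite {m. mdeg m = e}"
proof (rule finite_imageD)
  define b where "b = nat (fst e) + nat (snd e)"
  have le: "lk m v \<le> b" if "mdeg m = e" for m v
  proof -
    have "int (lk m (Xv i)) \<le> fst e" for i
      using that member_le_sum[of i UNIV "\<lambda>i. int (lk m (Xv i))"] by (auto simp: cox_deg_def)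
    then have "lk m (Xv i) \<le> b" for i
      unfolding b_def using le_nat_iff trans_le_add1 nat_int nat_mono by metis
    moreover have "int (lk m (Yv j)) \<le> snd e" for j
      using that member_le_sum[of j UNIV "\<lambda>i. int (lk m (Yv i))"] by (auto simp: cox_deg_def)
    then have "lk m (Yv j) \<le> b" for j
      unfolding b_def using le_nat_iff trans_le_add2 nat_int nat_mono by metis
    ultimately show ?thesis by (cases v) auto
  qed
  have "lk ` {m. mdeg m = e} \<subseteq> PiE UNIV (\<lambda>_. {..b})" unfolding PiE_UNIV_domain using le by auto
  moreover have "finite (PiE (UNIV :: cox_var set) (\<lambda>_. {..b}))" by (rule finite_PiE) simp_all
  ultimately show "finite (lk ` {m. mdeg m = e})" by (rule finite_subset)
  show "inj_on lk {m. mdeg m = e}" by (rule inj_onI) (rule poly_mapping_eqI, simp only:)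
qed

lemma fpart_finite_span:
  fixes \<gamma> :: "nat \<Rightarrow> int \<times> int"
  assumes "finite G"
  shows "\<exists>T :: (nat \<Rightarrow> 'k::field cox) set. finite T \<and> fpart G \<gamma> d \<subseteq> fv.span T"
proof -
  define e :: "nat \<Rightarrow> (cox_var \<Rightarrow>\<^sub>0 nat) \<Rightarrow> nat \<Rightarrow> 'k cox"
    where "e g m = (\<lambda>h. if h = g then Poly_Mapping.single m 1 else 0)" for g m
  define T where "T = (\<Union>g\<in>G. e g ` {m. mdeg m = d - \<gamma> g})"
  have "finite T" using assms finite_mdeg by (auto simp: T_def)
  moreover have "v \<in> fv.span T" if v: "v \<in> fpart G \<gamma> d" for v
  proof -
    have expand: "(\<Sum>m\<in>ks f. cox_const (lk f m) * Poly_Mapping.single m 1) = f" for f :: "'k cox"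
      by (subst (3) poly_mapping_sum_single[of f]) (simp add: cox_const_def mult_single)
    have "v h = (\<Sum>g\<in>G. \<Sum>m\<in>ks (v g). fscale (lk (v g) m) (e g m)) h" for h
    proof -
      have "(\<Sum>g\<in>G. \<Sum>m\<in>ks (v g). fscale (lk (v g) m) (e g m)) h =
          (\<Sum>g\<in>G. if g = h then \<Sum>m\<in>ks (v g). cox_const (lk (v g) m) * Poly_Mapping.single m 1 else 0)"
        by (auto simp: sum_apply fscale_def e_def intro!: sum.cong)
      also have "\<dots> = (if h \<in> G then v h else 0)"
        unfolding expand using assms by simp
      finally show ?thesis using fpart_fcar[OF v] by (auto simp: fcar_def)
    qed
    then have eq: "v = (\<Sum>g\<in>G. \<Sum>m\<in>ks (v g). fscale (lk (v g) m) (e g m))" by (rule ext)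
    have "e g m \<in> fv.span T" if "g \<in> G" "m \<in> ks (v g)" for g m
      using that cox_partD[OF fpart_cox_part[OF v], of g m]
      by (intro fv.span_base) (auto simp: T_def in_keys_iff)
    then show ?thesis by (subst eq) (intro fv.span_sum fv.span_scale, auto)
  qed
  ultimately show ?thesis by blast
qed

text \<open>Representatives of a basis of \<open>V / W\<close>: the vectors added when a basis of
  \<open>W\<close> is extended to one of \<open>V\<close>.\<close>

lemma (in vector_space) complement_basis:
  assumes W: "subspace W" "W \<subseteq> V" and V: "subspace V" and T: "finite T" "V \<subseteq> span T"
  shows "\<exists>E. finite E \<and> E \<subseteq> V \<and> (\<forall>z\<in>V. \<exists>c. z - (\<Sum>e\<in>E. scale (c e) e) \<in> W) \<and>
    (\<forall>c. (\<Sum>e\<in>E. scale (c e) e) \<in> W \<longrightarrow> (\<forall>e\<in>E. c e = 0))"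
proof -
  obtain B0 where B0: "B0 \<subseteq> W" "independent B0" "W \<subseteq> span B0"
    using maximal_independent_subset[of W] by blast
  obtain B where B: "B0 \<subseteq> B" "B \<subseteq> V" "independent B" "V \<subseteq> span B"
    using maximal_independent_subset_extend[of B0 V] B0 W(2) by blast
  have finB: "finite B" using independent_span_bound[OF T(1) B(3)] B(2) T(2) by blast
  then have fin0: "finite B0" using B(1) finite_subset by blast
  define E where "E = B - B0"
  have split: "(\<Sum>b\<in>B. scale (r b) b) = (\<Sum>b\<in>B0. scale (r b) b) + (\<Sum>b\<in>E. scale (r b) b)" for r
    using finB B(1) by (simp add: E_def sum.subset_diff[of B0 B] add.commute)
  have inW: "(\<Sum>b\<in>B0. scale (r b) b) \<in> W" for r
    using B0(1) W(1) by (intro subspace_sum subspace_scale) auto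
  have "\<exists>c. z - (\<Sum>e\<in>E. scale (c e) e) \<in> W" if "z \<in> V" for z
  proof -
    have "z \<in> range (\<lambda>u. \<Sum>v\<in>B. scale (u v) v)"
      using that B(4) span_finite[OF finB] by blast
    then obtain r where "z = (\<Sum>b\<in>B. scale (r b) b)" by (rule rangeE)
    then have "z - (\<Sum>e\<in>E. scale (r e) e) = (\<Sum>b\<in>B0. scale (r b) b)" by (simp add: split)
    then show ?thesis using inW by metis
  qed
  moreover have "c e = 0" if sum: "(\<Sum>e\<in>E. scale (c e) e) \<in> W" and e: "e \<in> E" for c e
  proof -
    have "(\<Sum>e\<in>E. scale (c e) e) \<in> range (\<lambda>u. \<Sum>v\<in>B0. scale (u v) v)"
      using sum B0(3) span_finite[OF fin0] by blast
    then obtain r where r: "(\<Sum>e\<in>E. scale (c e) e) = (\<Sum>b\<in>B0. scale (r b) b)" by (rule rangeE)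
    define s where "s b = (if b \<in> B0 then - r b else c b)" for b
    have "(\<Sum>b\<in>B. scale (s b) b) = (\<Sum>b\<in>B0. scale (- r b) b) + (\<Sum>b\<in>E. scale (c b) b)"
      unfolding split by (intro arg_cong2[of _ _ _ _ "(+)"] sum.cong) (auto simp: s_def E_def)
    also have "\<dots> = 0" by (simp add: r sum_negf)
    finally have "s e = 0" using B(3) finB e independentD[of B B s e] by (auto simp: E_def)
    then show ?thesis using e by (simp add: s_def E_def)
  qed
  ultimately show ?thesis using finB B(2) by (intro exI[of _ E]) (auto simp: E_def)
qed

text \<open>The invariant of one stage of the construction: \<open>Z\<close> is the module still to
  be covered, inside the free module on \<open>G\<close>. The finite set \<open>Bx\<close> is common
  to all stages; since Koszul homology of \<open>Z\<close> vanishes outside it, new generators are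
  needed only in these degrees.\<close>

locale syzygies =
  fixes Bx :: "(int \<times> int) set" and G :: "nat set" and \<gamma> :: "nat \<Rightarrow> int \<times> int"
    and Z :: "int \<times> int \<Rightarrow> (nat \<Rightarrow> 'k::field cox) set"
  assumes fin_Bx: "finite Bx" and Bx_ge_0: "d \<in> Bx \<Longrightarrow> 0 \<le> d"
    and fin_G: "finite G" and \<gamma>_ge_0: "g \<in> G \<Longrightarrow> 0 \<le> \<gamma> g"
    and Z_sub: "Z d \<subseteq> fpart G \<gamma> d"
    and Z_zero: "0 \<in> Z d"
    and Z_diff: "v \<in> Z d \<Longrightarrow> w \<in> Z d \<Longrightarrow> v - w \<in> Z d"
    and Z_mult: "f \<in> cox_part e \<Longrightarrow> v \<in> Z d \<Longrightarrow> (\<lambda>g. f * v g) \<in> Z (d + e)"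
    and Z_const: "v \<in> Z d \<Longrightarrow> lk (v g) 0 = 0"
    and Z_kex: "d \<notin> Bx \<Longrightarrow> kex fmul vdeg UNIV Z {0} a d"
begin

sublocale Z: graded_ops fmul vdeg Z
  by unfold_locales (auto simp: Z_zero Z_diff fmul_def intro: Z_mult)

lemma fpart_not_ge_0:
  assumes "v \<in> fpart G \<gamma> d" "\<not> 0 \<le> d" shows "v = 0"
proof
  fix g
  show "v g = 0 g"
  proof (cases "g \<in> G")
    case True
    then have "\<not> 0 \<le> d - \<gamma> g" using \<gamma>_ge_0[OF True] assms(2) by (auto simp: less_eq_prod_def)
    then show ?thesis using cox_part_not_ge_0 fpart_cox_part[OF assms(1), of g] by simp
  qed (use fpart_fcar[OF assms(1)] in \<open>simp add: fcar_def\<close>)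
qed

text \<open>The part of degree \<open>d\<close> of the product of the maximal graded ideal with
  \<open>Z\<close>, as the image of the last Koszul differential.\<close>

definition mZ :: "int \<times> int \<Rightarrow> (nat \<Rightarrow> 'k cox) set" where
  "mZ d = (\<lambda>u. kd fmul UNIV u {}) ` kel vdeg UNIV Z (Suc 0) d"

lemma Z_scale: "v \<in> Z d \<Longrightarrow> fscale c v \<in> Z d"
  using Z_mult[OF cox_part_const, of v d c] by (simp add: fscale_def)

lemma subspace_Z: "fv.subspace (Z d)"
  by (auto simp: fv.subspace_def Z_zero Z.gr_add Z_scale)

lemma mZ_sub: "mZ d \<subseteq> Z d"
proof
  fix v assume "v \<in> mZ d"
  then obtain u where u: "u \<in> kel vdeg UNIV Z (Suc 0) d" "v = kd fmul UNIV u {}"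
    unfolding mZ_def by blast
  show "v \<in> Z d" using kel_in[OF Z.kd_kel[OF u(1)], of "{}"] u(2) by simp
qed

lemma mZ_diff: "v \<in> mZ d \<Longrightarrow> w \<in> mZ d \<Longrightarrow> v - w \<in> mZ d"
  unfolding mZ_def by (auto simp: fm.kd_diff[symmetric] intro!: imageI Z.kel_diff)

lemma mZ_zero: "0 \<in> mZ d"
proof -
  have "(\<lambda>A. 0) \<in> kel vdeg UNIV Z (Suc 0) d" by (rule kelI) (auto simp: Z_zero)
  then show ?thesis unfolding mZ_def by (rule image_eqI[rotated]) (simp add: fm.kd_zero)
qed

lemma mZ_scale: assumes "v \<in> mZ d" shows "fscale c v \<in> mZ d"
proof -
  obtain u where u: "u \<in> kel vdeg UNIV Z (Suc 0) d" "v = kd fmul UNIV u {}"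
    using assms by (auto simp: mZ_def)
  have "(\<lambda>A. fscale c (u A)) \<in> kel vdeg UNIV Z (Suc 0) d"
    using kel_in[OF u(1)] kel_zero[OF u(1)] by (intro kelI) (auto simp: Z_scale)
  moreover have "fscale c v = kd fmul UNIV (\<lambda>A. fscale c (u A)) {}"
    by (auto simp: u(2) kd_def fmul_def fscale_def sg_def sum_apply sum_distrib_left algebra_simps fun_eq_iff intro!: sum.cong)
  ultimately show ?thesis by (auto simp: mZ_def)
qed

lemma subspace_mZ: "fv.subspace (mZ d)"
proof -
  have "v + w \<in> mZ d" if "v \<in> mZ d" "w \<in> mZ d" for v w
    using mZ_diff[OF that(1) mZ_diff[OF mZ_zero that(2)]] by simp
  then show ?thesis by (auto simp: fv.subspace_def mZ_zero mZ_scale)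
qed

lemma min_gens:
  "\<exists>E. finite E \<and> E \<subseteq> Z d \<and> (\<forall>z\<in>Z d. \<exists>c. z - (\<Sum>e\<in>E. fscale (c e) e) \<in> mZ d) \<and>
    (\<forall>c. (\<Sum>e\<in>E. fscale (c e) e) \<in> mZ d \<longrightarrow> (\<forall>e\<in>E. c e = 0))"
proof -
  obtain T :: "(nat \<Rightarrow> 'k cox) set" where T: "finite T" "fpart G \<gamma> d \<subseteq> fv.span T"
    using fpart_finite_span[OF fin_G] by blast
  have "Z d \<subseteq> fv.span T" using T(2) Z_sub[of d] by blast
  then show ?thesis
    by (rule fv.complement_basis[OF subspace_mZ mZ_sub subspace_Z T(1)])
qed

text \<open>Graded Nakayama: lifting a basis of \<open>Z / mZ\<close> in the finitely many degrees where this
  quotient can be nonzero gives minimal generators of \<open>Z\<close>.\<close>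

lemma next_step:
  "\<exists>C \<gamma>' M. finite C \<and>
    (\<forall>r\<in>G. \<forall>c\<in>C. M r c \<in> cox_part (\<gamma>' c - \<gamma> r) \<and> lk (M r c) 0 = 0) \<and>
    (\<forall>d. mat_map G C M ` fpart C \<gamma>' d = Z d) \<and>
    syzygies Bx C \<gamma>' (\<lambda>d. {w \<in> fpart C \<gamma>' d. mat_map G C M w \<in> {0}})"
proof -
  define R where "R d E \<longleftrightarrow> finite E \<and> E \<subseteq> Z d \<and> (\<forall>z\<in>Z d. \<exists>c. z - (\<Sum>e\<in>E. fscale (c e) e) \<in> mZ d) \<and>
    (\<forall>c. (\<Sum>e\<in>E. fscale (c e) e) \<in> mZ d \<longrightarrow> (\<forall>e\<in>E. c e = 0))" for d E
  have "\<forall>d. \<exists>E. R d E" unfolding R_def by (intro allI min_gens)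
  then obtain E where RE: "R d (E d)" for d by metis
  have E: "finite (E d)" "E d \<subseteq> Z d"
    "z \<in> Z d \<Longrightarrow> \<exists>c. z - (\<Sum>e\<in>E d. fscale (c e) e) \<in> mZ d"
    "(\<Sum>e\<in>E d. fscale (c e) e) \<in> mZ d \<Longrightarrow> e \<in> E d \<Longrightarrow> c e = 0" for d z c e
    using RE[of d] unfolding R_def by blast+
  \<comment> \<open>Generators of a complex are natural numbers, so the chosen vectors, paired with
    their degrees, are numbered.\<close>
  define S where "S = Sigma Bx E"
  have "finite S" using fin_Bx E(1) by (simp add: S_def)
  then obtain h where h: "bij_betw h {0..<card S} S" using ex_bij_betw_nat_finite by blast
  define C where "C = {0..<card S}"
  define \<gamma>' where "\<gamma>' c = fst (h c)" for c
  define M where "M r c = snd (h c) r" for r c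
  have hC: "\<gamma>' c \<in> Bx" "snd (h c) \<in> E (\<gamma>' c)" if "c \<in> C" for c
  proof -
    have "h c \<in> Sigma Bx E" using bij_betwE[OF h] that unfolding C_def S_def by blast
    then show "\<gamma>' c \<in> Bx" "snd (h c) \<in> E (\<gamma>' c)" by (auto simp: \<gamma>'_def)
  qed
  have finC: "finite C" by (simp add: C_def)
  have col: "snd (h c) \<in> Z (\<gamma>' c)" if "c \<in> C" for c using hC[OF that] E(2) by blast
  have M: "M r c \<in> cox_part (\<gamma>' c - \<gamma> r)" "lk (M r c) 0 = 0" if "c \<in> C" for r c
    using fpart_cox_part[OF subsetD[OF Z_sub col[OF that]], of r] Z_const[OF col[OF that]]
    by (auto simp: M_def)
  let ?D = "mat_map G C M"
  have D_eq: "?D w = (\<Sum>c\<in>C. (\<lambda>r. w c * snd (h c) r))" for w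
  proof
    fix r
    have "snd (h c) r = 0" if "r \<notin> G" "c \<in> C" for c
      using fpart_fcar[OF subsetD[OF Z_sub col[OF that(2)]]] that(1) by (auto simp: fcar_def)
    then show "?D w r = (\<Sum>c\<in>C. (\<lambda>r. w c * snd (h c) r)) r"
      by (auto simp: mat_map_def sum_apply M_def mult.commute)
  qed
  have D_Z: "?D w \<in> Z d" if w: "w \<in> fpart C \<gamma>' d" for w d
  proof -
    have "(\<lambda>r. w c * snd (h c) r) \<in> Z d" if "c \<in> C" for c
      using Z_mult[OF fpart_cox_part[OF w, of c] col[OF that]] by simp
    then show ?thesis unfolding D_eq by (rule Z.gr_sum)
  qed
  interpret D: graded_hom fmul fmul vdeg "fpart C \<gamma>'" Z ?D "{0}"
    by unfold_locales (auto simp: mat_map_diff mat_map_fmul D_Z)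
  have reindex: "(\<Sum>c\<in>{c \<in> C. \<gamma>' c = d}. f (snd (h c))) = (\<Sum>e\<in>E d. f e)"
    if "d \<in> Bx" for d and f :: "(nat \<Rightarrow> 'k cox) \<Rightarrow> nat \<Rightarrow> 'k cox"
  proof -
    have "bij_betw (\<lambda>c. snd (h c)) {c \<in> C. \<gamma>' c = d} (E d)"
    proof (rule bij_betwI[where g = "\<lambda>e. the_inv_into C h (d, e)"])
      have hinj: "inj_on h C" "h ` C = S" using h by (auto simp: bij_betw_def C_def)
      show "(\<lambda>c. snd (h c)) \<in> {c \<in> C. \<gamma>' c = d} \<rightarrow> E d" using hC by auto
      show "(\<lambda>e. the_inv_into C h (d, e)) \<in> E d \<rightarrow> {c \<in> C. \<gamma>' c = d}"
      proof
        fix e assume "e \<in> E d"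
        then have "(d, e) \<in> h ` C" using that hinj by (auto simp: S_def)
        then show "the_inv_into C h (d, e) \<in> {c \<in> C. \<gamma>' c = d}"
          using f_the_inv_into_f[OF hinj(1)] the_inv_into_into[OF hinj(1) _ order_refl] by (auto simp: \<gamma>'_def)
      qed
      show "the_inv_into C h (d, snd (h c)) = c" if "c \<in> {c \<in> C. \<gamma>' c = d}" for c
        using that the_inv_into_f_f[OF hinj(1), of c] by (auto simp: \<gamma>'_def)
      show "snd (h (the_inv_into C h (d, e))) = e" if "e \<in> E d" for e
      proof -
        have "(d, e) \<in> h ` C" using that \<open>d \<in> Bx\<close> hinj by (auto simp: S_def)
        from f_the_inv_into_f[OF hinj(1) this] show ?thesis by simp
      qed
    qed
    then show ?thesis by (rule sum.reindex_bij_betw)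
  qed
  have const_part: "?D (\<lambda>c. if c \<in> C \<and> \<gamma>' c = d then cox_const (b (snd (h c))) else 0) =
      (\<Sum>e\<in>E d. fscale (b e) e)" if "d \<in> Bx" for d b
  proof -
    have "?D (\<lambda>c. if c \<in> C \<and> \<gamma>' c = d then cox_const (b (snd (h c))) else 0) =
        (\<Sum>c\<in>{c \<in> C. \<gamma>' c = d}. fscale (b (snd (h c))) (snd (h c)))"
      unfolding D_eq using finC
      by (auto simp: sum.inter_filter fscale_def fun_eq_iff sum_apply intro!: sum.cong)
    then show ?thesis using reindex[OF that, of "\<lambda>e. fscale (b e) e"] by simp
  qed
  have onto: "\<exists>w\<in>fpart C \<gamma>' d. ?D w = z" if "z \<in> Z d" for z d
    using that
  \<comment> \<open>The \<open>+ 1\<close> lets the measure still drop from total degree 0 to total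
    degree -1, where everything is zero.\<close>
  proof (induction "nat (fst d + snd d + 1)" arbitrary: d z rule: less_induct)
    case less
    show ?case
    proof (cases "0 \<le> d")
      case False
      then have "z = 0" using fpart_not_ge_0 less.prems Z_sub by blast
      then show ?thesis by (intro bexI[of _ 0]) (auto simp: fm.gr_zero)
    next
      case True
      \<comment> \<open>Elements of \<open>mZ\<close> only use members of \<open>Z\<close> of
        smaller total degree. Outside \<open>Bx\<close> this is all of \<open>Z d\<close>; inside,
        the chosen vectors supply the rest.\<close>
      have lift: "\<exists>w\<in>fpart C \<gamma>' d. ?D w = y" if ymZ: "y \<in> mZ d" for y
      proof -
        obtain u where u: "u \<in> kel vdeg UNIV Z (Suc 0) d" "y = kd fmul UNIV u {}"
          using ymZ unfolding mZ_def by blast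
        have "\<exists>x\<in>fpart C \<gamma>' (d - sum vdeg A). y - ?D x \<in> {0}"
          if A1: "card A = Suc 0" "y \<in> Z (d - sum vdeg A)" for A y
        proof -
          obtain i where "A = {i}" using A1(1) by (metis One_nat_def card_1_singletonE)
          then have "fst (d - sum vdeg A) + snd (d - sum vdeg A) = fst d + snd d - 1"
            by (cases i) auto
          then show ?thesis
            using less.hyps[of "d - sum vdeg A" y] that True
            by (fastforce simp: less_eq_prod_def)
        qed
        then obtain u' where u': "u' \<in> kel vdeg UNIV (fpart C \<gamma>') (Suc 0) d"
            "\<And>A. kd fmul UNIV u A - ?D (kd fmul UNIV u' A) \<in> {0}"
          using D.lift_kd[OF _ u(1)] by blast
        then have "?D (kd fmul UNIV u' {}) = y" using u'(2)[of "{}"] u(2) by simp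
        moreover have "kd fmul UNIV u' {} \<in> fpart C \<gamma>' d"
          using kel_in[OF fm.kd_kel[OF u'(1)], of "{}"] by simp
        ultimately show ?thesis by blast
      qed
      show ?thesis
      proof (cases "d \<in> Bx")
        case False
        then have "z \<in> mZ d"
          using Z_kex[of d 0] less.prems by (auto simp: Z.kex_0_iff mZ_def)
        then show ?thesis by (rule lift)
      next
        case dB: True
        obtain b where "z - (\<Sum>e\<in>E d. fscale (b e) e) \<in> mZ d" using E(3)[OF less.prems] by blast
        then obtain w where w: "w \<in> fpart C \<gamma>' d" "?D w = z - (\<Sum>e\<in>E d. fscale (b e) e)" using lift by blast
        define w0 where "w0 = (\<lambda>c. if c \<in> C \<and> \<gamma>' c = d then cox_const (b (snd (h c))) else 0)"
        have w0: "w0 \<in> fpart C \<gamma>' d" by (auto simp: fpart_def fcar_def w0_def zero_prod_def[symmetric])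
        have "?D (w + w0) = z" using w(2) const_part[OF dB, of b] by (simp add: D.D_add w0_def)
        then show ?thesis using fm.gr_add[OF w(1) w0] by blast
      qed
    qed
  qed
  \<comment> \<open>Let \<open>w0\<close> be the constant part of a relation \<open>w\<close>. Then
    \<open>w0 - w\<close> is a combination of multiples of variables, so its image, which is that of
    \<open>w0\<close>, lies in \<open>mZ\<close>; independence of the chosen vectors modulo
    \<open>mZ\<close> forces \<open>w0\<close> to be zero.\<close>
  have min: "lk (w c) 0 = 0" if w: "w \<in> fpart C \<gamma>' d" "?D w = 0" for w d c
  proof (rule ccontr)
    assume nz: "lk (w c) 0 \<noteq> 0"
    then have c: "c \<in> C" using fpart_fcar[OF w(1)] by (auto simp: fcar_def)
    have "\<gamma>' c = d" using cox_partD[OF fpart_cox_part[OF w(1)] nz] by simp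
    then have dB: "d \<in> Bx" using hC(1)[OF c] by simp
    define b where "b e = lk (w (the_inv_into C h (d, e))) 0" for e
    have hinj: "inj_on h C" using h by (auto simp: bij_betw_def C_def)
    have b_eq: "b (snd (h c)) = lk (w c) 0" if "c \<in> C" "\<gamma>' c = d" for c
      using that the_inv_into_f_f[OF hinj, of c] by (auto simp: b_def \<gamma>'_def)
    define w0 where "w0 = (\<lambda>c. if c \<in> C \<and> \<gamma>' c = d then cox_const (b (snd (h c))) else 0)"
    have w0: "w0 \<in> fpart C \<gamma>' d" by (auto simp: fpart_def fcar_def w0_def zero_prod_def[symmetric])
    have "lk ((w0 - w) c) 0 = 0" for c
    proof (cases "c \<in> C \<and> \<gamma>' c = d")
      case False
      then show ?thesis
        using cox_partD[OF fpart_cox_part[OF w(1), of c], of 0] fpart_fcar[OF w(1)]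
        by (auto simp: w0_def lookup_minus fcar_def)
    qed (simp add: w0_def b_eq lookup_minus)
    then obtain u where u: "u \<in> kel vdeg UNIV (fpart C \<gamma>') (Suc 0) d" "kd fmul UNIV u {} = w0 - w"
      using fpart_in_max[OF fm.gr_diff[OF w0 w(1)]] by blast
    have "?D (w0 - w) = kd fmul UNIV (\<lambda>A. ?D (u A)) {}" by (simp add: D.D_kd[symmetric] u(2))
    then have "?D w0 \<in> mZ d" using D.D_kel[OF u(1)] w(2) by (auto simp: mZ_def D.D_diff)
    then have "b (snd (h c)) = 0"
      using E(4)[of b d "snd (h c)"] const_part[OF dB, of b] hC(2)[OF c] \<open>\<gamma>' c = d\<close> by (simp add: w0_def)
    then show False using nz b_eq[OF c \<open>\<gamma>' c = d\<close>] by simp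
  qed
  have "syzygies Bx C \<gamma>' (\<lambda>d. {w \<in> fpart C \<gamma>' d. ?D w \<in> {0}})"
  proof
    fix d e v w f g
    show "finite Bx" "finite C" using fin_Bx finC by auto
    show "0 \<le> d" if "d \<in> Bx" using Bx_ge_0[OF that] .
    show "0 \<le> \<gamma>' g" if "g \<in> C" using Bx_ge_0 hC(1)[OF that] by blast
    show "{w \<in> fpart C \<gamma>' d. ?D w \<in> {0}} \<subseteq> fpart C \<gamma>' d" by blast
    show "0 \<in> {w \<in> fpart C \<gamma>' d. ?D w \<in> {0}}" by (auto simp: fm.gr_zero)
    show "v - w \<in> {w \<in> fpart C \<gamma>' d. ?D w \<in> {0}}"
      if "v \<in> {w \<in> fpart C \<gamma>' d. ?D w \<in> {0}}" "w \<in> {w \<in> fpart C \<gamma>' d. ?D w \<in> {0}}"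
      using that by (auto simp: fm.gr_diff D.D_diff)
    show "(\<lambda>g. f * v g) \<in> {w \<in> fpart C \<gamma>' (d + e). ?D w \<in> {0}}"
      if f: "f \<in> cox_part e" and v: "v \<in> {w \<in> fpart C \<gamma>' d. ?D w \<in> {0}}"
    proof -
      have "f * v g \<in> cox_part (d + e - \<gamma>' g)" for g
        using cox_part_mult[OF f fpart_cox_part[of v C \<gamma>' d g]] v by (simp add: algebra_simps)
      then show ?thesis using v by (auto simp: fpart_def fcar_def mat_map_smult)
    qed
    show "lk (v g) 0 = 0" if "v \<in> {w \<in> fpart C \<gamma>' d. ?D w \<in> {0}}"
      using min that by blast
  next
    fix d a assume d: "d \<notin> Bx"
    show "kex fmul vdeg UNIV (\<lambda>d. {w \<in> fpart C \<gamma>' d. ?D w \<in> {0}}) {0} a d"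
    proof (rule D.kex_kernel[OF _ _ Z_kex[OF d]])
      fix A u assume "u \<in> Z (d - sum vdeg A)"
      then show "\<exists>x\<in>fpart C \<gamma>' (d - sum vdeg A). u - ?D x \<in> {0}" using onto by fastforce
    next
      fix z assume z: "z \<in> kel vdeg UNIV (fpart C \<gamma>') a d" "\<And>A. kd fmul UNIV z A = 0" "\<And>A. ?D (z A) \<in> {0}"
      show "\<exists>w\<in>kel vdeg UNIV (fpart C \<gamma>') (Suc a) d. \<forall>A. kd fmul UNIV w A = z A"
      proof (rule fpart_cycle_boundary[OF z(1,2)])
        fix c m assume "a = 0" "lk (z {} c) m \<noteq> 0"
        then have "m \<noteq> 0" using min[of "z {}" d c] kel_in[OF z(1), of "{}"] z(3)[of "{}"] by auto
        then show "\<exists>i\<in>UNIV. lk m i \<noteq> 0" by (rule exists_var)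
      qed
    qed
  qed
  moreover have "?D ` fpart C \<gamma>' d = Z d" for d using onto D_Z by blast
  ultimately show ?thesis using finC M by (intro exI[of _ C] exI[of _ \<gamma>'] exI[of _ M]) blast
qed

end

lemma eps_map_one: "eps_map {0} (\<lambda>_. 1) v = v 0"
  by (simp add: eps_map_def)

text \<open>The construction is iterated without any claim that it stops. The hypothesis
  \<open>proper\<close> is minimality at the start: elements of the first syzygy module have no
  constant term.\<close>

lemma (in graded_ideal) exists_min_resolution:
  assumes proper: "\<And>f d. f \<in> I \<Longrightarrow> f \<in> cox_part d \<Longrightarrow> lk f 0 = 0"
    and Bx: "finite Bx" "\<And>d. d \<in> Bx \<Longrightarrow> 0 \<le> d"
    and kex: "\<And>d a. d \<notin> Bx \<Longrightarrow> kex gmul vdeg UNIV cox_part I a d"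
  shows "\<exists>F. min_resolution I F (\<lambda>_. 1) \<and> gens F 0 = {0} \<and> gdeg F 0 = (\<lambda>_. 0)"
proof -
  define Z0 where "Z0 = (\<lambda>d. {v \<in> fpart {0} (\<lambda>_. 0) d. eps_map {0} (\<lambda>_. 1) v \<in> I})"
  interpret e: graded_hom fmul gmul vdeg "fpart {0} (\<lambda>_. 0)" cox_part "eps_map {0} (\<lambda>_. 1)" I
    by unfold_locales (auto simp: eps_map_one fmul_def id_zero id_diff id_mult fpart_def)
  have syz0: "syzygies Bx {0} (\<lambda>_. 0) Z0"
  proof
    fix d e f and v w :: "nat \<Rightarrow> 'k cox" and g :: nat
    show "finite Bx" "finite {0::nat}" "d \<in> Bx \<Longrightarrow> 0 \<le> d" "0 \<le> (0 :: int \<times> int)" using Bx by auto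
    show "Z0 d \<subseteq> fpart {0} (\<lambda>_. 0) d" by (auto simp: Z0_def)
    show "0 \<in> Z0 d" by (auto simp: Z0_def fm.gr_zero id_zero)
    show "v - w \<in> Z0 d" if "v \<in> Z0 d" "w \<in> Z0 d"
      using that by (auto simp: Z0_def fm.gr_diff eps_map_one id_diff)
    show "(\<lambda>g. f * v g) \<in> Z0 (d + e)" if f: "f \<in> cox_part e" and v: "v \<in> Z0 d"
    proof -
      have "f * v g \<in> cox_part (d + e)" for g
        using cox_part_mult[OF f fpart_cox_part[of v "{0}" "\<lambda>_. 0" d g]] v by (simp add: algebra_simps Z0_def)
      then show ?thesis using v by (auto simp: Z0_def fpart_def fcar_def eps_map_one id_mult)
    qed
    show "lk (v g) 0 = 0" if "v \<in> Z0 d"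
      using that proper[of "v 0" d] by (cases "g = 0") (auto simp: Z0_def eps_map_one fpart_def fcar_def)
  next
    fix d a assume d: "d \<notin> Bx"
    show "kex fmul vdeg UNIV Z0 {0} a d"
      unfolding Z0_def
    proof (rule e.kex_kernel[OF _ _ kex[OF d]])
      fix A and u :: "'k cox" assume "u \<in> cox_part (d - sum vdeg A)"
      then show "\<exists>x\<in>fpart {0} (\<lambda>_. 0) (d - sum vdeg A). u - eps_map {0} (\<lambda>_. 1) x \<in> I"
        by (intro bexI[of _ "\<lambda>g. if g = 0 then u else 0"]) (auto simp: eps_map_one id_zero fpart_def fcar_def)
    next
      fix z :: "cox_var set \<Rightarrow> nat \<Rightarrow> 'k cox"
      assume z: "z \<in> kel vdeg UNIV (fpart {0} (\<lambda>_. 0)) a d" "\<And>A. kd fmul UNIV z A = 0"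
        "\<And>A. eps_map {0} (\<lambda>_. 1) (z A) \<in> I"
      show "\<exists>w\<in>kel vdeg UNIV (fpart {0} (\<lambda>_. 0)) (Suc a) d. \<forall>A. kd fmul UNIV w A = z A"
      proof (rule fpart_cycle_boundary[OF z(1,2)])
        fix c m assume c: "a = 0" "c \<in> {0 :: nat}" and m: "lk (z {} c) m \<noteq> 0"
        then have "z {} \<in> fpart {0} (\<lambda>_. 0) d" using kel_in[OF z(1), of "{}"] by simp
        then have "lk (z {} c) 0 = 0"
          using z(3)[of "{}"] proper[of "z {} 0" d] c by (auto simp: eps_map_one fpart_def)
        then have "m \<noteq> 0" using m by auto
        then show "\<exists>i\<in>UNIV. lk m i \<noteq> 0" by (rule exists_var)
      qed
    qed
  qed
  \<comment> \<open>The state of a stage carries \<open>Z\<close> as well as the complex, because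
    the next stage has to cover \<open>Z\<close>. The matrix in it is the one mapping into the
    previous stage, so that of stage 0 is arbitrary.\<close>
  define P :: "nat \<Rightarrow> nat set \<times> (nat \<Rightarrow> int \<times> int) \<times> (nat \<Rightarrow> nat \<Rightarrow> 'k cox) \<times> (int \<times> int \<Rightarrow> (nat \<Rightarrow> 'k cox) set) \<Rightarrow> bool"
    where "P k = (\<lambda>(G, \<gamma>, M, Z). syzygies Bx G \<gamma> Z \<and> (k = 0 \<longrightarrow> G = {0} \<and> \<gamma> = (\<lambda>_. 0) \<and> Z = Z0))" for k
  define Q :: "nat \<Rightarrow> nat set \<times> (nat \<Rightarrow> int \<times> int) \<times> (nat \<Rightarrow> nat \<Rightarrow> 'k cox) \<times> (int \<times> int \<Rightarrow> (nat \<Rightarrow> 'k cox) set) \<Rightarrow> _ \<Rightarrow> bool"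
    where "Q k = (\<lambda>(G, \<gamma>, M, Z) (C, \<gamma>', M', Z'). finite C \<and>
    (\<forall>r\<in>G. \<forall>c\<in>C. M' r c \<in> cox_part (\<gamma>' c - \<gamma> r) \<and> lk (M' r c) 0 = 0) \<and>
    (\<forall>d. mat_map G C M' ` fpart C \<gamma>' d = Z d) \<and>
    Z' = (\<lambda>d. {w \<in> fpart C \<gamma>' d. mat_map G C M' w \<in> {0}}))" for k
  have "\<exists>f. \<forall>n. P n (f n) \<and> Q n (f n) (f (Suc n))"
  proof (rule dependent_nat_choice)
    show "\<exists>x. P 0 x" by (rule exI[of _ "({0}, \<lambda>_. 0, undefined, Z0)"]) (simp add: P_def syz0 del: fun_zero)
    show "\<exists>y. P (Suc n) y \<and> Q n x y" if Px: "P n x" for x n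
    proof -
      obtain G \<gamma> M Z where x: "x = (G, \<gamma>, M, Z)" by (cases x)
      interpret syzygies Bx G \<gamma> Z using Px by (simp add: P_def x)
      obtain C \<gamma>' M' where "finite C"
        "\<forall>r\<in>G. \<forall>c\<in>C. M' r c \<in> cox_part (\<gamma>' c - \<gamma> r) \<and> lk (M' r c) 0 = 0"
        "\<forall>d. mat_map G C M' ` fpart C \<gamma>' d = Z d"
        "syzygies Bx C \<gamma>' (\<lambda>d. {w \<in> fpart C \<gamma>' d. mat_map G C M' w \<in> {0}})"
        using next_step by blast
      then show ?thesis
        by (intro exI[of _ "(C, \<gamma>', M', \<lambda>d. {w \<in> fpart C \<gamma>' d. mat_map G C M' w \<in> {0}})"])
          (simp add: P_def Q_def x)
    qed
  qed
  then obtain f where f: "\<And>n. P n (f n)" "\<And>n. Q n (f n) (f (Suc n))" by blast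
  define F :: "'k free_complex" where "F = \<lparr>gens = (\<lambda>k. fst (f k)), gdeg = (\<lambda>k. fst (snd (f k))),
    diff = (\<lambda>k. fst (snd (snd (f k))))\<rparr>"
  define Zk where "Zk k = snd (snd (snd (f k)))" for k
  have fk: "f k = (gens F k, gdeg F k, diff F k, Zk k)" for k by (simp add: F_def Zk_def)
  have F0: "gens F 0 = {0}" "gdeg F 0 = (\<lambda>_. 0)" "Zk 0 = Z0"
    using f(1)[of 0] by (auto simp: P_def fk)
  have F_fin: "finite (gens F k)" for k
    using f(2)[of "k - 1"] F0 by (cases k) (auto simp: Q_def fk)
  have F_diff: "diff F (Suc k) r c \<in> cox_part (gdeg F (Suc k) c - gdeg F k r)" "lk (diff F (Suc k) r c) 0 = 0"
    if "r \<in> gens F k" "c \<in> gens F (Suc k)" for k r c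
    using f(2)[of k] that by (auto simp: Q_def fk)
  have F_im: "boundary F (Suc k) ` fpart (gens F (Suc k)) (gdeg F (Suc k)) d = Zk k d" for k d
    using f(2)[of k] unfolding Q_def fk boundary_Suc by (simp del: split_paired_All)
  have F_ker: "Zk k d = (if k = 0 then {v \<in> fpart (gens F 0) (gdeg F 0) d. eps_map (gens F 0) (\<lambda>_. 1) v \<in> I}
    else {v \<in> fpart (gens F k) (gdeg F k) d. boundary F k v = 0})" for k d
    using f(2)[of "k - 1"] F0 by (cases k) (auto simp: Q_def fk boundary_Suc Z0_def)
  \<comment> \<open>Images and kernels are known degree by degree, while complexes speak of
    arbitrary vectors; splitting into finitely many components bridges this.\<close>
  have hom_sum: "\<exists>D. finite D \<and> v = (\<Sum>d\<in>D. hcv (gens F k) (gdeg F k) d v)" if "v \<in> fcar (gens F k)" for v k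
    using sum_hcv[OF F_fin that] .
  have b_add: "boundary F (Suc k) (\<Sum>d\<in>D. u d) = (\<Sum>d\<in>D. boundary F (Suc k) (u d))"
    for D :: "(int \<times> int) set" and u k
    by (induction D rule: infinite_finite_induct)
      (simp_all only: boundary_Suc mat_map_add sum.insert sum.infinite sum.empty mat_map_0 simp_thms)
  have e_add: "eps_map (gens F 0) (\<lambda>_. 1) (\<Sum>d\<in>D. u d) = (\<Sum>d\<in>D. eps_map (gens F 0) (\<lambda>_. 1) (u d))"
    for D :: "(int \<times> int) set" and u
    by (induction D rule: infinite_finite_induct) (auto simp: F0 eps_map_one)
  have b_hcv: "boundary F (Suc k) (hcv (gens F (Suc k)) (gdeg F (Suc k)) d x) =
    hcv (gens F k) (gdeg F k) d (boundary F (Suc k) x)" for k d x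
    unfolding boundary_Suc by (rule mat_map_hcv[OF F_diff(1)])
  have I_sum: "sum g D \<in> I" if "\<And>d. d \<in> D \<Longrightarrow> g d \<in> I" for g and D :: "(int \<times> int) set"
    using that by (induction D rule: infinite_finite_induct) (auto simp: id_zero e.I_add)
  have img: "boundary F (Suc k) (hcv (gens F (Suc k)) (gdeg F (Suc k)) d v) \<in> Zk k d" for k d v
    using F_im[of k d] hcv_fpart by blast
  have "min_resolution I F (\<lambda>_. 1)"
  proof
    show "graded_free_complex F"
      unfolding graded_free_complex_def
    proof (intro conjI allI ballI)
      fix k v assume "v \<in> carrier (free_mod F (Suc k))"
      then obtain D where D: "v = (\<Sum>d\<in>D. hcv (gens F (Suc k)) (gdeg F (Suc k)) d v)" using hom_sum[of v "Suc k"] by auto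
      show "boundary F k (boundary F (Suc k) v) = (\<lambda>r. 0)"
      proof (cases k)
        case (Suc j)
        have "boundary F k (boundary F (Suc k) (hcv (gens F (Suc k)) (gdeg F (Suc k)) d v)) = 0" for d
          using img[of k d v] F_ker[of k d] Suc by auto
        then show ?thesis by (subst D) (simp add: b_add, simp add: Suc b_add)
      qed simp
    qed (use F_fin F_diff in auto)
    show "(1 :: 'k cox) \<in> cox_part (gdeg F 0 g)" for g by (simp add: F0)
    show "\<exists>v\<in>fcar (gens F 0). s - eps_map (gens F 0) (\<lambda>_. 1) v \<in> I" for s
      by (rule bexI[of _ "\<lambda>g. if g = 0 then s else 0"]) (auto simp: F0 eps_map_one id_zero fcar_def)
    show "eps_map (gens F 0) (\<lambda>_. 1) (boundary F (Suc 0) v) \<in> I" if v: "v \<in> fcar (gens F (Suc 0))" for v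
    proof -
      obtain D where D: "v = (\<Sum>d\<in>D. hcv (gens F (Suc 0)) (gdeg F (Suc 0)) d v)" using hom_sum[OF v] by auto
      have "eps_map (gens F 0) (\<lambda>_. 1) (boundary F (Suc 0) (hcv (gens F (Suc 0)) (gdeg F (Suc 0)) d v)) \<in> I" for d
        using img[of 0 d v] F_ker[of 0 d] by auto
      then show ?thesis by (subst D) (auto simp: b_add e_add intro: I_sum)
    qed
    show "\<exists>w\<in>fcar (gens F (Suc k)). boundary F (Suc k) w = v"
      if v: "v \<in> fcar (gens F k)" and cyc: "if k = 0 then eps_map (gens F 0) (\<lambda>_. 1) v \<in> I else boundary F k v = 0" for v k
    proof -
      obtain D where D: "v = (\<Sum>d\<in>D. hcv (gens F k) (gdeg F k) d v)" using hom_sum[OF v] by auto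
      have "hcv (gens F k) (gdeg F k) d v \<in> Zk k d" for d
      proof (cases k)
        case 0
        have "hc d (v 0) \<in> I" using cyc 0 id_hc by (simp add: F0 eps_map_one)
        then show ?thesis unfolding F_ker 0 using hcv_fpart[of "gens F 0" "gdeg F 0" d v] by (simp add: F0 eps_map_one hcv_def)
      next
        case (Suc j)
        then show ?thesis unfolding F_ker using cyc hcv_fpart b_hcv[of j d v] by (simp add: hcv_def fun_eq_iff)
      qed
      then have "\<forall>d. \<exists>w. w \<in> fpart (gens F (Suc k)) (gdeg F (Suc k)) d \<and> boundary F (Suc k) w = hcv (gens F k) (gdeg F k) d v"
        using F_im[of k] by (metis (no_types, lifting) image_iff)
      then obtain w where w: "\<And>d. w d \<in> fpart (gens F (Suc k)) (gdeg F (Suc k)) d"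
        "\<And>d. boundary F (Suc k) (w d) = hcv (gens F k) (gdeg F k) d v" by metis
      have "boundary F (Suc k) (\<Sum>d\<in>D. w d) = (\<Sum>d\<in>D. hcv (gens F k) (gdeg F k) d v)" by (simp add: b_add w(2))
      also have "\<dots> = v" by (rule D[symmetric])
      finally have "boundary F (Suc k) (\<Sum>d\<in>D. w d) = v" .
      moreover have "(\<Sum>d\<in>D. w d) \<in> fcar (gens F (Suc k))"
        using fpart_fcar[OF w(1)] by (auto simp: fcar_def sum_apply intro!: sum.neutral)
      ultimately show ?thesis by blast
    qed
  qed (use F_diff in auto)
  then show ?thesis using F0 by blast
qed

section \<open>Quotients of graded modules\<close>

locale gmodule = abelian_group M
  for M :: "('k::field cox, 'b) graded_module" (structure) +
  assumes smult_closed [simp]: "u \<in> carrier M \<Longrightarrow> f \<odot> u \<in> carrier M"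
    and smult_add: "u \<in> carrier M \<Longrightarrow> v \<in> carrier M \<Longrightarrow> f \<odot> (u \<oplus> v) = f \<odot> u \<oplus> f \<odot> v"
    and part_sub: "part M d \<subseteq> carrier M"

locale gsubmodule = gmodule M
  for M :: "('k::field cox, 'b) graded_module" (structure) and N +
  assumes N_sub: "N \<subseteq> carrier M" and N_zero: "\<zero> \<in> N"
    and N_add: "u \<in> N \<Longrightarrow> v \<in> N \<Longrightarrow> u \<oplus> v \<in> N"
    and N_neg: "u \<in> N \<Longrightarrow> \<ominus> u \<in> N"
    and N_smult: "u \<in> N \<Longrightarrow> f \<odot> u \<in> N"
begin

sublocale abelian_subgroup N M
proof (rule abelian_subgroupI3)
  show "additive_subgroup N M"
  proof (rule additive_subgroupI, rule group.subgroupI)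
    show "group (add_monoid M)" by (rule a_group)
    show "N \<noteq> {}" using N_zero by blast
    show "inv\<^bsub>add_monoid M\<^esub> a \<in> N" if "a \<in> N" for a using N_neg[OF that] by (simp add: a_inv_def)
  qed (use N_sub N_add in auto)
qed unfold_locales

lemma coset_eq_iff:
  assumes "u \<in> carrier M" "v \<in> carrier M"
  shows "N +> u = N +> v \<longleftrightarrow> u \<ominus> v \<in> N"
proof
  assume "N +> u = N +> v"
  then have "u \<in> N +> v" using a_rcos_self[OF assms(1)] by simp
  then show "u \<ominus> v \<in> N" using a_rcos_module[OF assms(2,1)] by (simp add: minus_eq)
next
  assume "u \<ominus> v \<in> N"
  then have "u \<in> N +> v" using a_rcos_module[OF assms(2,1)] by (simp add: minus_eq)
  then show "N +> u = N +> v" using a_repr_independence'[OF _ assms(2)] by simp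
qed

abbreviation "Q \<equiv> quot_mod M N"

lemma quot_carrier: "carrier Q = (\<lambda>u. N +> u) ` carrier M"
  by (auto simp: quot_mod_def A_RCOSETS_def RCOSETS_def a_r_coset_def)

lemma quot_part: "part Q d = (\<lambda>u. N +> u) ` part M d"
  by (simp add: quot_mod_def)

lemma quot_zero: "\<zero>\<^bsub>Q\<^esub> = N +> \<zero>"
  using a_coset_add_zero[OF N_sub] by (simp add: quot_mod_def)

lemma quot_add: "u \<in> carrier M \<Longrightarrow> v \<in> carrier M \<Longrightarrow> (N +> u) \<oplus>\<^bsub>Q\<^esub> (N +> v) = N +> (u \<oplus> v)"
  by (simp add: quot_mod_def a_rcos_sum)

lemma smult_zero: "f \<odot> \<zero> = \<zero>"
proof -
  define x where "x = f \<odot> \<zero>"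
  have x: "x \<in> carrier M" "x \<oplus> x = x" using smult_add[of \<zero> \<zero> f] by (simp_all add: x_def)
  have "x = x \<oplus> (x \<oplus> \<ominus> x)" using x(1) by (simp add: r_neg)
  also have "\<dots> = (x \<oplus> x) \<oplus> \<ominus> x" using x(1) by (simp add: a_assoc)
  also have "\<dots> = \<zero>" using x by (simp add: r_neg)
  finally show ?thesis by (simp add: x_def)
qed

lemma smult_minus: "u \<in> carrier M \<Longrightarrow> v \<in> carrier M \<Longrightarrow> f \<odot> (u \<ominus> v) = f \<odot> u \<ominus> f \<odot> v"
proof -
  assume uv: "u \<in> carrier M" "v \<in> carrier M"
  have "f \<odot> (\<ominus> v) \<oplus> f \<odot> v = \<zero>"
    using smult_add[of "\<ominus> v" v f] uv by (simp add: l_neg smult_zero)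
  then have "f \<odot> (\<ominus> v) = \<ominus> (f \<odot> v)"
    using uv minus_equality[of "f \<odot> (\<ominus> v)" "f \<odot> v"] by simp
  then show ?thesis using uv smult_add[of u "\<ominus> v" f] by (simp add: minus_eq)
qed

lemma coset_elem: "w \<in> N +> u \<Longrightarrow> u \<in> carrier M \<Longrightarrow> w \<in> carrier M \<and> N +> w = N +> u"
  using a_repr_independence' a_elemrcos_carrier by metis

text \<open>The union over representatives in \<open>quot_mod\<close> is a union of equal cosets, as
  \<open>N\<close> is closed under scalars.\<close>

lemma quot_smult: assumes "u \<in> carrier M" shows "f \<odot>\<^bsub>Q\<^esub> (N +> u) = N +> (f \<odot> u)"
proof -
  have "N +> (f \<odot> w) = N +> (f \<odot> u)" if "w \<in> N +> u" for w
  proof -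
    have w: "w \<in> carrier M" "N +> w = N +> u" using coset_elem[OF that assms] by auto
    then have "w \<ominus> u \<in> N" using coset_eq_iff assms by blast
    then have "f \<odot> w \<ominus> f \<odot> u \<in> N" using N_smult[of "w \<ominus> u" f] smult_minus[OF w(1) assms] by simp
    then show ?thesis using coset_eq_iff w assms by simp
  qed
  then have "(\<Union>w\<in>N +> u. N +> (f \<odot> w)) = N +> (f \<odot> u)"
    using a_rcos_self[OF assms] by blast
  then show ?thesis by (simp add: quot_mod_def)
qed

lemma gmodule_quot: "gmodule Q"
proof -
  have "abelian_group Q"
  proof (rule abelian_groupI)
    fix C assume "C \<in> carrier Q"
    then obtain u where u: "u \<in> carrier M" "C = N +> u" by (auto simp: quot_carrier)
    have "(N +> \<ominus> u) \<oplus>\<^bsub>Q\<^esub> C = \<zero>\<^bsub>Q\<^esub>" using u by (simp add: quot_add l_neg quot_zero)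
    then show "\<exists>y\<in>carrier Q. y \<oplus>\<^bsub>Q\<^esub> C = \<zero>\<^bsub>Q\<^esub>" using u by (auto simp: quot_carrier)
  qed (auto simp: quot_carrier quot_add quot_zero a_ac)
  then interpret Q: abelian_group Q .
  show ?thesis
    by unfold_locales (use part_sub in \<open>auto simp: quot_carrier quot_smult quot_add smult_add quot_part\<close>)
qed

end

text \<open>The homomorphism theorem with a quotient on both sides. Surjectivity is required in
  every degree separately, since the parts of a module are only known to lie in its carrier.\<close>

lemma quot_iso:
  fixes M :: "('k::field cox, 'b) graded_module" and N :: "('k cox, 'c) graded_module"
  assumes A: "gsubmodule M A" and B: "gsubmodule N B"
    and car: "\<And>u. u \<in> carrier M \<Longrightarrow> f u \<in> carrier N"
    and add: "\<And>u v. u \<in> carrier M \<Longrightarrow> v \<in> carrier M \<Longrightarrow> f (u \<oplus>\<^bsub>M\<^esub> v) = f u \<oplus>\<^bsub>N\<^esub> f v"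
    and smult: "\<And>r u. u \<in> carrier M \<Longrightarrow> f (r \<odot>\<^bsub>M\<^esub> u) = r \<odot>\<^bsub>N\<^esub> f u"
    and part: "\<And>d u. u \<in> part M d \<Longrightarrow> f u \<in> part N d"
    and ker: "\<And>u. u \<in> carrier M \<Longrightarrow> f u \<in> B \<longleftrightarrow> u \<in> A"
    and onto: "\<And>w. w \<in> carrier N \<Longrightarrow> \<exists>u\<in>carrier M. B +>\<^bsub>N\<^esub> w = B +>\<^bsub>N\<^esub> f u"
    and onto_part: "\<And>d w. w \<in> part N d \<Longrightarrow> \<exists>u\<in>part M d. B +>\<^bsub>N\<^esub> w = B +>\<^bsub>N\<^esub> f u"
  shows "\<exists>h. (\<forall>u\<in>carrier M. h (A +>\<^bsub>M\<^esub> u) = B +>\<^bsub>N\<^esub> f u) \<and>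
    bij_betw h (carrier (quot_mod M A)) (carrier (quot_mod N B)) \<and>
     (\<forall>u\<in>carrier (quot_mod M A). \<forall>v\<in>carrier (quot_mod M A).
        h (u \<oplus>\<^bsub>quot_mod M A\<^esub> v) = h u \<oplus>\<^bsub>quot_mod N B\<^esub> h v) \<and>
     (\<forall>r. \<forall>u\<in>carrier (quot_mod M A). h (r \<odot>\<^bsub>quot_mod M A\<^esub> u) = r \<odot>\<^bsub>quot_mod N B\<^esub> h u) \<and>
     (\<forall>d. h ` part (quot_mod M A) d = part (quot_mod N B) d)"
proof -
  interpret A: gsubmodule M A by (rule A)
  interpret B: gsubmodule N B by (rule B)
  have f_minus: "f (u \<ominus>\<^bsub>M\<^esub> v) = f u \<ominus>\<^bsub>N\<^esub> f v" if "u \<in> carrier M" "v \<in> carrier M" for u v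
  proof -
    have "f (u \<ominus>\<^bsub>M\<^esub> v) \<oplus>\<^bsub>N\<^esub> f v = f u"
      using add[of "u \<ominus>\<^bsub>M\<^esub> v" v] that by (simp add: A.minus_eq A.a_assoc A.l_neg)
    then show ?thesis
      using car that by (metis A.minus_closed B.add.inv_solve_right B.minus_eq)
  qed
  have eq: "B +>\<^bsub>N\<^esub> f u = B +>\<^bsub>N\<^esub> f v \<longleftrightarrow> A +>\<^bsub>M\<^esub> u = A +>\<^bsub>M\<^esub> v" if "u \<in> carrier M" "v \<in> carrier M" for u v
    using that by (simp add: A.coset_eq_iff B.coset_eq_iff car ker f_minus[symmetric])
  define h where "h C = (\<Union>u\<in>C. B +>\<^bsub>N\<^esub> f u)" for C
  have h: "h (A +>\<^bsub>M\<^esub> u) = B +>\<^bsub>N\<^esub> f u" if "u \<in> carrier M" for u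
  proof -
    have "B +>\<^bsub>N\<^esub> f w = B +>\<^bsub>N\<^esub> f u" if w: "w \<in> A +>\<^bsub>M\<^esub> u" for w
      using A.coset_elem[OF w \<open>u \<in> carrier M\<close>] eq \<open>u \<in> carrier M\<close> by blast
    then show ?thesis using A.a_rcos_self[OF that] unfolding h_def by blast
  qed
  have "inj_on h (carrier (quot_mod M A))"
    by (rule inj_onI) (auto simp: A.quot_carrier h eq)
  moreover have "h ` carrier (quot_mod M A) = carrier (quot_mod N B)"
  proof (rule subset_antisym)
    show "h ` carrier (quot_mod M A) \<subseteq> carrier (quot_mod N B)"
      by (auto simp: A.quot_carrier B.quot_carrier h car)
    show "carrier (quot_mod N B) \<subseteq> h ` carrier (quot_mod M A)"
      using onto unfolding A.quot_carrier B.quot_carrier by (force simp: image_iff h)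
  qed
  ultimately have "bij_betw h (carrier (quot_mod M A)) (carrier (quot_mod N B))"
    by (simp add: bij_betw_def)
  moreover have "h ` part (quot_mod M A) d = part (quot_mod N B) d" for d
  proof -
    have hp: "h (A +>\<^bsub>M\<^esub> u) = B +>\<^bsub>N\<^esub> f u" if "u \<in> part M d" for u
      using h A.part_sub that by blast
    show ?thesis
    proof (rule subset_antisym)
      show "h ` part (quot_mod M A) d \<subseteq> part (quot_mod N B) d"
        by (auto simp: A.quot_part B.quot_part hp part)
      show "part (quot_mod N B) d \<subseteq> h ` part (quot_mod M A) d"
      proof
        fix C assume "C \<in> part (quot_mod N B) d"
        then obtain w where "w \<in> part N d" "C = B +>\<^bsub>N\<^esub> w" by (auto simp: B.quot_part)
        then obtain u where "u \<in> part M d" "C = h (A +>\<^bsub>M\<^esub> u)" using onto_part hp by metis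
        then show "C \<in> h ` part (quot_mod M A) d" by (auto simp: A.quot_part)
      qed
    qed
  qed
  ultimately show ?thesis
    using h by (intro exI[of _ h])
      (auto simp: A.quot_carrier A.quot_add B.quot_add A.quot_smult B.quot_smult car add smult)
qed

lemma quot_graded_iso:
  assumes "\<exists>h. P h \<and> bij_betw h (carrier M) (carrier N) \<and>
     (\<forall>u\<in>carrier M. \<forall>v\<in>carrier M. h (u \<oplus>\<^bsub>M\<^esub> v) = h u \<oplus>\<^bsub>N\<^esub> h v) \<and>
     (\<forall>f. \<forall>u\<in>carrier M. h (f \<odot>\<^bsub>M\<^esub> u) = f \<odot>\<^bsub>N\<^esub> h u) \<and>
     (\<forall>d. h ` part M d = part N d)"
  shows "graded_iso M N"
  using assms unfolding graded_iso_def by blast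

text \<open>Carries the operations of a module record over to those of the underlying group type, so
  that later arguments can use ordinary subtraction.\<close>

lemma gmodule_plus:
  fixes M :: "('k::field cox, 'b::ab_group_add) graded_module"
  assumes "add M = (+)" "zero M = 0"
    and "0 \<in> carrier M" "\<And>u v. u \<in> carrier M \<Longrightarrow> v \<in> carrier M \<Longrightarrow> u - v \<in> carrier M"
    and "\<And>f u. u \<in> carrier M \<Longrightarrow> smult M f u \<in> carrier M"
    and "\<And>f u v. smult M f (u + v) = smult M f u + smult M f v"
    and "\<And>d. part M d \<subseteq> carrier M"
  shows "gmodule M" "\<And>u v. u \<in> carrier M \<Longrightarrow> v \<in> carrier M \<Longrightarrow> u \<ominus>\<^bsub>M\<^esub> v = u - v"
    "\<And>u. u \<in> carrier M \<Longrightarrow> \<ominus>\<^bsub>M\<^esub> u = - u"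
proof -
  have neg: "- u \<in> carrier M" if "u \<in> carrier M" for u using assms(4)[OF assms(3) that] by simp
  have plus: "u + v \<in> carrier M" if "u \<in> carrier M" "v \<in> carrier M" for u v
    using assms(4)[OF that(1) neg[OF that(2)]] by simp
  have "abelian_group M"
    by (rule abelian_groupI) (auto simp: assms(1,2,3) plus algebra_simps intro!: bexI[OF _ neg])
  then interpret abelian_group M .
  show "gmodule M" by unfold_locales (use assms(1,5-7) in auto)
  show 1: "\<ominus>\<^bsub>M\<^esub> u = - u" if "u \<in> carrier M" for u
    using minus_equality[of "- u" u] neg[OF that] that by (simp add: assms(1,2))
  show "u \<ominus>\<^bsub>M\<^esub> v = u - v" if "u \<in> carrier M" "v \<in> carrier M" for u v
    using 1[OF that(2)] by (simp add: minus_eq assms(1))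
qed

lemma gsubmodule_plus:
  fixes M :: "('k::field cox, 'b::ab_group_add) graded_module"
  assumes "add M = (+)" "zero M = 0"
    and "0 \<in> carrier M" "\<And>u v. u \<in> carrier M \<Longrightarrow> v \<in> carrier M \<Longrightarrow> u - v \<in> carrier M"
    and "\<And>f u. u \<in> carrier M \<Longrightarrow> smult M f u \<in> carrier M"
    and "\<And>f u v. smult M f (u + v) = smult M f u + smult M f v"
    and "\<And>d. part M d \<subseteq> carrier M"
    and N: "N \<subseteq> carrier M" "0 \<in> N" "\<And>u v. u \<in> N \<Longrightarrow> v \<in> N \<Longrightarrow> u - v \<in> N"
    "\<And>f u. u \<in> N \<Longrightarrow> smult M f u \<in> N"
  shows "gsubmodule M N" "\<And>u v. u \<in> carrier M \<Longrightarrow> v \<in> carrier M \<Longrightarrow> N +>\<^bsub>M\<^esub> u = N +>\<^bsub>M\<^esub> v \<longleftrightarrow> u - v \<in> N"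
proof -
  have M: "gmodule M" "u \<in> carrier M \<Longrightarrow> v \<in> carrier M \<Longrightarrow> u \<ominus>\<^bsub>M\<^esub> v = u - v"
    "u \<in> carrier M \<Longrightarrow> \<ominus>\<^bsub>M\<^esub> u = - u" for u v
    by (rule gmodule_plus; use assms(1-7) in blast)+
  interpret gmodule M by (rule M(1))
  have neg: "- u \<in> N" if "u \<in> N" for u using N(3)[OF N(2) that] by simp
  have plus: "u + v \<in> N" if "u \<in> N" "v \<in> N" for u v
    using N(3)[OF that(1) neg[OF that(2)]] by simp
  show "gsubmodule M N"
    by unfold_locales (use N(1,2,4) plus neg M(3) in \<open>auto simp: assms(1,2) subset_iff\<close>)
  then interpret gsubmodule M N .
  show "N +>\<^bsub>M\<^esub> u = N +>\<^bsub>M\<^esub> v \<longleftrightarrow> u - v \<in> N" if "u \<in> carrier M" "v \<in> carrier M" for u v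
    using coset_eq_iff[OF that] M(2)[OF that] by simp
qed

section \<open>The Cox ring, free modules and homology as graded modules\<close>

lemma cox_module_simps [simp]:
  "carrier cox_module = UNIV" "add cox_module = (+)" "zero cox_module = 0"
  "smult cox_module = (*)" "part cox_module = cox_part"
  by (simp_all add: cox_module_def)

lemma submod_simps [simp]:
  "carrier (submod M U) = U" "add (submod M U) = add M" "zero (submod M U) = zero M"
  "smult (submod M U) = smult M" "part (submod M U) d = part M d \<inter> U"
  by (simp_all add: submod_def)

lemma free_mod_add: "add (free_mod F k) = (+)"
  by (intro ext) simp

context graded_ideal
begin

lemma gsubmodule_ideal: "gsubmodule cox_module I"
  and ideal_coset_eq: "I +>\<^bsub>cox_module\<^esub> u = I +>\<^bsub>cox_module\<^esub> v \<longleftrightarrow> u - v \<in> I"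
  using gsubmodule_plus[of cox_module I] by (simp_all add: algebra_simps id_zero id_diff id_mult)

end

definition cycles :: "'k::field free_complex \<Rightarrow> nat \<Rightarrow> (nat \<Rightarrow> 'k cox) set" where
  "cycles F k = {v \<in> carrier (free_mod F k). boundary F k v = (\<lambda>r. 0)}"

definition boundaries :: "'k::field free_complex \<Rightarrow> nat \<Rightarrow> (nat \<Rightarrow> 'k cox) set" where
  "boundaries F k = boundary F (Suc k) ` carrier (free_mod F (Suc k))"

lemma homology_eq: "homology F k = quot_mod (submod (free_mod F k) (cycles F k)) (boundaries F k)"
  by (simp add: homology_def cycles_def boundaries_def)

lemma boundary_diff: "boundary F k (u - v) = boundary F k u - boundary F k v"
  by (cases k) (auto simp: boundary_Suc mat_map_diff)

lemma boundary_smult: "boundary F k (\<lambda>g. f * v g) = (\<lambda>g. f * boundary F k v g)"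
  by (cases k) (auto simp: boundary_Suc mat_map_smult)

lemma boundary_0: "boundary F k 0 = 0"
  by (cases k) (auto simp: boundary_Suc)

lemma boundaries_simps:
  shows "0 \<in> boundaries F k" "u \<in> boundaries F k \<Longrightarrow> v \<in> boundaries F k \<Longrightarrow> u - v \<in> boundaries F k"
    "u \<in> boundaries F k \<Longrightarrow> (\<lambda>g. f * u g) \<in> boundaries F k"
proof -
  show "0 \<in> boundaries F k"
    unfolding boundaries_def by (rule image_eqI[of _ _ 0]) (auto simp: boundary_0 fcar_def)
  show "u - v \<in> boundaries F k" if uv: "u \<in> boundaries F k" "v \<in> boundaries F k"
  proof -
    obtain a b where "a \<in> fcar (gens F (Suc k))" "u = boundary F (Suc k) a"
      "b \<in> fcar (gens F (Suc k))" "v = boundary F (Suc k) b"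
      using uv by (auto simp: boundaries_def)
    then show ?thesis unfolding boundaries_def
      by (intro image_eqI[of _ _ "a - b"]) (auto simp: boundary_diff fcar_def)
  qed
  show "(\<lambda>g. f * u g) \<in> boundaries F k" if u: "u \<in> boundaries F k"
  proof -
    obtain a where "a \<in> fcar (gens F (Suc k))" "u = boundary F (Suc k) a"
      using u by (auto simp: boundaries_def)
    then show ?thesis unfolding boundaries_def
      by (intro image_eqI[of _ _ "\<lambda>g. f * a g"]) (auto simp: boundary_smult fcar_def)
  qed
qed

lemma boundaries_sum: "(\<And>d. d \<in> D \<Longrightarrow> u d \<in> boundaries F k) \<Longrightarrow> sum u D \<in> boundaries F k"
proof (induction D rule: infinite_finite_induct)
  case (insert x D)
  have "u x - (0 - sum u D) \<in> boundaries F k"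
    using insert boundaries_simps by (metis insertCI)
  then show ?case by (simp only: sum.insert[OF insert.hyps] diff_0 diff_minus_eq_add)
qed (auto simp: boundaries_simps)

lemma
  assumes "graded_free_complex F"
  shows gsubmodule_boundaries: "gsubmodule (submod (free_mod F k) (cycles F k)) (boundaries F k)"
    and boundaries_coset_eq: "u \<in> cycles F k \<Longrightarrow> v \<in> cycles F k \<Longrightarrow>
      boundaries F k +>\<^bsub>submod (free_mod F k) (cycles F k)\<^esub> u =
      boundaries F k +>\<^bsub>submod (free_mod F k) (cycles F k)\<^esub> v \<longleftrightarrow> u - v \<in> boundaries F k"
proof -
  let ?M = "submod (free_mod F k) (cycles F k)"
  have 1: "boundaries F k \<subseteq> cycles F k"
  proof
    fix v assume "v \<in> boundaries F k"
    then obtain w where "w \<in> carrier (free_mod F (Suc k))" "v = boundary F (Suc k) w"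
      by (auto simp: boundaries_def)
    then show "v \<in> cycles F k"
      using assms unfolding graded_free_complex_def cycles_def by (auto simp: boundary_Suc)
  qed
  have 2: "0 \<in> cycles F k" "\<And>u v. u \<in> cycles F k \<Longrightarrow> v \<in> cycles F k \<Longrightarrow> u - v \<in> cycles F k"
    "\<And>f u. u \<in> cycles F k \<Longrightarrow> (\<lambda>g. f * u g) \<in> cycles F k"
    by (auto simp: cycles_def fcar_def boundary_diff boundary_0 boundary_smult)
  have "gsubmodule ?M (boundaries F k) \<and> (\<forall>u v. u \<in> carrier ?M \<longrightarrow> v \<in> carrier ?M \<longrightarrow>
      (boundaries F k +>\<^bsub>?M\<^esub> u = boundaries F k +>\<^bsub>?M\<^esub> v \<longleftrightarrow> u - v \<in> boundaries F k))"
    by (intro conjI allI impI gsubmodule_plus)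
      (use 1 2 boundaries_simps in \<open>auto simp: free_mod_add algebra_simps fun_eq_iff\<close>)
  then show "gsubmodule ?M (boundaries F k)"
    "u \<in> cycles F k \<Longrightarrow> v \<in> cycles F k \<Longrightarrow> boundaries F k +>\<^bsub>?M\<^esub> u = boundaries F k +>\<^bsub>?M\<^esub> v \<longleftrightarrow> u - v \<in> boundaries F k"
    by auto
qed

section \<open>The Hilbert function of a finite set of points\<close>

definition pscale :: "'k::field \<Rightarrow> ('p \<Rightarrow> 'k) \<Rightarrow> 'p \<Rightarrow> 'k" where
  "pscale c t = (\<lambda>P. c * t P)"

interpretation pv: vector_space "pscale :: 'k::field \<Rightarrow> ('p \<Rightarrow> 'k) \<Rightarrow> 'p \<Rightarrow> 'k"
  by unfold_locales (auto simp: pscale_def fun_eq_iff algebra_simps)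

context points
begin

abbreviation "Q \<equiv> coord_ring X"
abbreviation "cst u \<equiv> I +>\<^bsub>cox_module\<^esub> u"

interpretation CI: gsubmodule cox_module I by (rule gsubmodule_ideal)

lemma Q_simps:
  "carrier Q = range cst" "part Q d = cst ` cox_part d" "\<zero>\<^bsub>Q\<^esub> = cst 0"
  "cst u \<oplus>\<^bsub>Q\<^esub> cst v = cst (u + v)" "f \<odot>\<^bsub>Q\<^esub> cst u = cst (f * u)"
  using CI.quot_carrier CI.quot_part CI.quot_zero CI.quot_add CI.quot_smult by (simp_all add: coord_ring_def)

lemma gmodule_Q: "gmodule Q"
  using CI.gmodule_quot by (simp add: coord_ring_def)

definition val :: "'k cox set \<Rightarrow> 'k point \<Rightarrow> 'k" where
  "val C = evX (SOME u. u \<in> C)"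

lemma val_cst: "val (cst u) = evX u"
proof -
  have "(SOME w. w \<in> cst u) \<in> cst u"
    using CI.a_rcos_self[of u] by (intro someI[of "\<lambda>w. w \<in> cst u"]) simp
  then have "cst (SOME w. w \<in> cst u) = cst u" using CI.coset_elem[of _ u] by simp
  then have "evX ((SOME w. w \<in> cst u) - u) = 0" using ideal_coset_eq ideal_evX by blast
  then show ?thesis by (simp add: val_def evX_diff)
qed

lemma inj_on_val: "inj_on val (part Q d)"
proof (rule inj_onI)
  fix C C' assume "C \<in> part Q d" "C' \<in> part Q d" and eq: "val C = val C'"
  then obtain u v where uv: "u \<in> cox_part d" "v \<in> cox_part d" "C = cst u" "C' = cst v"
    by (auto simp: Q_simps)
  then have "u - v \<in> I"
    using eq by (intro evX_ideal[OF cox_part_diff]) (auto simp: val_cst evX_diff)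
  then show "C = C'" using uv ideal_coset_eq by simp
qed

text \<open>By \<open>inj_on_val\<close> this is a copy of the part of degree \<open>d\<close> of
  \<open>S / I\<close> inside the functions on \<open>X\<close>, where linear algebra is
  available.\<close>

definition W :: "int \<times> int \<Rightarrow> ('k point \<Rightarrow> 'k) set" where
  "W d = evX ` cox_part d"

lemma val_part: "val ` part Q d = W d"
  by (auto simp: Q_simps val_cst W_def image_image)

lemma evX_const_mult: "evX (cox_const c * u) = pscale c (evX u)"
  by (auto simp: evX_def pscale_def fun_eq_iff eval_mpoly_mult eval_mpoly_const)

lemma evX_add: "evX (u + v) = evX u + evX v"
  by (auto simp: evX_def fun_eq_iff eval_mpoly_add)

lemma subspace_W: "pv.subspace (W d)"
  unfolding pv.subspace_def
proof (intro conjI ballI allI)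
  show "0 \<in> W d" unfolding W_def by (rule image_eqI[of _ _ 0]) auto
  show "x + y \<in> W d" if "x \<in> W d" "y \<in> W d" for x y
    using that by (auto simp: W_def evX_add[symmetric] intro: cox_part_add)
  show "pscale c x \<in> W d" if "x \<in> W d" for c x
    using that by (auto simp: W_def evX_const_mult[symmetric] intro: cox_part_const_mult)
qed

lemma finsum_val:
  assumes "finite S" "S \<subseteq> part Q d"
  shows "finsum Q (\<lambda>e. cox_const (c e) \<odot>\<^bsub>Q\<^esub> e) S \<in> part Q d \<and>
    val (finsum Q (\<lambda>e. cox_const (c e) \<odot>\<^bsub>Q\<^esub> e) S) = (\<Sum>e\<in>S. pscale (c e) (val e))"
  using assms
proof (induction S rule: finite_induct)
  interpret gmodule Q by (rule gmodule_Q)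
  case empty
  have "cst 0 \<in> part Q d" by (auto simp: Q_simps)
  then show ?case by (simp add: Q_simps(3) val_cst)
next
  interpret gmodule Q by (rule gmodule_Q)
  case (insert e S)
  have S: "(\<lambda>e. cox_const (c e) \<odot>\<^bsub>Q\<^esub> e) \<in> S \<rightarrow> carrier Q"
    using insert.prems part_sub[of d] by (auto intro!: smult_closed)
  have e: "cox_const (c e) \<odot>\<^bsub>Q\<^esub> e \<in> carrier Q"
    using insert.prems part_sub[of d] by (auto intro!: smult_closed)
  obtain u where u: "u \<in> cox_part d" "finsum Q (\<lambda>e. cox_const (c e) \<odot>\<^bsub>Q\<^esub> e) S = cst u"
    using insert by (auto simp: Q_simps)
  obtain v where v: "v \<in> cox_part d" "e = cst v" using insert.prems by (auto simp: Q_simps)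
  have "finsum Q (\<lambda>e. cox_const (c e) \<odot>\<^bsub>Q\<^esub> e) (insert e S) = cst (cox_const (c e) * v + u)"
    by (simp add: finsum_insert[OF insert.hyps S e] u(2), simp add: v(2) Q_simps)
  moreover have "cox_const (c e) * v + u \<in> cox_part d"
    by (intro cox_part_add cox_part_const_mult u v)
  moreover have "val (cst u) = (\<Sum>e\<in>S. pscale (c e) (val e))"
    using insert u(2) by simp
  ultimately show ?case using insert.hyps v(2)
    by (simp only: sum.insert[OF insert.hyps]) (auto simp: Q_simps(2) val_cst evX_add evX_const_mult)
qed

definition pt :: "'k point \<Rightarrow> 'k point \<Rightarrow> 'k" where
  "pt P = (\<lambda>R. if R = P then 1 else 0)"

lemma pt_sum: assumes "\<And>P. P \<notin> X \<Longrightarrow> t P = 0" shows "t = (\<Sum>P\<in>X. pscale (t P) (pt P))"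
proof
  fix R
  have "(\<Sum>P\<in>X. pscale (t P) (pt P)) R = (\<Sum>P\<in>X. if P = R then t P else 0)"
    unfolding sum_apply by (rule sum.cong) (auto simp: pscale_def pt_def)
  then show "t R = (\<Sum>P\<in>X. pscale (t P) (pt P)) R" using assms finite_X by simp
qed

lemma span_pt: "(\<And>P. P \<notin> X \<Longrightarrow> t P = 0) \<Longrightarrow> t \<in> pv.span (pt ` X)"
proof -
  assume "\<And>P. P \<notin> X \<Longrightarrow> t P = 0"
  then have t: "t = (\<Sum>P\<in>X. pscale (t P) (pt P))" by (rule pt_sum)
  show ?thesis by (subst t, rule pv.span_sum, rule pv.span_scale, rule pv.span_base) blast
qed

lemma inj_pt: "inj_on pt X"
proof (rule inj_onI)
  fix P R assume "pt P = pt R"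
  then have "pt P P = pt R P" by simp
  then show "P = R" by (simp add: pt_def split: if_splits)
qed

lemma independent_pt: "pv.independent (pt ` X)"
proof
  assume "pv.dependent (pt ` X)"
  then obtain u v where u: "v \<in> pt ` X" "u v \<noteq> 0" "(\<Sum>v\<in>pt ` X. pscale (u v) v) = 0"
    using finite_X by (auto simp: pv.dependent_finite)
  obtain P where P: "P \<in> X" "v = pt P" using u(1) by auto
  have "(\<Sum>v\<in>pt ` X. pscale (u v) v) P = (\<Sum>R\<in>X. if R = P then u (pt R) else 0)"
    unfolding sum.reindex[OF inj_pt] sum_apply by (rule sum.cong) (auto simp: pscale_def pt_def)
  then show False using u(2,3) P finite_X by simp
qed

lemma W_support: "t \<in> W d \<Longrightarrow> P \<notin> X \<Longrightarrow> t P = 0"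
  by (auto simp: W_def evX_def)

lemma finite_independent_W: "B \<subseteq> W d \<Longrightarrow> pv.independent B \<Longrightarrow> finite B"
  using pv.independent_span_bound[of "pt ` X" B] finite_X span_pt W_support by blast

text \<open>Existence of coordinates makes the values span \<open>W d\<close>, and uniqueness for
  the zero element makes them independent. So all bases have the same size and the description in
  \<open>part_dim\<close> denotes it.\<close>

lemma card_part_basis:
  assumes "part_basis Q d E" shows "card E = pv.dim (W d)"
proof -
  note pb = assms[unfolded part_basis_def]
  note E = pb[THEN conjunct1] pb[THEN conjunct2, THEN conjunct1]
  note ex = bspec[OF pb[THEN conjunct2, THEN conjunct2]]
  have inj: "inj_on val E" using inj_on_subset[OF inj_on_val E(2)] .
  have sub: "val ` E \<subseteq> W d" using E(2) val_part by blast
  have "W d \<subseteq> pv.span (val ` E)"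
  proof
    fix w assume "w \<in> W d"
    then obtain u where u: "u \<in> part Q d" "w = val u" using val_part by blast
    then obtain c where "u = finsum Q (\<lambda>e. cox_const (c e) \<odot>\<^bsub>Q\<^esub> e) E" using ex by blast
    then have "w = (\<Sum>e\<in>E. pscale (c e) (val e))" using finsum_val[OF E] u by simp
    then show "w \<in> pv.span (val ` E)"
      by (simp only:) (rule pv.span_sum, rule pv.span_scale, rule pv.span_base, blast)
  qed
  moreover have "pv.independent (val ` E)"
  proof
    assume "pv.dependent (val ` E)"
    then obtain r v where r: "v \<in> val ` E" "r v \<noteq> 0" "(\<Sum>v\<in>val ` E. pscale (r v) v) = 0"
      using E(1) by (auto simp: pv.dependent_finite)
    obtain e where e: "e \<in> E" "v = val e" using r(1) by blast
    define c where "c = restrict (\<lambda>e. r (val e)) E"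
    define c0 where "c0 = restrict (\<lambda>e. 0 :: 'k) E"
    have z: "cst 0 \<in> part Q d" by (auto simp: Q_simps)
    have zero: "cst 0 = finsum Q (\<lambda>e. cox_const (b e) \<odot>\<^bsub>Q\<^esub> e) E" if "(\<Sum>e\<in>E. pscale (b e) (val e)) = 0" for b
      using inj_onD[OF inj_on_val, of "cst 0" "finsum Q (\<lambda>e. cox_const (b e) \<odot>\<^bsub>Q\<^esub> e) E" d]
        finsum_val[OF E, of b] that z by (simp add: val_cst)
    have "(\<Sum>e\<in>E. pscale (c e) (val e)) = 0"
      using r(3) unfolding sum.reindex[OF inj] by (simp add: c_def)
    moreover have "(\<Sum>e\<in>E. pscale (c0 e) (val e)) = 0"
      by (simp add: c0_def)
    moreover have "c \<in> E \<rightarrow>\<^sub>E UNIV" "c0 \<in> E \<rightarrow>\<^sub>E UNIV" by (auto simp: c_def c0_def)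
    ultimately have "c = c0" using ex[OF z] zero by blast
    then have "c e = c0 e" by simp
    then show False using r(2) e by (simp add: c_def c0_def)
  qed
  ultimately have "card (val ` E) = pv.dim (W d)" using sub by (metis pv.basis_card_eq_dim)
  then show ?thesis using inj by (simp add: card_image)
qed

lemma ex_part_basis: "\<exists>E. part_basis Q d E"
proof -
  obtain B where B: "B \<subseteq> W d" "pv.independent B" "W d \<subseteq> pv.span B"
    using pv.maximal_independent_subset[of "W d"] by blast
  have finB: "finite B" using finite_independent_W B by blast
  have "B \<subseteq> val ` part Q d" using B(1) val_part[of d] by simp
  then have "\<forall>b\<in>B. \<exists>e\<in>part Q d. val e = b" by blast
  then obtain g where g: "\<And>b. b \<in> B \<Longrightarrow> g b \<in> part Q d" "\<And>b. b \<in> B \<Longrightarrow> val (g b) = b" by metis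
  define E where "E = g ` B"
  have E: "finite E" "E \<subseteq> part Q d" using finB g by (auto simp: E_def)
  have injg: "inj_on g B" using g(2) by (metis inj_onI)
  have gval: "g (val e) = e" if "e \<in> E" for e using that g by (auto simp: E_def)
  have sumE: "(\<Sum>e\<in>E. pscale (c e) (val e)) = (\<Sum>b\<in>B. pscale (c (g b)) b)" for c
    unfolding E_def sum.reindex[OF injg] by (rule sum.cong) (auto simp: g)
  have "\<exists>!c. c \<in> E \<rightarrow>\<^sub>E (UNIV :: 'k set) \<and> u = finsum Q (\<lambda>e. cox_const (c e) \<odot>\<^bsub>Q\<^esub> e) E"
    if u: "u \<in> part Q d" for u
  proof -
    have "val u \<in> range (\<lambda>r. \<Sum>b\<in>B. pscale (r b) b)"
      using B(3) val_part[of d] u pv.span_finite[OF finB] by blast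
    then obtain r where r: "val u = (\<Sum>b\<in>B. pscale (r b) b)" by (rule rangeE)
    define c where "c = restrict (\<lambda>e. r (val e)) E"
    have val_c: "val (finsum Q (\<lambda>e. cox_const (c e) \<odot>\<^bsub>Q\<^esub> e) E) = val u"
    proof -
      have "(\<Sum>b\<in>B. pscale (c (g b)) b) = (\<Sum>b\<in>B. pscale (r b) b)"
        by (rule sum.cong) (auto simp: c_def E_def g)
      then show ?thesis using finsum_val[OF E, of c] sumE[of c] r by simp
    qed
    have ceq: "u = finsum Q (\<lambda>e. cox_const (c e) \<odot>\<^bsub>Q\<^esub> e) E"
      by (rule inj_onD[OF inj_on_val[of d] val_c, symmetric]) (use finsum_val[OF E, of c] u in simp_all)
    show ?thesis
    proof (rule ex1I[of _ c])
      show "c \<in> E \<rightarrow>\<^sub>E UNIV \<and> u = finsum Q (\<lambda>e. cox_const (c e) \<odot>\<^bsub>Q\<^esub> e) E"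
        using ceq by (auto simp: c_def)
      fix c' assume c': "c' \<in> E \<rightarrow>\<^sub>E (UNIV :: 'k set) \<and> u = finsum Q (\<lambda>e. cox_const (c' e) \<odot>\<^bsub>Q\<^esub> e) E"
      have "(\<Sum>b\<in>B. pscale (c' (g b)) b) = (\<Sum>b\<in>B. pscale (c (g b)) b)"
      proof -
        have "val (finsum Q (\<lambda>e. cox_const (c' e) \<odot>\<^bsub>Q\<^esub> e) E) = val u"
          using conjunct2[OF c'] by (rule arg_cong[OF sym])
        then show ?thesis
          using conjunct2[OF finsum_val[OF E, of c']] conjunct2[OF finsum_val[OF E, of c]] val_c
          unfolding sumE by simp
      qed
      then have "(\<Sum>b\<in>B. pscale (c' (g b) - c (g b)) b) = 0"
        by (simp add: pv.scale_left_diff_distrib sum_subtractf)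
      then have "c' (g b) - c (g b) = 0" if "b \<in> B" for b
        using pv.independentD[OF B(2) finB order_refl _ that, of "\<lambda>b. c' (g b) - c (g b)"] by blast
      then have on_E: "c' e = c e" if "e \<in> E" for e using that unfolding E_def by auto
      show "c' = c"
      proof
        fix e
        show "c' e = c e"
          using on_E[of e] PiE_arb[OF conjunct1[OF c'], of e] by (cases "e \<in> E") (simp_all add: c_def)
      qed
    qed
  qed
  then show ?thesis using E unfolding part_basis_def by (intro exI[of _ E] conjI ballI)
qed

lemma part_dim_eq: "part_dim Q d = pv.dim (W d)"
  unfolding part_dim_def
proof (rule the_equality)
  show "\<exists>E. part_basis Q d E \<and> card E = pv.dim (W d)" using ex_part_basis card_part_basis by blast
qed (auto simp: card_part_basis)

text \<open>The indicator functions of the points form a basis of all functions on \<open>X\<close>;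
  a subspace is everything exactly when its dimension is \<open>card X\<close>.\<close>

lemma ev_surj_iff: "ev_surj d \<longleftrightarrow> part_dim Q d = card X"
proof
  assume s: "ev_surj d"
  have "pt P \<in> W d" if "P \<in> X" for P
  proof -
    have "pt P R = 0" if "R \<notin> X" for R using that \<open>P \<in> X\<close> by (auto simp: pt_def)
    from ev_surj_evX[OF s, of "pt P", OF this] obtain f where "f \<in> cox_part d" "evX f = pt P" by blast
    then show ?thesis unfolding W_def by (intro image_eqI[of _ _ f]) simp_all
  qed
  then have "pt ` X \<subseteq> W d" by blast
  moreover have "W d \<subseteq> pv.span (pt ` X)" using span_pt W_support by blast
  ultimately have "card (pt ` X) = pv.dim (W d)" using independent_pt by (metis pv.basis_card_eq_dim)
  then show "part_dim Q d = card X" using inj_pt by (simp add: part_dim_eq card_image)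
next
  assume dim: "part_dim Q d = card X"
  define FX where "FX = {t :: 'k point \<Rightarrow> 'k. \<forall>P. P \<notin> X \<longrightarrow> t P = 0}"
  have WF: "W d \<subseteq> FX" using W_support unfolding FX_def by blast
  obtain B where B: "B \<subseteq> W d" "pv.independent B" "W d \<subseteq> pv.span B" "card B = pv.dim (W d)"
    using pv.basis_exists by blast
  obtain B' where B': "B \<subseteq> B'" "B' \<subseteq> FX" "pv.independent B'" "FX \<subseteq> pv.span B'"
    using pv.maximal_independent_subset_extend[of B FX] B WF by blast
  have FXspan: "FX \<subseteq> pv.span (pt ` X)" using span_pt by (auto simp: FX_def)
  have "finite B'" using pv.independent_span_bound[of "pt ` X" B'] finite_X B' FXspan by blast
  moreover have "card B' = card B"
  proof -
    have "pt ` X \<subseteq> FX" by (auto simp: FX_def pt_def)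
    then have "card (pt ` X) = pv.dim FX" using FXspan independent_pt by (metis pv.basis_card_eq_dim)
    moreover have "card B' = pv.dim FX" using B' by (metis pv.basis_card_eq_dim)
    ultimately show ?thesis using B(4) dim inj_pt by (simp add: part_dim_eq card_image)
  qed
  ultimately have "B = B'" using B'(1) by (metis card_subset_eq)
  then have "FX \<subseteq> W d" using B'(4) pv.span_minimal[OF B(1) subspace_W] by blast
  show "ev_surj d"
    unfolding ev_surj_def
  proof
    fix \<tau> :: "'k point \<Rightarrow> 'k"
    have "(\<lambda>P. if P \<in> X then \<tau> P else 0) \<in> W d" using \<open>FX \<subseteq> W d\<close> by (auto simp: FX_def)
    then obtain f where f: "f \<in> cox_part d" "evX f = (\<lambda>P. if P \<in> X then \<tau> P else 0)" by (auto simp: W_def)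
    have "ev P f = \<tau> P" if "P \<in> X" for P using fun_cong[OF f(2), of P] that by (simp add: evX_def)
    then show "\<exists>f\<in>cox_part d. \<forall>P\<in>X. ev P f = \<tau> P" using f(1) by blast
  qed
qed

lemma ev_surj_generic:
  assumes "generic_hilbert_matrix X"
  shows "ev_surj (int i, int j) \<longleftrightarrow> card X \<le> (i + 1) * ((j + 2) choose 2)"
  using assms[unfolded generic_hilbert_matrix_def hilbert_matrix_def, rule_format, of i j]
  unfolding ev_surj_iff by (simp add: min_def)

end

section \<open>Minimal and virtual resolutions of the coordinate ring\<close>

lemma maximal_ideal_const:
  assumes "f \<in> maximal_graded_ideal" shows "lk (f :: 'k::field cox) 0 = 0"
  using assms unfolding maximal_graded_ideal_def
proof (induction rule: module.span_induct_alt[OF module_mult, consumes 1, case_names base step])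
  case (step c x y)
  then obtain v where "x = cox_gen v" by blast
  then have "lk x 0 = 0" by (auto simp: cox_gen_def lookup_single when_def poly_mapping_eq_iff fun_eq_iff)
  then show ?case using step by (simp add: lookup_add lookup_mult_0)
qed simp

lemma part_in_maximal_ideal:
  fixes f :: "'k::field cox"
  assumes "f \<in> cox_part d" "lk f 0 = 0" shows "f \<in> maximal_graded_ideal"
proof -
  have "\<exists>v\<in>UNIV. lk m v \<noteq> 0" if "lk f m \<noteq> 0" for m
    using that assms(2) by (intro exists_var) auto
  then obtain w where "kd gmul UNIV w {} = f" using cox_part_in_vars[OF assms(1)] by blast
  then have "f = (\<Sum>i\<in>UNIV. sg i {} (gmul i (w {i})))" by (simp add: kd_def)
  also have "\<dots> = (\<Sum>i\<in>UNIV. w {i} * cox_gen i)" by (simp add: sg_def mult.commute)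
  finally show ?thesis
    unfolding maximal_graded_ideal_def
    using module.span_sum[OF module_mult] module.span_scale[OF module_mult] module.span_base[OF module_mult]
    by (metis (no_types, lifting) rangeI)
qed

text \<open>For \<open>t \<ge> 0\<close> this is the \<open>t\<close>-th power of the ideal of
  \<open>x\<^sub>0, x\<^sub>1\<close>. It bounds powers of the irrelevant ideal from above; the
  \<open>y\<close>-degree may be ignored because exactness is known for all \<open>y\<close>-degrees
  once the \<open>x\<close>-degree is large.\<close>

definition x_ge :: "int \<Rightarrow> 'k::field cox set" where
  "x_ge t = {f. \<forall>m. lk f m \<noteq> 0 \<longrightarrow> t \<le> fst (mdeg m)}"

lemma x_ge_span:
  assumes "S \<subseteq> x_ge t" shows "ideal_gen S \<subseteq> (x_ge t :: 'k::field cox set)"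
proof
  fix f assume "f \<in> ideal_gen S"
  then show "f \<in> x_ge t"
  proof (induction rule: module.span_induct_alt[OF module_mult, consumes 1, case_names base step])
    case (step c x y)
    have "t \<le> fst (mdeg m)" if "lk (c * x) m \<noteq> 0" for m
    proof -
      have "m \<in> ks (c * x)" using that by (simp add: in_keys_iff)
      then obtain a b where "m = a + b" "b \<in> ks x" using keys_mult[of c x] by blast
      then have "t \<le> fst (mdeg b)" "m = a + b" using step(1) assms by (auto simp: x_ge_def in_keys_iff)
      then show ?thesis using mdeg_ge_0[of a] by (simp add: mdeg_add less_eq_prod_def)
    qed
    then have "c * x \<in> x_ge t" by (simp add: x_ge_def)
    moreover have "a + b \<in> x_ge t" if "a \<in> x_ge t" "b \<in> x_ge t" for a b :: "'k cox"
      unfolding x_ge_def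
    proof (intro CollectI allI impI)
      fix m assume "lk (a + b) m \<noteq> 0"
      then have "lk a m \<noteq> 0 \<or> lk b m \<noteq> 0" by (auto simp: lookup_add)
      then show "t \<le> fst (mdeg m)" using that by (auto simp: x_ge_def)
    qed
    ultimately show ?case using step by simp
  qed (simp add: x_ge_def)
qed

lemma irrelevant_x_ge: "irrelevant_ideal \<subseteq> (x_ge 1 :: 'k::field cox set)"
proof -
  have "range (\<lambda>i. cox_gen (Xv i)) \<subseteq> (x_ge 1 :: 'k cox set)"
    by (auto simp: x_ge_def cox_gen_def lookup_single when_def split: if_splits)
  then show ?thesis using x_ge_span unfolding irrelevant_ideal_def by blast
qed

lemma ideal_pow_x_ge: "ideal_pow irrelevant_ideal t \<subseteq> (x_ge (int t) :: 'k::field cox set)"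
proof (induction t)
  case 0
  then show ?case using mdeg_ge_0 by (auto simp: x_ge_def less_eq_prod_def)
next
  case (Suc t)
  have "a * b \<in> x_ge (int (Suc t))" if ab: "a \<in> irrelevant_ideal" "b \<in> ideal_pow irrelevant_ideal t" for a b :: "'k cox"
    unfolding x_ge_def
  proof (rule CollectI, intro allI impI)
    fix m assume "lk (a * b) m \<noteq> 0"
    then have "m \<in> ks (a * b)" by (simp add: in_keys_iff)
    then obtain p q where pq: "m = p + q" "p \<in> ks a" "q \<in> ks b" using keys_mult[of a b] by blast
    have "1 \<le> fst (mdeg p)" "int t \<le> fst (mdeg q)"
      using pq ab irrelevant_x_ge Suc by (auto simp: x_ge_def in_keys_iff)
    then show "int (Suc t) \<le> fst (mdeg m)" by (simp add: pq(1) mdeg_add)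
  qed
  then have "{a * b |a b. a \<in> irrelevant_ideal \<and> b \<in> ideal_pow irrelevant_ideal t} \<subseteq> (x_ge (int (Suc t)) :: 'k cox set)"
    by blast
  then show ?case using x_ge_span by simp
qed

lemma hc_x_ge: assumes "b \<in> x_ge t" "fst e < t" shows "hc e (b * f) = 0"
proof (rule poly_mapping_eqI)
  fix m
  have "b * f \<in> x_ge t"
    using x_ge_span[of "{b}" t] assms(1) module.span_scale[OF module_mult, of b "{b}" f]
      module.span_base[OF module_mult, of b "{b}"] by (auto simp: mult.commute)
  then show "lk (hc e (b * f)) m = lk 0 m"
    using assms(2) by (auto simp: lookup_hc x_ge_def)
qed

text \<open>The generators of the complexes below have nonnegative degrees, so multiplication by the
  \<open>t\<close>-th power of the irrelevant ideal lands in \<open>x\<close>-degrees at least \<open>t\<close>.\<close>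

lemma (in aug_complex) torsion:
  assumes pos: "\<And>g. g \<in> gens F k \<Longrightarrow> 0 \<le> gdeg F k g"
    and ex: "\<And>p q v. int t \<le> p \<Longrightarrow> v \<in> Zp k (p, q) \<Longrightarrow> v \<in> boundaries F k"
    and v: "v \<in> fcar (gens F k)" "if k = 0 then E v \<in> I else boundary F k v = 0"
    and b: "b \<in> ideal_pow irrelevant_ideal t"
  shows "(\<lambda>g. b * v g) \<in> boundaries F k"
proof -
  let ?u = "\<lambda>g. b * v g"
  have u: "?u \<in> fcar (gens F k)" using v(1) by (simp add: fcar_def)
  obtain D where D: "finite D" "?u = (\<Sum>d\<in>D. hcv (gens F k) (gdeg F k) d ?u)"
    using sum_hcv[OF fin_gens u] by blast
  have b': "b \<in> x_ge (int t)" using b ideal_pow_x_ge by blast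
  have "hcv (gens F k) (gdeg F k) d ?u \<in> boundaries F k" for d
  proof (cases "int t \<le> fst d")
    case True
    have "hcv (gens F k) (gdeg F k) d ?u \<in> Zp k d"
    proof (cases k)
      case 0
      have "E ?u \<in> I" using v(2) 0 by (simp add: eps_map_smult id_mult)
      then have "E (hcv (gens F 0) (gdeg F 0) d ?u) \<in> I"
        by (simp add: eps_map_hcv[OF eps_part] id_hc)
      then show ?thesis using 0 by (simp add: Zp_def)
    next
      case (Suc j)
      have "boundary F (Suc j) ?u = 0" using v(2) Suc by (simp add: boundary_smult)
      then have "boundary F (Suc j) (hcv (gens F (Suc j)) (gdeg F (Suc j)) d ?u) = 0"
        by (simp add: boundary_hcv hcv_zero)
      then show ?thesis using Suc by (simp add: Zp_def)
    qed
    then show ?thesis using ex[OF True, of _ "snd d"] by simp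
  next
    case False
    have "hc (d - gdeg F k g) (b * v g) = 0" if "g \<in> gens F k" for g
      using pos[OF that] False by (intro hc_x_ge[OF b']) (auto simp: less_eq_prod_def)
    then have "hcv (gens F k) (gdeg F k) d ?u = 0" by (auto simp: hcv_def fun_eq_iff)
    then show ?thesis using boundaries_simps(1) by simp
  qed
  then show ?thesis by (subst D(2)) (rule boundaries_sum)
qed

section \<open>Minimal free resolutions as augmented complexes\<close>

context points
begin

interpretation CI: gsubmodule cox_module I by (rule gsubmodule_ideal)

lemma coset_zero_iff: "cst u = cst 0 \<longleftrightarrow> u \<in> I"
  using ideal_coset_eq[of u 0] by simp

text \<open>The isomorphism sends the class of a basis element to the class of some form of the same
  degree, taken as \<open>eps\<close>. By linearity it is then induced by the augmentation, and its
  injectivity is exactness at \<open>F\<^sub>0\<close>.\<close>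

lemma min_resolution_of_minimal:
  assumes F: "minimal_free_resolution F Q"
  shows "\<exists>eps. min_resolution I F eps"
proof -
  have gfc: "graded_free_complex F"
    and exact: "\<And>i. 0 < i \<Longrightarrow> carrier (homology F i) = {\<zero>\<^bsub>homology F i\<^esub>}"
    and iso: "graded_iso (homology F 0) Q"
    and max: "\<And>k r c. r \<in> gens F k \<Longrightarrow> c \<in> gens F (Suc k) \<Longrightarrow> diff F (Suc k) r c \<in> maximal_graded_ideal"
    using F unfolding minimal_free_resolution_def by blast+
  have fin: "finite (gens F 0)" using gfc by (simp add: graded_free_complex_def)
  interpret H: gsubmodule "submod (free_mod F 0) (cycles F 0)" "boundaries F 0"
    by (rule gsubmodule_boundaries[OF gfc])
  have cyc0: "cycles F 0 = fcar (gens F 0)" by (simp add: cycles_def)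
  let ?c = "\<lambda>v. boundaries F 0 +>\<^bsub>submod (free_mod F 0) (cycles F 0)\<^esub> v"
  have Hq: "homology F 0 = quot_mod (submod (free_mod F 0) (cycles F 0)) (boundaries F 0)" by (rule homology_eq)
  have Hcar: "carrier (homology F 0) = ?c ` fcar (gens F 0)"
    using H.quot_carrier cyc0 Hq by simp
  have Hadd: "?c u \<oplus>\<^bsub>homology F 0\<^esub> ?c v = ?c (u + v)" if "u \<in> fcar (gens F 0)" "v \<in> fcar (gens F 0)" for u v
    using H.quot_add that cyc0 Hq by simp
  have Hsm: "f \<odot>\<^bsub>homology F 0\<^esub> ?c u = ?c (\<lambda>g. f * u g)" if "u \<in> fcar (gens F 0)" for f u
    using H.quot_smult that cyc0 Hq by simp
  have Hpart: "part (homology F 0) d = ?c ` fpart (gens F 0) (gdeg F 0) d" for d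
  proof -
    have "fpart (gens F 0) (gdeg F 0) d \<inter> fcar (gens F 0) = (fpart (gens F 0) (gdeg F 0) d :: (nat \<Rightarrow> 'k cox) set)"
      using fpart_fcar by blast
    then show ?thesis using H.quot_part[of d] cyc0 Hq by simp
  qed
  have Heq: "?c u = ?c v \<longleftrightarrow> u - v \<in> boundaries F 0" if "u \<in> fcar (gens F 0)" "v \<in> fcar (gens F 0)" for u v
    using boundaries_coset_eq[OF gfc, of u 0 v] that cyc0 by simp
  obtain h where h: "bij_betw h (carrier (homology F 0)) (carrier Q)"
    "\<And>u v. u \<in> carrier (homology F 0) \<Longrightarrow> v \<in> carrier (homology F 0) \<Longrightarrow>
        h (u \<oplus>\<^bsub>homology F 0\<^esub> v) = h u \<oplus>\<^bsub>Q\<^esub> h v"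
    "\<And>f u. u \<in> carrier (homology F 0) \<Longrightarrow> h (f \<odot>\<^bsub>homology F 0\<^esub> u) = f \<odot>\<^bsub>Q\<^esub> h u"
    "\<And>d. h ` part (homology F 0) d = part Q d"
    using iso unfolding graded_iso_def by metis
  define e :: "nat \<Rightarrow> nat \<Rightarrow> 'k cox" where "e g = (\<lambda>r. if r = g then 1 else 0)" for g
  have e: "e g \<in> fpart (gens F 0) (gdeg F 0) (gdeg F 0 g)" if "g \<in> gens F 0" for g
    using that by (auto simp: e_def fpart_def fcar_def zero_prod_def[symmetric])
  have "\<exists>s. s \<in> cox_part (gdeg F 0 g) \<and> h (?c (e g)) = cst s" if "g \<in> gens F 0" for g
  proof -
    have "h (?c (e g)) \<in> part Q (gdeg F 0 g)" using h(4)[of "gdeg F 0 g"] Hpart e[OF that] by blast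
    then show ?thesis by (auto simp: Q_simps)
  qed
  then obtain eps where eps: "\<And>g. g \<in> gens F 0 \<Longrightarrow> eps g \<in> cox_part (gdeg F 0 g)"
    "\<And>g. g \<in> gens F 0 \<Longrightarrow> h (?c (e g)) = cst (eps g)" by metis
  let ?E = "eps_map (gens F 0) eps"
  \<comment> \<open>\<open>graded_iso\<close> lists no condition at zero; compatibility with the
    scalar 0 supplies it.\<close>
  have h0: "h (?c 0) = cst 0"
  proof -
    have z: "(0 :: nat \<Rightarrow> 'k cox) \<in> fcar (gens F 0)" by (simp add: fcar_def)
    have "h (?c 0) \<in> carrier Q" using bij_betwE[OF h(1)] Hcar z by blast
    then obtain s where s: "h (?c 0) = cst s" by (auto simp: Q_simps)
    have "h (0 \<odot>\<^bsub>homology F 0\<^esub> ?c 0) = cst 0" using h(3)[of "?c 0" 0] s Hcar z by (simp add: Q_simps)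
    then show ?thesis using Hsm[OF z, of 0] by simp
  qed
  have hE: "h (?c v) = cst (?E v)" if v: "v \<in> fcar (gens F 0)" for v
  proof -
    have claim: "h (?c (\<Sum>g\<in>S. (\<lambda>r. v g * e g r))) = cst (\<Sum>g\<in>S. v g * eps g)"
      if "finite S" "S \<subseteq> gens F 0" for S
      using that
    proof (induction S rule: finite_induct)
      case (insert g S)
      have eg: "e g \<in> fcar (gens F 0)" using insert.prems e fpart_fcar by blast
      then have 1: "(\<lambda>r. v g * e g r) \<in> fcar (gens F 0)" by (simp add: fcar_def)
      have 2: "(\<Sum>g\<in>S. (\<lambda>r. v g * e g r)) \<in> fcar (gens F 0)"
        using insert.prems by (auto simp: fcar_def sum_apply e_def intro!: sum.neutral)
      have "h (?c (\<lambda>r. v g * e g r)) = cst (v g * eps g)"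
        using Hsm[OF eg, of "v g"] h(3)[of "?c (e g)" "v g"] eg eps(2)[of g] insert.prems Hcar by (simp add: Q_simps)
      moreover have "h (?c (\<Sum>g\<in>S. (\<lambda>r. v g * e g r))) = cst (\<Sum>g\<in>S. v g * eps g)" using insert by simp
      ultimately have "h (?c ((\<lambda>r. v g * e g r) + (\<Sum>g\<in>S. (\<lambda>r. v g * e g r)))) = cst (v g * eps g + (\<Sum>g\<in>S. v g * eps g))"
        using h(2)[of "?c (\<lambda>r. v g * e g r)" "?c (\<Sum>g\<in>S. (\<lambda>r. v g * e g r))"] Hadd[OF 1 2] Hcar 1 2 by (simp add: Q_simps)
      then show ?case by (simp only: sum.insert[OF insert.hyps])
    qed (simp add: h0)
    have "(\<Sum>g\<in>gens F 0. (\<lambda>r. v g * e g r)) = v"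
    proof
      fix r
      have "(\<Sum>g\<in>gens F 0. (\<lambda>r. v g * e g r)) r = (\<Sum>g\<in>gens F 0. if g = r then v g else 0)"
        unfolding sum_apply by (rule sum.cong) (auto simp: e_def)
      then show "(\<Sum>g\<in>gens F 0. (\<lambda>r. v g * e g r)) r = v r"
        using fin v by (auto simp: fcar_def)
    qed
    with claim[OF fin order_refl] show ?thesis by (simp only: eps_map_def)
  qed
  have ker: "?E v \<in> I \<longleftrightarrow> v \<in> boundaries F 0" if v: "v \<in> fcar (gens F 0)" for v
  proof -
    have z: "(0 :: nat \<Rightarrow> 'k cox) \<in> fcar (gens F 0)" by (simp add: fcar_def)
    have "?E v \<in> I \<longleftrightarrow> h (?c v) = h (?c 0)" using hE[OF v] h0 coset_zero_iff by simp
    also have "\<dots> \<longleftrightarrow> ?c v = ?c 0"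
    proof (rule inj_on_eq_iff[OF bij_betw_imp_inj_on[OF h(1)]])
      show "?c v \<in> carrier (homology F 0)" "?c 0 \<in> carrier (homology F 0)"
        unfolding Hcar by (rule imageI, rule v, rule imageI, rule z)
    qed
    also have "\<dots> \<longleftrightarrow> v \<in> boundaries F 0" using Heq[OF v z] by simp
    finally show ?thesis .
  qed
  have "min_resolution I F eps"
  proof
    show "graded_free_complex F" by (rule gfc)
    show "eps g \<in> cox_part (gdeg F 0 g)" if "g \<in> gens F 0" for g using eps(1)[OF that] .
    show "\<exists>v\<in>fcar (gens F 0). s - ?E v \<in> I" for s
    proof -
      have "cst s \<in> carrier Q" by (auto simp: Q_simps)
      then have "cst s \<in> h ` ?c ` fcar (gens F 0)"
        using bij_betw_imp_surj_on[OF h(1)] Hcar by simp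
      then obtain v where "v \<in> fcar (gens F 0)" "cst s = h (?c v)" by (elim imageE) simp
      then show ?thesis using hE[of v] ideal_coset_eq[of s "?E v"] by (intro bexI[of _ v]) simp_all
    qed
    show "?E (boundary F (Suc 0) v) \<in> I" if "v \<in> fcar (gens F (Suc 0))" for v
      using that ker[of "boundary F (Suc 0) v"] by (auto simp: boundaries_def boundary_Suc)
    show "\<exists>w\<in>fcar (gens F (Suc k)). boundary F (Suc k) w = v"
      if v: "v \<in> fcar (gens F k)" "if k = 0 then ?E v \<in> I else boundary F k v = 0" for v k
    proof (cases "k = 0")
      case True
      then have "v \<in> boundaries F 0" using v ker by simp
      then show ?thesis using True by (auto simp: boundaries_def)
    next
      case False
      interpret K: gsubmodule "submod (free_mod F k) (cycles F k)" "boundaries F k"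
        by (rule gsubmodule_boundaries[OF gfc])
      have vc: "v \<in> cycles F k" "0 \<in> cycles F k" using v False by (auto simp: cycles_def fcar_def boundary_0)
      have "boundaries F k +>\<^bsub>submod (free_mod F k) (cycles F k)\<^esub> v = boundaries F k +>\<^bsub>submod (free_mod F k) (cycles F k)\<^esub> 0"
        using exact[of k] False vc K.quot_carrier K.quot_zero unfolding homology_eq by auto
      then have "v \<in> boundaries F k" using boundaries_coset_eq[OF gfc vc] by simp
      then show ?thesis by (auto simp: boundaries_def)
    qed
    show "lk (diff F (Suc k) r c) 0 = 0" if "r \<in> gens F k" "c \<in> gens F (Suc k)" for k r c
      using max[OF that] by (rule maximal_ideal_const)
  qed
  then show ?thesis by blast
qed

text \<open>Here the augmentation induces the isomorphism in homology at 0: its kernel modulo the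
  ideal is the set of boundaries by exactness.\<close>

lemma minimal_of_min_resolution:
  assumes "min_resolution I F eps" shows "minimal_free_resolution F Q"
proof -
  interpret min_resolution I F eps by (rule assms)
  have exactB: "v \<in> boundaries F k" if "v \<in> fcar (gens F k)" "if k = 0 then E v \<in> I else boundary F k v = 0" for k v
    using exact[OF that] by (auto simp: boundaries_def)
  have "carrier (homology F i) = {\<zero>\<^bsub>homology F i\<^esub>}" if "0 < i" for i
  proof -
    interpret K: gsubmodule "submod (free_mod F i) (cycles F i)" "boundaries F i"
      by (rule gsubmodule_boundaries[OF graded])
    let ?c = "\<lambda>u. boundaries F i +>\<^bsub>submod (free_mod F i) (cycles F i)\<^esub> u"
    have z: "0 \<in> cycles F i" by (simp add: cycles_def fcar_def boundary_0)
    have "?c v = ?c 0" if "v \<in> cycles F i" for v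
      using exactB[of v i] that \<open>0 < i\<close> boundaries_coset_eq[OF graded that z] by (simp add: cycles_def)
    then have "?c ` cycles F i = (\<lambda>u. ?c 0) ` cycles F i" by (intro image_cong refl)
    also have "\<dots> = {?c 0}" by (rule image_constant[OF z])
    finally have "?c ` cycles F i = {?c 0}" .
    then show ?thesis
      unfolding homology_eq K.quot_carrier K.quot_zero by simp
  qed
  moreover have "graded_iso (homology F 0) Q"
    unfolding homology_eq coord_ring_def
  proof (rule quot_graded_iso, rule quot_iso[OF gsubmodule_boundaries[OF graded] gsubmodule_ideal])
    show "E (u \<oplus>\<^bsub>submod (free_mod F 0) (cycles F 0)\<^esub> v) = E u \<oplus>\<^bsub>cox_module\<^esub> E v" for u v
      by (simp add: eps_map_add)
    show "E (r \<odot>\<^bsub>submod (free_mod F 0) (cycles F 0)\<^esub> u) = r \<odot>\<^bsub>cox_module\<^esub> E u" for r u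
      by (simp add: eps_map_smult)
    show "E u \<in> part cox_module d" if "u \<in> part (submod (free_mod F 0) (cycles F 0)) d" for u d
      using eps_map_fpart[OF eps_part] that by simp
    show "E u \<in> I \<longleftrightarrow> u \<in> boundaries F 0" if "u \<in> carrier (submod (free_mod F 0) (cycles F 0))" for u
      using that exactB[of u 0] eps_boundary by (auto simp: boundaries_def cycles_def)
    show "\<exists>u\<in>carrier (submod (free_mod F 0) (cycles F 0)). cst w = cst (E u)" for w
      using eps_onto[of w] by (simp add: ideal_coset_eq cycles_def)
    show "\<exists>u\<in>part (submod (free_mod F 0) (cycles F 0)) d. cst w = cst (E u)" if "w \<in> part cox_module d" for w d
      using eps_onto_part[of w d] that fpart_fcar by (fastforce simp: ideal_coset_eq cycles_def)
  qed auto
  ultimately show ?thesis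
    unfolding minimal_free_resolution_def
    using graded part_in_maximal_ideal[OF diff_part minimal] by (intro conjI allI impI ballI) simp_all
qed

end

section \<open>Torsion with respect to the irrelevant ideal\<close>

lemma ideal_pow_power: "f \<in> J \<Longrightarrow> f ^ t \<in> ideal_pow J t"
  for f :: "'a::comm_ring_1"
proof (induction t)
  case (Suc t)
  then show ?case
    by (simp only: ideal_pow.simps power_Suc) (rule module.span_base[OF module_mult], blast)
qed simp

lemma gen_mult_irrelevant: "cox_gen (Xv i) * cox_gen (Yv j) \<in> (irrelevant_ideal :: 'k::field cox set)"
  unfolding irrelevant_ideal_def
proof
  show "cox_gen (Xv i) * cox_gen (Yv j) \<in> ideal_gen (range (\<lambda>i. cox_gen (Xv i) :: 'k cox))"
    unfolding mult.commute[of "cox_gen (Xv i)"]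
    by (intro module.span_scale[OF module_mult] module.span_base[OF module_mult] rangeI)
  show "cox_gen (Xv i) * cox_gen (Yv j) \<in> ideal_gen (range (\<lambda>j. cox_gen (Yv j) :: 'k cox))"
    by (intro module.span_scale[OF module_mult] module.span_base[OF module_mult] rangeI)
qed

lemma cox_part_power: "f \<in> cox_part d \<Longrightarrow> \<exists>e. f ^ t \<in> cox_part e"
  for f :: "'k::field cox"
proof (induction t)
  case 0
  show ?case by (rule exI[of _ 0]) simp
next
  case (Suc t)
  then obtain e where "f ^ t \<in> cox_part e" by blast
  then show ?case using cox_part_mult[OF Suc.prems] by (intro exI[of _ "d + e"]) simp
qed

context points
begin

text \<open>At every point of \<open>X\<close> some form in any given power of the irrelevant ideal does not vanish.\<close>

lemma saturated:
  assumes "\<And>b. b \<in> ideal_pow irrelevant_ideal t \<Longrightarrow> b * u \<in> I" shows "u \<in> I"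
proof -
  have "hc d u \<in> I" for d
    unfolding ideal_iff[OF hc_part]
  proof
    fix P assume P: "P \<in> X"
    obtain i j where ij: "rep P (Xv i) \<noteq> 0" "rep P (Yv j) \<noteq> 0" using rep_nonzero[OF P] by blast
    define b :: "'k cox" where "b = (cox_gen (Xv i) * cox_gen (Yv j)) ^ t"
    obtain e where e: "b \<in> cox_part e"
      using cox_part_power[OF cox_part_mult[OF cox_part_gen cox_part_gen]] unfolding b_def by blast
    have "hc (d + e) (b * u) \<in> I"
      using assms ideal_pow_power[OF gen_mult_irrelevant] hc_ideal unfolding b_def by blast
    then have "ev P b * ev P (hc d u) = 0"
      using ideal_ev[OF _ P] by (simp add: hc_mult[OF e] eval_mpoly_mult[symmetric])
    then show "ev P (hc d u) = 0"
      using ij by (simp add: b_def eval_mpoly_power eval_mpoly_mult eval_mpoly_gen)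
  qed
  moreover have "sum f B \<in> I" if "\<And>b. b \<in> B \<Longrightarrow> f b \<in> I" for f and B :: "(int \<times> int) set"
    using that by (induction B rule: infinite_finite_induct) (auto intro: ideal_facts)
  moreover have "u = (\<Sum>d\<in>mdeg ` ks u. hc d u)" by (rule sum_hc) auto
  ultimately show ?thesis by metis
qed

text \<open>The vanishing ideal is saturated, so the second condition on a virtual resolution
  compares with \<open>S / I\<close> itself.\<close>

lemma Gamma_coord_ring: "Gamma_B Q = {\<zero>\<^bsub>Q\<^esub>}"
proof
  show "Gamma_B Q \<subseteq> {\<zero>\<^bsub>Q\<^esub>}"
  proof
    fix C assume "C \<in> Gamma_B Q"
    then have C: "C \<in> range cst" and "\<exists>t. \<forall>b\<in>ideal_pow irrelevant_ideal t. b \<odot>\<^bsub>Q\<^esub> C = \<zero>\<^bsub>Q\<^esub>"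
      unfolding Gamma_B_def Q_simps(1) by blast+
    then obtain t where t: "\<And>b. b \<in> ideal_pow irrelevant_ideal t \<Longrightarrow> b \<odot>\<^bsub>Q\<^esub> C = \<zero>\<^bsub>Q\<^esub>" by blast
    obtain u where u: "C = cst u" using C by (rule rangeE)
    have "u \<in> I"
    proof (rule saturated[of t])
      fix b :: "'k cox" assume "b \<in> ideal_pow irrelevant_ideal t"
      then have "cst (b * u) = cst 0" using t u Q_simps(3,5) by metis
      then show "b * u \<in> I" using coset_zero_iff by simp
    qed
    then show "C \<in> {\<zero>\<^bsub>Q\<^esub>}" using u coset_zero_iff by (simp add: Q_simps)
  qed
  have "f \<odot>\<^bsub>Q\<^esub> \<zero>\<^bsub>Q\<^esub> = \<zero>\<^bsub>Q\<^esub>" for f by (simp add: Q_simps)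
  then show "{\<zero>\<^bsub>Q\<^esub>} \<subseteq> Gamma_B Q" by (auto simp: Gamma_B_def Q_simps(1,3))
qed

lemma gsubmodule_zero: "gsubmodule Q {\<zero>\<^bsub>Q\<^esub>}"
proof -
  interpret gmodule Q by (rule gmodule_Q)
  have "f \<odot>\<^bsub>Q\<^esub> \<zero>\<^bsub>Q\<^esub> = \<zero>\<^bsub>Q\<^esub>" for f by (simp add: Q_simps(3,5))
  then show ?thesis by unfold_locales auto
qed

text \<open>One exponent \<open>t\<close> kills the homology in all positions, and also the kernel
  of \<open>H\<^sub>0(F) \<rightarrow> S / I\<close>. Conversely torsion maps to torsion, which is
  zero in \<open>S / I\<close>. Hence that kernel is exactly the torsion and can be divided
  out.\<close>

lemma virtual_resolutionI:
  assumes F: "aug_complex I F eps"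
    and pos: "\<And>k g. g \<in> gens F k \<Longrightarrow> 0 \<le> gdeg F k g"
    and ex: "\<And>k p q v. int t \<le> p \<Longrightarrow> v \<in> aug_complex.Zp I F eps k (p, q) \<Longrightarrow> v \<in> boundaries F k"
  shows "virtual_resolution F Q"
proof -
  interpret aug_complex I F eps by (rule F)
  have tors: "(\<lambda>g. b * v g) \<in> boundaries F k"
    if "v \<in> fcar (gens F k)" "if k = 0 then E v \<in> I else boundary F k v = 0"
      "b \<in> ideal_pow irrelevant_ideal t" for b v k
    by (rule torsion[OF pos ex that])
  have hom: "b \<odot>\<^bsub>homology F i\<^esub> u = \<zero>\<^bsub>homology F i\<^esub>"
    if i: "0 < i" and b: "b \<in> ideal_pow irrelevant_ideal t" and u: "u \<in> carrier (homology F i)" for i b u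
  proof -
    interpret K: gsubmodule "submod (free_mod F i) (cycles F i)" "boundaries F i"
      by (rule gsubmodule_boundaries[OF graded])
    obtain v where v: "v \<in> cycles F i" "u = boundaries F i +>\<^bsub>submod (free_mod F i) (cycles F i)\<^esub> v"
      using u unfolding homology_eq K.quot_carrier by auto
    have z: "0 \<in> cycles F i" by (simp add: cycles_def fcar_def boundary_0)
    have "(\<lambda>g. b * v g) \<in> boundaries F i" using v(1) i b by (intro tors) (auto simp: cycles_def)
    moreover have "(\<lambda>g. b * v g) \<in> cycles F i"
      using K.smult_closed[of v b] v(1) by simp
    ultimately show ?thesis
      unfolding homology_eq v(2) using boundaries_coset_eq[OF graded _ z] K.quot_smult[of v b] K.quot_zero v(1) by simp
  qed
  interpret H: gsubmodule "submod (free_mod F 0) (cycles F 0)" "boundaries F 0"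
    by (rule gsubmodule_boundaries[OF graded])
  let ?H = "homology F 0"
  let ?c = "\<lambda>v. boundaries F 0 +>\<^bsub>submod (free_mod F 0) (cycles F 0)\<^esub> v"
  have gH: "gmodule ?H" using H.gmodule_quot by (simp add: homology_eq)
  have cyc0: "v \<in> cycles F 0 \<longleftrightarrow> v \<in> fcar (gens F 0)" for v by (simp add: cycles_def)
  have Hcar: "carrier ?H = ?c ` cycles F 0" using H.quot_carrier by (simp add: homology_eq)
  have Hadd: "?c u \<oplus>\<^bsub>?H\<^esub> ?c v = ?c (u + v)" if "u \<in> cycles F 0" "v \<in> cycles F 0" for u v
    using H.quot_add[of u v] that by (simp add: homology_eq)
  have Hsm: "f \<odot>\<^bsub>?H\<^esub> ?c u = ?c (\<lambda>g. f * u g)" if "u \<in> cycles F 0" for f u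
    using H.quot_smult[of u f] that by (simp add: homology_eq)
  have Hzero: "\<zero>\<^bsub>?H\<^esub> = ?c 0" using H.quot_zero by (simp add: homology_eq)
  have Hpart: "part ?H d = ?c ` Fp 0 d" for d
  proof -
    have "Fp 0 d \<inter> cycles F 0 = Fp 0 d" using fpart_fcar cyc0 by blast
    then show ?thesis using H.quot_part[of d] by (simp add: homology_eq)
  qed
  have Heq: "?c u = ?c v \<longleftrightarrow> u - v \<in> boundaries F 0" if "u \<in> cycles F 0" "v \<in> cycles F 0" for u v
    by (rule boundaries_coset_eq[OF graded that])
  have cyc_closed: "0 \<in> cycles F 0" "u \<in> cycles F 0 \<Longrightarrow> v \<in> cycles F 0 \<Longrightarrow> u + v \<in> cycles F 0"
    "u \<in> cycles F 0 \<Longrightarrow> - u \<in> cycles F 0" "u \<in> cycles F 0 \<Longrightarrow> (\<lambda>g. f * u g) \<in> cycles F 0" for u v f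
    by (auto simp: cyc0 fcar_def)
  have EB: "E v \<in> I" if "v \<in> boundaries F 0" for v
    using that eps_boundary by (auto simp: boundaries_def)
  \<comment> \<open>The map on cosets induced by the augmentation; it does not depend on the
    representative because boundaries are sent into \<open>I\<close>.\<close>
  define f where "f C = cst (E (SOME v. v \<in> C))" for C
  have f: "f (?c u) = cst (E u)" if u: "u \<in> cycles F 0" for u
  proof -
    have "(SOME v. v \<in> ?c u) \<in> ?c u"
      using H.a_rcos_self[of u] u by (intro someI[of "\<lambda>v. v \<in> ?c u"]) simp
    then have "(SOME v. v \<in> ?c u) \<in> cycles F 0" "?c (SOME v. v \<in> ?c u) = ?c u"
      using H.coset_elem[of _ u] u by simp_all
    then have "(SOME v. v \<in> ?c u) - u \<in> boundaries F 0" using Heq u by simp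
    then have "E (SOME v. v \<in> ?c u) - E u \<in> I" using EB by (simp add: eps_map_diff[symmetric])
    then show ?thesis unfolding f_def using ideal_coset_eq by simp
  qed
  have Gamma: "?c u \<in> Gamma_B ?H \<longleftrightarrow> E u \<in> I" if u: "u \<in> cycles F 0" for u
  proof
    assume "?c u \<in> Gamma_B ?H"
    then obtain s where s: "\<And>b. b \<in> ideal_pow irrelevant_ideal s \<Longrightarrow> b \<odot>\<^bsub>?H\<^esub> ?c u = \<zero>\<^bsub>?H\<^esub>"
      unfolding Gamma_B_def by blast
    show "E u \<in> I"
    proof (rule saturated[of s])
      fix b :: "'k cox" assume "b \<in> ideal_pow irrelevant_ideal s"
      then have "?c (\<lambda>g. b * u g) = ?c 0" using s Hsm[OF u] Hzero by simp
      then have "(\<lambda>g. b * u g) \<in> boundaries F 0"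
        using Heq[OF cyc_closed(4)[OF u] cyc_closed(1)] by simp
      then show "b * E u \<in> I" using EB by (simp add: eps_map_smult[symmetric])
    qed
  next
    assume "E u \<in> I"
    then have "b \<odot>\<^bsub>?H\<^esub> ?c u = \<zero>\<^bsub>?H\<^esub>" if "b \<in> ideal_pow irrelevant_ideal t" for b
      using tors[of u 0 b] that u Heq[OF cyc_closed(4)[OF u] cyc_closed(1)] by (simp add: Hsm Hzero cyc0)
    then show "?c u \<in> Gamma_B ?H" using u unfolding Gamma_B_def Hcar by blast
  qed
  have Gamma_eq: "Gamma_B ?H = ?c ` {u \<in> cycles F 0. E u \<in> I}"
  proof -
    have "Gamma_B ?H \<subseteq> carrier ?H" by (auto simp: Gamma_B_def)
    then show ?thesis using Gamma unfolding Hcar by blast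
  qed
  interpret gH: gmodule ?H by (rule gH)
  have Hneg: "\<ominus>\<^bsub>?H\<^esub> ?c u = ?c (- u)" if u: "u \<in> cycles F 0" for u
    using gH.minus_equality[of "?c (- u)" "?c u"] Hadd[OF cyc_closed(3)[OF u] u] u cyc_closed(3)[OF u]
    by (simp add: Hzero Hcar)
  have E0: "E 0 \<in> I" by (simp add: eps_map_def ideal_facts)
  have Eneg: "E (- u) \<in> I" if "E u \<in> I" for u
    using ideal_facts(3)[OF E0 that] eps_map_diff[of "gens F 0" eps 0 u] by simp
  have gsG: "gsubmodule ?H (Gamma_B ?H)"
  proof unfold_locales
    show "Gamma_B ?H \<subseteq> carrier ?H" by (auto simp: Gamma_B_def)
    show "\<zero>\<^bsub>?H\<^esub> \<in> Gamma_B ?H" using Gamma[OF cyc_closed(1)] E0 Hzero by simp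
    show "u \<oplus>\<^bsub>?H\<^esub> v \<in> Gamma_B ?H" if uv: "u \<in> Gamma_B ?H" "v \<in> Gamma_B ?H" for u v
    proof -
      obtain a b where "a \<in> cycles F 0" "E a \<in> I" "u = ?c a" "b \<in> cycles F 0" "E b \<in> I" "v = ?c b"
        using uv unfolding Gamma_eq by blast
      then show ?thesis using Gamma[OF cyc_closed(2)] by (simp add: Hadd eps_map_add ideal_facts)
    qed
    show "\<ominus>\<^bsub>?H\<^esub> u \<in> Gamma_B ?H" if u: "u \<in> Gamma_B ?H" for u
    proof -
      obtain a where "a \<in> cycles F 0" "E a \<in> I" "u = ?c a" using u unfolding Gamma_eq by blast
      then show ?thesis using Gamma[OF cyc_closed(3)] Eneg by (simp add: Hneg)
    qed
    show "r \<odot>\<^bsub>?H\<^esub> u \<in> Gamma_B ?H" if u: "u \<in> Gamma_B ?H" for r u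
    proof -
      obtain a where "a \<in> cycles F 0" "E a \<in> I" "u = ?c a" using u unfolding Gamma_eq by blast
      then show ?thesis using Gamma[OF cyc_closed(4)] by (simp add: Hsm eps_map_smult ideal_facts)
    qed
  qed
  have "graded_iso (quot_mod ?H (Gamma_B ?H)) (quot_mod Q (Gamma_B Q))"
    unfolding Gamma_coord_ring
  proof (rule quot_graded_iso, rule quot_iso[OF gsG gsubmodule_zero, of f])
    show "f u \<in> carrier Q" if "u \<in> carrier ?H" for u using that by (auto simp: Hcar f Q_simps)
    show "f (u \<oplus>\<^bsub>?H\<^esub> v) = f u \<oplus>\<^bsub>Q\<^esub> f v" if "u \<in> carrier ?H" "v \<in> carrier ?H" for u v
      using that by (auto simp: Hcar f Q_simps Hadd cyc_closed eps_map_add)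
    show "f (r \<odot>\<^bsub>?H\<^esub> u) = r \<odot>\<^bsub>Q\<^esub> f u" if "u \<in> carrier ?H" for r u
      using that by (auto simp: Hcar f Q_simps Hsm cyc_closed eps_map_smult)
    show "f u \<in> part Q d" if u: "u \<in> part ?H d" for u d
    proof -
      obtain a where a: "a \<in> Fp 0 d" "u = ?c a" using u unfolding Hpart by blast
      then have "f u = cst (E a)" using f[of a] fpart_fcar[OF a(1)] cyc0 by simp
      then show ?thesis using eps_map_fpart[OF eps_part a(1)] by (auto simp: Q_simps)
    qed
    show "f u \<in> {\<zero>\<^bsub>Q\<^esub>} \<longleftrightarrow> u \<in> Gamma_B ?H" if u: "u \<in> carrier ?H" for u
    proof -
      obtain a where "a \<in> cycles F 0" "u = ?c a" using u unfolding Hcar by blast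
      then show ?thesis by (simp only: f Gamma Q_simps(3) coset_zero_iff singleton_iff)
    qed
    show "\<exists>u\<in>carrier ?H. {\<zero>\<^bsub>Q\<^esub>} +>\<^bsub>Q\<^esub> w = {\<zero>\<^bsub>Q\<^esub>} +>\<^bsub>Q\<^esub> f u" if w: "w \<in> carrier Q" for w
    proof -
      obtain s where s: "w = cst s" using w by (auto simp: Q_simps)
      obtain v where v: "v \<in> fcar (gens F 0)" "s - E v \<in> I" using eps_onto by blast
      then have "w = f (?c v)" using s f[of v] cyc0 ideal_coset_eq by simp
      then show ?thesis using v(1) cyc0 Hcar by blast
    qed
    show "\<exists>u\<in>part ?H d. {\<zero>\<^bsub>Q\<^esub>} +>\<^bsub>Q\<^esub> w = {\<zero>\<^bsub>Q\<^esub>} +>\<^bsub>Q\<^esub> f u" if w: "w \<in> part Q d" for w d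
    proof -
      obtain s where s: "s \<in> cox_part d" "w = cst s" using w by (auto simp: Q_simps)
      obtain v where v: "v \<in> Fp 0 d" "s - E v \<in> I" using eps_onto_part[OF s(1)] by blast
      then have "w = f (?c v)" using s f[of v] cyc0 fpart_fcar[OF v(1)] ideal_coset_eq by simp
      then show ?thesis using v(1) Hpart by blast
    qed
  qed
  then show ?thesis
    unfolding virtual_resolution_def using graded hom by blast
qed

text \<open>Every form of nonzero degree is a combination of variables. So \<open>F\<^sub>0\<close>
  is generated in degree 0 and survives truncation entirely.\<close>

lemma kex_0: assumes "d \<noteq> 0" shows "kex gmul vdeg UNIV cox_part I 0 d"
  unfolding cox.kex_0_iff[OF ideal_facts(1)]
proof
  fix f :: "'k cox" assume f: "f \<in> cox_part d"
  have "\<exists>v\<in>UNIV. lk m v \<noteq> 0" if "lk f m \<noteq> 0" for m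
    using cox_partD[OF f that] assms by (intro exists_var) auto
  then obtain w where "w \<in> kel vdeg UNIV cox_part (Suc 0) d" "kd gmul UNIV w {} = f"
    using cox_part_in_vars[OF f] by blast
  then show "\<exists>u\<in>kel vdeg UNIV cox_part (Suc 0) d. f - kd gmul UNIV u {} \<in> I"
    using ideal_facts(1) by (intro bexI[of _ w]) simp_all
qed

text \<open>Only surjectivity at \<open>(n, 0)\<close> enters: it bounds the
  \<open>x\<close>-degrees of generators and gives exactness in \<open>x\<close>-degrees from
  \<open>n\<close> on. Beyond position 3 all generators have \<open>y\<close>-degree above 2, so
  none are kept.\<close>

lemma virtual_of_pair_resolution:
  assumes F: "min_resolution I F eps" and n: "ev_surj (int n, 0)"
  shows "virtual_resolution (virtual_of_pair F (int n, 0)) Q"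
    and "3 < k \<Longrightarrow> gens (virtual_of_pair F (int n, 0)) k = {}"
proof -
  interpret min_resolution I F eps by (rule F)
  let ?F = "virtual_of_pair F (int n, 0)"
  have pos: "0 \<le> gdeg F k g" if "g \<in> gens F k" for k g
    using gens_imp_not_kex[OF that refl] kex_not_ge_0 by blast
  have G0: "gdeg F 0 g \<le> (int n, 0) + (1, 2)" if "g \<in> gens F 0" for g
  proof -
    have "gdeg F 0 g = 0" using gens_imp_not_kex[OF that refl] kex_0 by blast
    then show ?thesis by (simp add: zero_prod_def)
  qed
  \<comment> \<open>All generators have \<open>x\<close>-degree at most \<open>n + 1\<close>, the
    \<open>x\<close>-degree of the truncation bound, so only the \<open>y\<close>-degree decides
    which ones are kept.\<close>
  have "fst (gdeg F k g) < int n + 2" if "g \<in> gens F k" for k g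
    using gens_imp_not_kex[OF that refl] kex_large_x[OF n, of "fst (gdeg F k g)" k "snd (gdeg F k g)"] by fastforce
  then have low: "gdeg F k g \<le> (int n, 0) + (1, 2)" if "g \<in> gens F k" "snd (gdeg F k g) \<le> 2" for k g
    using that by (force simp: less_eq_prod_def)
  show "virtual_resolution ?F Q"
  proof (rule virtual_resolutionI[of ?F eps n])
    show "aug_complex I ?F eps" by (rule aug_complex_virtual_of_pair[OF G0])
    show "0 \<le> gdeg ?F k g" if "g \<in> gens ?F k" for k g using that pos by simp
    show "v \<in> boundaries ?F k" if "int n \<le> p" "v \<in> aug_complex.Zp I ?F eps k (p, q)" for k p q v
    proof -
      have "\<exists>w\<in>fpart (gens ?F (Suc k)) (gdeg F (Suc k)) (p, q). boundary ?F (Suc k) w = v"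
        by (rule truncation_exact[OF G0 low _ kex_Y[OF n that(1)] that(2)]) auto
      then show ?thesis using fpart_fcar by (fastforce simp: boundaries_def)
    qed
  qed
  show "gens ?F k = {}" if "3 < k"
  proof -
    have False if "g \<in> gens F k" "gdeg F k g \<le> (int n, 0) + (1, 2)" for g
      using gens_imp_not_kex[OF that(1) refl] kex_ge_4[of k "snd (gdeg F k g)" "fst (gdeg F k g)"]
        that(2) \<open>3 < k\<close> by (simp add: less_eq_prod_def)
    then show ?thesis by auto
  qed
qed

lemma generic_resolution:
  assumes X: "card X \<ge> 2" and gen: "generic_hilbert_matrix X"
  shows "\<exists>F. minimal_free_resolution F Q"
    and "minimal_free_resolution F Q \<Longrightarrow> virtual_resolution (virtual_of_pair F (int (card X) - 1, 0)) Q"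
    and "minimal_free_resolution F Q \<Longrightarrow> complex_length (virtual_of_pair F (int (card X) - 1, 0)) 3"
proof -
  obtain m where m: "card X = m + 2" using X by (metis add.commute le_Suc_ex)
  \<comment> \<open>With \<open>m = N - 2\<close>, the number of forms is \<open>m + 2\<close> in
    degree \<open>(m + 1, 0)\<close>, \<open>3 (m + 1)\<close> in degree \<open>(m, 1)\<close>, but
    only \<open>m + 1\<close> in degree \<open>(m, 0)\<close>, to be compared with
    \<open>N = m + 2\<close>.\<close>
  have s1: "ev_surj (int (m + 1), 0)" and s2: "ev_surj (int m, 1)" and s3: "\<not> ev_surj (int m, 0)"
    using ev_surj_generic[OF gen, of "m + 1" 0] ev_surj_generic[OF gen, of m 1] ev_surj_generic[OF gen, of m 0]
    by (simp_all add: m choose_two)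
  have s4: "ev_surj (0, int (m + 1))"
    using ev_surj_generic[OF gen, of 0 "m + 1"] by (simp add: m choose_two)
  have deg: "(int (card X) - 1, 0 :: int) = (int (m + 1), 0)" by (simp add: m)
  \<comment> \<open>The box is the complement, among nonnegative degrees, of
    \<open>i \<ge> m + 3\<close> and \<open>j \<ge> m + 4\<close>: the surjectivity bound
    \<open>m + 1\<close> in each direction, plus the two \<open>x\<close> or the three
    \<open>y\<close>.\<close>
  define Bx where "Bx = {0..int (m + 2)} \<times> {0..int (m + 3)}"
  have kexB: "kex gmul vdeg UNIV cox_part I a d" if dB: "d \<notin> Bx" for a d
  proof -
    obtain i j where d: "d = (i, j)" by (cases d)
    consider "\<not> 0 \<le> d" | "int (m + 1) + 2 \<le> i" | "int (m + 1) + 3 \<le> j"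
      using dB by (force simp: d Bx_def zero_prod_def)
    then show ?thesis
      using kex_not_ge_0 kex_large_x[OF s1, of i] kex_large_y[OF s4, of j] d by cases auto
  qed
  have proper: "lk f 0 = 0" if f: "f \<in> I" "f \<in> cox_part d" for f d
  proof (rule ccontr)
    assume nz: "lk f 0 \<noteq> 0"
    then have "f = cox_const (lk f 0)" using cox_partD[OF f(2) nz] cox_part_0_const f(2) by simp
    moreover have "X \<noteq> {}" using X by auto
    then obtain P where "P \<in> X" by blast
    ultimately show False using ideal_ev[OF f(1)] nz by (metis eval_mpoly_const)
  qed
  have fin: "finite Bx" by (simp add: Bx_def)
  have "\<exists>F. min_resolution I F (\<lambda>_. 1) \<and> gens F 0 = {0} \<and> gdeg F 0 = (\<lambda>_. 0)"
    by (rule exists_min_resolution[OF proper fin _ kexB]) (auto simp: Bx_def zero_prod_def)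
  then show "\<exists>F. minimal_free_resolution F Q" using minimal_of_min_resolution by blast
  assume "minimal_free_resolution F Q"
  then obtain eps where F: "min_resolution I F eps" using min_resolution_of_minimal by blast
  interpret min_resolution I F eps by (rule F)
  show "virtual_resolution (virtual_of_pair F (int (card X) - 1, 0)) Q"
    unfolding deg by (rule virtual_of_pair_resolution(1)[OF F s1])
  \<comment> \<open>This degree is \<open>(N, 2)\<close>, the corner of the truncation, so the
    generator it produces is still kept.\<close>
  have "\<not> kex gmul vdeg UNIV cox_part I 3 (int m + 2, 2)"
    using not_kex_3[of "int m"] s1 s2 s3 by (simp add: add.commute)
  then obtain g where "g \<in> gens F 3" "gdeg F 3 g = (int m + 2, 2)"
    using not_kex_imp_gens[of 2 "(int m + 2, 2)"] by (auto simp: eval_nat_numeral)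
  then have "gens (virtual_of_pair F (int (card X) - 1, 0)) 3 \<noteq> {}"
    by (auto simp: deg)
  then show "complex_length (virtual_of_pair F (int (card X) - 1, 0)) 3"
    unfolding complex_length_def deg using virtual_of_pair_resolution(2)[OF F s1] by blast
qed

end

theorem theorem1p3:
  fixes X :: "'k::alg_closed_field point set"
  assumes "weakened_mrc TYPE('k)"
    and "X \<subseteq> P1xP2" and "finite X" and "card X \<ge> 2"
    and "sufficiently_general X"
  shows "(\<exists>F. minimal_free_resolution F (coord_ring X)) \<and>
    (\<forall>F. minimal_free_resolution F (coord_ring X) \<longrightarrow>
       virtual_resolution (virtual_of_pair F (int (card X) - 1, 0)) (coord_ring X) \<and>
       complex_length (virtual_of_pair F (int (card X) - 1, 0)) 3)"
proof -
  interpret points X by unfold_locales (use assms in auto)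
  have "generic_hilbert_matrix X" using assms(5) by (simp add: sufficiently_general_def)
  then show ?thesis using generic_resolution[OF assms(4)] by blast
qed

end
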